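(* For every non-collinear class $\mathbb B\in N(\mathfrak B)$ with $h(\mathbb B)>0$ the product $Q_{\mathbb B}(x,y)$ lies in $\mathbb C\{x,y\}$, and $Q_{B_*}(x,y)\in\mathbb C\{x,y\}$. Hence $$J_{(f,g)}(x,y)=\text{unit}\cdot y^E\cdot Q_{B_*}(x,y)\cdot\prod_{\mathbb B}P_{\mathbb B}(x,y)\cdot Q_{\mathbb B}(x,y),\qquad E\ge0,$$ where $\mathbb B$ runs over the classes in $N(\mathfrak B)$ with $h(\mathbb B)>0$, is a decomposition in $\mathbb C\{x,y\}$.
   Context: SETTING. Let $f,g:(\mathbb C^2,O)\to(\mathbb C,O)$ be holomorphic germs in coordinates $(x,y)$, with Newton–Puiseux factorisations $f=u\,y^{E_1}\prod_{i=1}^p[x-\alpha_i(y)]$, $g=u'\,y^{E_2}\prod_{j=1}^q[x-\beta_j(y)]$, where $E_1,E_2\ge 0$, $u,u'$ are units and $\alpha_i,\beta_j$ are fractional power series in $y$ of positive order $O_y$. Write $\lambda_1,\dots,\lambda_N$ ($N=p+q\ge1$) for $\alpha_1,\dots,\alpha_p,\beta_1,\dots,\beta_q$; they are assumed pairwise distinct. Put $O(\lambda,\mu):=O_y(\lambda(y)-\mu(y))$ (contact order). An arc is a fractional power series in $y$. Let $J=J_{(f,g)}=f_yg_x-f_xg_y$. A polar root is a Newton–Puiseux root $x=\gamma(y)$ of $J$ with $O_y(\gamma)>0$ and $f(\gamma(y),y)g(\gamma(y),y)\ne0$; let $\gamma_j$ be the polar roots, listed with multiplicity. TREE $T(f,g)$.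 The ground bar $B_*$ has height $h(B_* )=0$ and carries one trunk (the main trunk), consisting of all $\lambda_k$. On top of each trunk there is one bar $B$ whose height $h(B)$ is the minimum of the contact orders between members of the trunk ($\infty$ if the trunk has one member); the members of the trunk are divided into classes by $\lambda\equiv\mu$ iff $O(\lambda,\mu)>h(B)$, and each class is a trunk growing on $B$; continue recursively. Bars of infinite height are omitted: "bar" means bar of finite height. A trunk consisting of $s$ of the $\alpha_i$ and $t$ of the $\beta_j$ has bimultiplicity $[s,t]$. For a bar $B$ and a root $\lambda_k$ in a trunk on $B$, let $\lambda_B$ be $\lambda_k$ with all terms $y^e$, $e\ge h(B)$, omitted (independent of the choice of $\lambda_k$; $\lambda_{B_*}=0$). Then $\lambda_k=\lambda_B+cy^{h(B)}+\cdots$, and the trunk containing $\lambda_k$ is said to grow on $B$ at $c\in\mathbb C$ (the main trunk grows on $B_*$ at $0$). If $B'$ is the bar on top of a trunk growing on $B$ at $c$, then $B'$ is a postbar of $B$ supported at $c$, written $B\perp_cB'$ or $B\perp B'$. If $B\perp_c B_1\perp\cdots\perp B'$ (or $B\perp_cB'$), then $B'$ lies above $B$, and lies over $c$. An arc $\xi$ climbs over $B$ at $a\in\mathbb C$ if $\xi=\lambda_B+ay^{h(B)}+\cdots$ ($\cdots$ meaning higher order terms); if moreover no trunk grows on $B$ at $a$, then $\xi$ leaves the tree on $B$ at $a$. $\xi$ is bounded by $B$ if $O(\xi,\lambda_B)<h(B)$. COLLINEARITY. For a bar $B$ and $F\in\{f,g\}$ let $\nu_F(B):=O_y(F(\lambda_B(y)+zy^{h(B)},y))$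 for generic $z$ (so $\nu_f(B_* )=E_1$, $\nu_g(B_* )=E_2$). Let the trunks on $B$ grow at $z_1,\dots,z_l$ with bimultiplicities $[p_k,q_k]$; put $\Delta_B(z_k):=\nu_f(B)q_k-\nu_g(B)p_k$. The point $z_k$ is collinear if $\Delta_B(z_k)=0$ and non-collinear otherwise; $C(B)$, $N(B)$ are the sets of collinear and non-collinear points. $B$ is collinear if $N(B)=\emptyset$, non-collinear otherwise, purely non-collinear if $C(B)=\emptyset\neq N(B)$. COVER. For $c\in C(B)$, a set of non-collinear bars $\{\bar B_1,\dots,\bar B_l\}$ is a cover of $c$ if: (i) each $\bar B_s$ lies over $c$ and there is a sequence $B\perp B_1^*\perp\cdots\perp B^*_{r(s)}\perp\bar B_s$ with $B\perp_cB_1^*$, where either $r(s)=0$ (i.e. $B\perp_c\bar B_s$) or all $B_i^*$ are collinear; (ii) each root $\lambda_k$ climbing over $B$ at $c$ also climbs over a unique $\bar B_s$. Every $c\in C(B)$ has a unique cover. CONJUGATE BARS. Bars $B,\bar B$ are conjugate, $B\sim\bar B$, if $h(B)=h(\bar B)$ and there is an irreducible $p(x,y)\in\mathbb C\{x,y\}$ one of whose Newton–Puiseux roots climbs over $B$ and one of whose roots climbs over $\bar B$. This is an equivalence relation; $\mathfrak B$ is the set of equivalence classes. All bars of a class $\mathbb B$ have the same height $h(\mathbb B)$ and are all collinear or all non-collinear (resp. all or none purely non-collinear), and $\mathbb B$ is called accordingly; $N(\mathfrak B)$ is the set of non-collinear classes. FACTORS. For $\mathbb B\in N(\mathfrak B)$,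 $P_{\mathbb B}(x,y):=\prod_j[x-\gamma_j(y)]$ over all $j$ such that $\gamma_j$ leaves the tree on some $B\in\mathbb B$. For $\mathbb B\in N(\mathfrak B)$ with $h(\mathbb B)>0$, $Q_{\mathbb B}(x,y):=\prod_j[x-\gamma_j(y)]$ over all $j$ such that $\gamma_j$ climbs over some $B\in\mathbb B$ at some $c\in C(B)$ and is bounded by every bar of the cover of $c$ ($Q_{\mathbb B}:=1$ if $\mathbb B$ is purely non-collinear). $Q_{B_*}(x,y):=\prod_j[x-\gamma_j(y)]$ over all $j$ such that $\gamma_j$ is bounded by every minimal non-collinear bar, i.e. every non-collinear bar which does not lie above another non-collinear bar (if $B_*$ is collinear these are the bars of the cover of $0\in C(B_* )$). Empty products are $1$. *)

theory Defs
  imports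
    "HOL-Analysis.Infinite_Sum"
    "HOL-Library.Extended"
    "HOL-Computational_Algebra.Formal_Power_Series"
begin

unbundle fps_syntax

section \<open>Convergent power series in two variables\<close>

text \<open>An element \<open>F\<close> of type \<^typ>\<open>complex fps fps\<close> is read as the double power series with
  \<open>F $ i $ j\<close> the coefficient of \<open>x^i y^j\<close>.\<close>

definition convergent2 :: "complex fps fps \<Rightarrow> bool" where
  "convergent2 F \<longleftrightarrow>
     (\<exists>r>0. (\<lambda>(i, j). norm (F $ i $ j) * r ^ (i + j)) summable_on (UNIV :: (nat \<times> nat) set))"

lemma convergent2_iff_bound:
  "convergent2 F \<longleftrightarrow> (\<exists>r>0. \<exists>M. \<forall>i j. norm (F $ i $ j) * r ^ (i + j) \<le> M)"
proof
  assume "convergent2 F"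
  then obtain r where r: "r > 0"
    and s: "(\<lambda>(i, j). norm (F $ i $ j) * r ^ (i + j)) summable_on (UNIV :: (nat \<times> nat) set)"
    unfolding convergent2_def by blast
  have "norm (F $ i $ j) * r ^ (i + j) \<le>
      infsum (\<lambda>(i, j). norm (F $ i $ j) * r ^ (i + j)) UNIV" for i j
    using finite_sum_le_infsum[OF s, of "{(i, j)}"] r by auto
  then show "\<exists>r>0. \<exists>M. \<forall>i j. norm (F $ i $ j) * r ^ (i + j) \<le> M"
    using r by blast
next
  assume "\<exists>r>0. \<exists>M. \<forall>i j. norm (F $ i $ j) * r ^ (i + j) \<le> M"
  then obtain r M where r: "r > 0" and M: "\<And>i j. norm (F $ i $ j) * r ^ (i + j) \<le> M"
    by blast
  let ?g = "\<lambda>(i, j). M * (1/2) ^ (i + j) :: real"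
  have geo: "((\<lambda>j. (1/2::real) ^ j) has_sum 2) UNIV"
    using geometric_sums[of "1/2::real"]
    by (intro norm_summable_imp_has_sum) (auto simp: summable_geometric)
  have "?g summable_on (UNIV \<times> UNIV)"
  proof (rule summable_on_SigmaI)
    show "((\<lambda>j. ?g (i, j)) has_sum (M * (1/2) ^ i * 2)) UNIV" for i
      using has_sum_cmult_right[OF geo, of "M * (1/2) ^ i"] by (simp add: power_add mult_ac)
    show "(\<lambda>i. M * (1/2) ^ i * 2 :: real) summable_on UNIV"
      using summable_on_cmult_right[OF has_sum_imp_summable[OF geo], of "M * 2"]
      by (simp add: mult_ac)
    have "0 \<le> M" using M[of 0 0] order_trans[OF norm_ge_zero, of "F $ 0 $ 0" M] by simp
    then show "?g (i, j) \<ge> 0" for i j by simp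
  qed
  then have g: "?g summable_on UNIV" by simp
  have "(\<lambda>p. norm ((\<lambda>(i, j). norm (F $ i $ j) * (r/2) ^ (i + j)) p)) summable_on
      (UNIV :: (nat \<times> nat) set)"
  proof (rule abs_summable_on_comparison_test'[OF g])
    fix p :: "nat \<times> nat"
    obtain i j where p: "p = (i, j)" by force
    have "norm (F $ i $ j) * r ^ (i + j) * (1/2) ^ (i + j) \<le> M * (1/2) ^ (i + j)"
      by (rule mult_right_mono[OF M]) simp
    then show "norm ((\<lambda>(i, j). norm (F $ i $ j) * (r/2) ^ (i + j)) p) \<le> ?g p"
      using r by (simp add: p power_divide abs_mult)
  qed
  then have "(\<lambda>(i, j). norm (F $ i $ j) * (r/2) ^ (i + j)) summable_on (UNIV :: (nat \<times> nat) set)"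
    using r by (simp add: case_prod_unfold abs_mult)
  then show "convergent2 F"
    unfolding convergent2_def using r by (intro exI[of _ "r/2"]) auto
qed

lemma convergent2_common_bound:
  assumes "convergent2 F" "convergent2 G"
  obtains r M where "r > 0" "M \<ge> 0"
    "\<And>i j. norm (F $ i $ j) * r ^ (i + j) \<le> M" "\<And>i j. norm (G $ i $ j) * r ^ (i + j) \<le> M"
proof -
  obtain r1 M1 where 1: "r1 > 0" "\<And>i j. norm (F $ i $ j) * r1 ^ (i + j) \<le> M1"
    using assms(1) unfolding convergent2_iff_bound by blast
  obtain r2 M2 where 2: "r2 > 0" "\<And>i j. norm (G $ i $ j) * r2 ^ (i + j) \<le> M2"
    using assms(2) unfolding convergent2_iff_bound by blast
  let ?r = "min r1 r2" and ?M = "max 0 (max M1 M2)"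
  have "norm (F $ i $ j) * ?r ^ (i + j) \<le> ?M" for i j
  proof -
    have "norm (F $ i $ j) * ?r ^ (i + j) \<le> norm (F $ i $ j) * r1 ^ (i + j)"
      using 1(1) 2(1) by (intro mult_left_mono power_mono) auto
    with 1(2)[of i j] show ?thesis by linarith
  qed
  moreover have "norm (G $ i $ j) * ?r ^ (i + j) \<le> ?M" for i j
  proof -
    have "norm (G $ i $ j) * ?r ^ (i + j) \<le> norm (G $ i $ j) * r2 ^ (i + j)"
      using 1(1) 2(1) by (intro mult_left_mono power_mono) auto
    with 2(2)[of i j] show ?thesis by linarith
  qed
  ultimately show ?thesis using that[of ?r ?M] 1(1) 2(1) by auto
qed

lemma convergent2_add: "convergent2 F \<Longrightarrow> convergent2 G \<Longrightarrow> convergent2 (F + G)"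
proof -
  assume "convergent2 F" "convergent2 G"
  then obtain r M where r: "r > 0" "M \<ge> 0"
    and F: "\<And>i j. norm (F $ i $ j) * r ^ (i + j) \<le> M"
    and G: "\<And>i j. norm (G $ i $ j) * r ^ (i + j) \<le> M"
    by (rule convergent2_common_bound) blast
  have "norm ((F + G) $ i $ j) * r ^ (i + j) \<le> M + M" for i j
  proof -
    have "norm ((F + G) $ i $ j) * r ^ (i + j)
        \<le> (norm (F $ i $ j) + norm (G $ i $ j)) * r ^ (i + j)"
      using r by (intro mult_right_mono) (auto intro: norm_triangle_ineq)
    also have "\<dots> \<le> M + M" unfolding distrib_right by (intro add_mono F G)
    finally show ?thesis .
  qed
  then show ?thesis unfolding convergent2_iff_bound using r by blast
qed

lemma Suc_le_two_power: "real (Suc i) \<le> 2 ^ i"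
  by (induction i) auto

lemma convergent2_mult: "convergent2 F \<Longrightarrow> convergent2 G \<Longrightarrow> convergent2 (F * G)"
proof -
  assume "convergent2 F" "convergent2 G"
  then obtain r M where r: "r > 0" "M \<ge> 0"
    and F: "\<And>i j. norm (F $ i $ j) * r ^ (i + j) \<le> M"
    and G: "\<And>i j. norm (G $ i $ j) * r ^ (i + j) \<le> M"
    by (rule convergent2_common_bound) blast
  have "norm ((F * G) $ i $ j) * (r/2) ^ (i + j) \<le> M * M" for i j
  proof -
    have "norm ((F * G) $ i $ j) * r ^ (i + j)
        = norm (\<Sum>a\<le>i. \<Sum>b\<le>j. F $ a $ b * G $ (i - a) $ (j - b)) * r ^ (i + j)"
      by (simp add: fps_mult_nth fps_sum_nth atLeast0AtMost)
    also have "\<dots> \<le> (\<Sum>a\<le>i. \<Sum>b\<le>j. norm (F $ a $ b * G $ (i - a) $ (j - b))) * r ^ (i + j)"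
      using r by (intro mult_right_mono sum_norm_le) (auto intro: sum_norm_le)
    also have "\<dots> = (\<Sum>a\<le>i. \<Sum>b\<le>j. (norm (F $ a $ b) * r ^ (a + b)) *
        (norm (G $ (i - a) $ (j - b)) * r ^ ((i - a) + (j - b))))"
      unfolding sum_distrib_right
    proof (intro sum.cong refl)
      fix a b assume "a \<in> {..i}" "b \<in> {..j}"
      then have "i + j = (a + b) + ((i - a) + (j - b))" by auto
      then have "r ^ (i + j) = r ^ (a + b) * r ^ ((i - a) + (j - b))"
        by (metis power_add)
      then show "norm (F $ a $ b * G $ (i - a) $ (j - b)) * r ^ (i + j) =
          (norm (F $ a $ b) * r ^ (a + b)) *
          (norm (G $ (i - a) $ (j - b)) * r ^ ((i - a) + (j - b)))"
        by (simp add: norm_mult mult_ac)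
    qed
    also have "\<dots> \<le> (\<Sum>a\<le>i. \<Sum>b\<le>j. M * M)"
      using r by (intro sum_mono mult_mono F G) auto
    also have "\<dots> = real (Suc i) * real (Suc j) * (M * M)" by simp
    also have "\<dots> \<le> (2 ^ i * 2 ^ j) * (M * M)"
      using r by (intro mult_right_mono mult_mono Suc_le_two_power) auto
    finally have *: "norm ((F * G) $ i $ j) * r ^ (i + j) \<le> 2 ^ (i + j) * (M * M)"
      by (simp add: power_add)
    have "norm ((F * G) $ i $ j) * (r/2) ^ (i + j)
        = norm ((F * G) $ i $ j) * r ^ (i + j) / 2 ^ (i + j)"
      by (simp add: power_divide)
    also have "\<dots> \<le> M * M"
      using * by (simp add: divide_le_eq mult_ac)
    finally show ?thesis .
  qed
  then show ?thesis unfolding convergent2_iff_bound using r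
    by (intro exI[of _ "r/2"]) auto
qed

lemma convergent2_deriv_aux:
  assumes "convergent2 F"
    and "\<And>i j. \<exists>k. (k = Suc i \<and> norm (G $ i $ j) = real k * norm (F $ k $ j))
                  \<or> (k = Suc j \<and> norm (G $ i $ j) = real k * norm (F $ i $ k))"
  shows "convergent2 G"
proof -
  obtain r M where r: "r > 0" and F: "\<And>i j. norm (F $ i $ j) * r ^ (i + j) \<le> M"
    using assms(1) unfolding convergent2_iff_bound by blast
  have M: "M \<ge> 0" using F[of 0 0] order_trans[OF norm_ge_zero, of "F $ 0 $ 0" M] by simp
  have "norm (G $ i $ j) * (r/2) ^ (i + j) \<le> M / r" for i j
  proof -
    obtain k a b where k: "k \<le> Suc (i + j)" "a + b = Suc (i + j)"
      "norm (G $ i $ j) = real k * norm (F $ a $ b)"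
    proof -
      from assms(2)[of i j] consider
          "norm (G $ i $ j) = real (Suc i) * norm (F $ (Suc i) $ j)"
        | "norm (G $ i $ j) = real (Suc j) * norm (F $ i $ (Suc j))" by blast
      then show ?thesis by cases (rule that[of "Suc i" "Suc i" j] that[of "Suc j" i "Suc j"]; simp)+
    qed
    have "real k \<le> real (Suc (i + j))" using k by linarith
    then have k2: "real k \<le> 2 ^ (i + j)" using Suc_le_two_power order_trans by blast
    have "norm (G $ i $ j) * r ^ (i + j) * r = real k * (norm (F $ a $ b) * r ^ (a + b))"
      using k by simp
    also have "\<dots> \<le> 2 ^ (i + j) * M"
      using k2 F M r by (intro mult_mono) auto
    finally show ?thesis using r
      by (simp add: power_divide divide_le_eq le_divide_eq mult_ac)
  qed
  then show ?thesis unfolding convergent2_iff_bound using r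
    by (intro exI[of _ "r/2"]) auto
qed

lemma convergent2_finite:
  assumes "\<And>i j. i + j > n \<Longrightarrow> F $ i $ j = 0"
  shows "convergent2 F"
proof -
  have "norm (F $ i $ j) \<le> (\<Sum>a\<le>n. \<Sum>b\<le>n. norm (F $ a $ b))" for i j
  proof (cases "i + j \<le> n")
    case True
    have "norm (F $ i $ j) \<le> (\<Sum>b\<le>n. norm (F $ i $ b))"
      using True by (intro member_le_sum) auto
    also have "\<dots> \<le> (\<Sum>a\<le>n. \<Sum>b\<le>n. norm (F $ a $ b))"
      using True by (intro member_le_sum[of i _ "\<lambda>a. \<Sum>b\<le>n. norm (F $ a $ b)"])
        (auto intro: sum_nonneg)
    finally show ?thesis .
  next
    case False
    then show ?thesis using assms[of i j] by (auto intro!: sum_nonneg)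
  qed
  then show ?thesis unfolding convergent2_iff_bound by (intro exI[of _ 1]) auto
qed

text \<open>The ring \<open>\<complex>{x,y}\<close> of germs of holomorphic functions at the origin.\<close>

typedef germ = "{F. convergent2 F}"
  by (intro exI[of _ 0]) (auto intro: convergent2_finite)

setup_lifting type_definition_germ

instantiation germ :: comm_ring_1
begin

lift_definition zero_germ :: germ is 0 by (auto intro: convergent2_finite)
lift_definition one_germ :: germ is 1 by (auto intro: convergent2_finite[of 0])
lift_definition plus_germ :: "germ \<Rightarrow> germ \<Rightarrow> germ" is "(+)" by (rule convergent2_add)
lift_definition times_germ :: "germ \<Rightarrow> germ \<Rightarrow> germ" is "(*)" by (rule convergent2_mult)
lift_definition uminus_germ :: "germ \<Rightarrow> germ" is "uminus" by (simp add: convergent2_def)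
lift_definition minus_germ :: "germ \<Rightarrow> germ \<Rightarrow> germ" is "(-)"
proof -
  fix F G :: "complex fps fps" assume "convergent2 F" "convergent2 G"
  then have "convergent2 (F + - G)" by (intro convergent2_add) (simp_all add: convergent2_def)
  then show "convergent2 (F - G)" by simp
qed

instance
  by standard (transfer; simp add: algebra_simps)+

end

lift_definition germ_coeff :: "germ \<Rightarrow> nat \<Rightarrow> nat \<Rightarrow> complex" is "\<lambda>F i j. F $ i $ j" .

lift_definition germ_y :: germ is "fps_const fps_X"
  by (rule convergent2_finite[of 1]) (auto simp: fps_X_def)

lift_definition deriv_x :: "germ \<Rightarrow> germ" is fps_deriv
proof -
  fix F :: "complex fps fps" assume F: "convergent2 F"
  have "fps_deriv F $ i $ j = of_nat (Suc i) * F $ (Suc i) $ j" for i j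
    by (simp add: fps_of_nat[symmetric] del: of_nat_Suc)
  then show "convergent2 (fps_deriv F)"
    using F by (intro convergent2_deriv_aux[OF F]) (metis norm_mult norm_of_nat)
qed

lift_definition deriv_y :: "germ \<Rightarrow> germ" is "\<lambda>F. Abs_fps (\<lambda>i. fps_deriv (F $ i))"
proof -
  fix F :: "complex fps fps" assume F: "convergent2 F"
  have "Abs_fps (\<lambda>i. fps_deriv (F $ i)) $ i $ j = of_nat (Suc j) * F $ i $ (Suc j)" for i j
    by simp
  then show "convergent2 (Abs_fps (\<lambda>i. fps_deriv (F $ i)))"
    using F by (intro convergent2_deriv_aux[OF F]) (metis norm_mult norm_of_nat)
qed

definition germ_jacobian :: "germ \<Rightarrow> germ \<Rightarrow> germ" where
  "germ_jacobian f g = deriv_y f * deriv_x g - deriv_x f * deriv_y g"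


section \<open>Fractional power series in \<open>y\<close>\<close>

text \<open>A fractional power series is given by its coefficient function; the exponents of the
  nonzero terms are nonnegative and have a common denominator.\<close>

typedef puiseux =
  "{c :: rat \<Rightarrow> complex. \<exists>n>0. \<forall>q. c q \<noteq> 0 \<longrightarrow> (\<exists>k. q = of_nat k / of_nat n)}"
  morphisms pcoeff Abs_puiseux
  by (intro exI[of _ "\<lambda>_. 0"]) auto

setup_lifting type_definition_puiseux

lemma puiseux_eqI: "(\<And>q. pcoeff a q = pcoeff b q) \<Longrightarrow> a = b"
  by (metis pcoeff_inject ext)

lemma of_nat_divide_inject:
  "n > 0 \<Longrightarrow> (of_nat k / of_nat n = (of_nat l / of_nat n :: rat)) \<longleftrightarrow> k = l"
  by (simp add: divide_simps)

text \<open>\<open>ramify n s\<close> is \<open>s (y^(1/n))\<close>.\<close>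

lift_definition ramify :: "nat \<Rightarrow> complex fps \<Rightarrow> puiseux" is
  "\<lambda>n s q. if n > 0 \<and> (\<exists>k. q = of_nat k / of_nat n) then s $ nat \<lfloor>q * of_nat n\<rfloor> else 0"
  subgoal for n by (cases "n > 0") auto
  done

lemma pcoeff_ramify [simp]: "n > 0 \<Longrightarrow> pcoeff (ramify n s) (of_nat k / of_nat n) = s $ k"
  by (auto simp: ramify.rep_eq)

lemma pcoeff_ramify_outside:
  "\<nexists>k. q = of_nat k / of_nat n \<Longrightarrow> pcoeff (ramify n s) q = 0"
  by (auto simp: ramify.rep_eq)

lemma ex_ramify: "\<exists>n>0. \<exists>s. a = ramify n s"
proof -
  obtain n where n: "n > 0" "\<And>q. pcoeff a q \<noteq> 0 \<Longrightarrow> \<exists>k. q = of_nat k / of_nat n"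
    using pcoeff[of a] by blast
  have "a = ramify n (Abs_fps (\<lambda>k. pcoeff a (of_nat k / of_nat n)))"
  proof (rule puiseux_eqI)
    fix q show "pcoeff a q = pcoeff (ramify n (Abs_fps (\<lambda>k. pcoeff a (of_nat k / of_nat n)))) q"
      using n(2)[of q] by (cases "\<exists>k. q = of_nat k / of_nat n")
        (auto simp: n(1) pcoeff_ramify_outside)
  qed
  with n(1) show ?thesis by blast
qed

lemma ramify_refine:
  assumes "n > 0" "m > 0" shows "\<exists>t. ramify n s = ramify (n * m) t"
proof -
  define t where "t = Abs_fps (\<lambda>k. pcoeff (ramify n s) (of_nat k / of_nat (n * m)))"
  have "ramify n s = ramify (n * m) t"
  proof (rule puiseux_eqI)
    fix q show "pcoeff (ramify n s) q = pcoeff (ramify (n * m) t) q"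
    proof (cases "\<exists>k. q = of_nat k / of_nat (n * m)")
      case True
      then obtain k where q: "q = of_nat k / of_nat (n * m)" by blast
      have "n * m > 0" using assms by simp
      then show ?thesis unfolding q by (simp only: pcoeff_ramify) (simp only: t_def fps_nth_Abs_fps)
    next
      case False
      then have "\<nexists>k. q = of_nat k / of_nat n"
        using assms
        by (metis mult_divide_mult_cancel_right of_nat_0_eq_iff of_nat_mult less_numeral_extra(3))
      with False show ?thesis by (simp add: pcoeff_ramify_outside)
    qed
  qed
  then show ?thesis by blast
qed

lemma ex_ramify2: "\<exists>n>0. \<exists>s t. a = ramify n s \<and> b = ramify n t"
proof -
  obtain n s where 1: "n > 0" "a = ramify n s" using ex_ramify by blast
  obtain m t where 2: "m > 0" "b = ramify m t" using ex_ramify by blast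
  obtain s' where "a = ramify (n * m) s'" using ramify_refine[of n m] 1 2 by metis
  moreover obtain t' where "b = ramify (n * m) t'"
    using ramify_refine[of m n] 1 2 by (metis mult.commute)
  ultimately show ?thesis using 1 2 by (metis nat_0_less_mult_iff)
qed

lemma ex_ramify3: "\<exists>n>0. \<exists>s t v. a = ramify n s \<and> b = ramify n t \<and> c = ramify n v"
proof -
  obtain n s t where 1: "n > 0" "a = ramify n s" "b = ramify n t" using ex_ramify2 by blast
  obtain m v where 2: "m > 0" "c = ramify m v" using ex_ramify by blast
  obtain s' where "a = ramify (n * m) s'" using ramify_refine[of n m] 1 2 by metis
  moreover obtain t' where "b = ramify (n * m) t'" using ramify_refine[of n m] 1 2 by metis
  moreover obtain v' where "c = ramify (n * m) v'"
    using ramify_refine[of m n] 1 2 by (metis mult.commute)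
  ultimately show ?thesis using 1 2 by (metis nat_0_less_mult_iff)
qed

lemma ramify_support:
  "pcoeff (ramify n s) q \<noteq> 0 \<Longrightarrow> \<exists>k. q = of_nat k / of_nat n"
  using pcoeff_ramify_outside by blast

definition convolve :: "(rat \<Rightarrow> complex) \<Rightarrow> (rat \<Rightarrow> complex) \<Rightarrow> rat \<Rightarrow> complex" where
  "convolve a b q = (\<Sum>p | a p \<noteq> 0 \<and> b (q - p) \<noteq> 0. a p * b (q - p))"

lemma convolve_ramify:
  assumes n: "n > 0"
  shows "convolve (pcoeff (ramify n s)) (pcoeff (ramify n t)) = pcoeff (ramify n (s * t))"
proof
  fix q
  let ?a = "pcoeff (ramify n s)" and ?b = "pcoeff (ramify n t)"
  let ?S = "{p. ?a p \<noteq> 0 \<and> ?b (q - p) \<noteq> 0}"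
  have S: "\<exists>i j. p = of_nat i / of_nat n \<and> q - p = of_nat j / of_nat n" if "p \<in> ?S" for p
    using that ramify_support by blast
  show "convolve ?a ?b q = pcoeff (ramify n (s * t)) q"
  proof (cases "\<exists>k. q = of_nat k / of_nat n")
    case True
    then obtain k where q: "q = of_nat k / of_nat n" by blast
    let ?h = "\<lambda>i. of_nat i / of_nat n :: rat"
    have sub: "q - ?h i = ?h (k - i)" if "i \<le> k" for i
      using that by (simp add: q of_nat_diff diff_divide_distrib)
    have "?S \<subseteq> ?h ` {..k}"
    proof
      fix p assume "p \<in> ?S"
      then obtain i j where ij: "p = ?h i" "q - p = ?h j" using S by blast
      then have "?h k = ?h (i + j)" by (simp add: q add_divide_distrib algebra_simps)
      then have "k = i + j" using n by (simp add: of_nat_divide_inject del: of_nat_add)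
      then show "p \<in> ?h ` {..k}" using ij by auto
    qed
    then have "convolve ?a ?b q = (\<Sum>p\<in>?h ` {..k}. ?a p * ?b (q - p))"
      unfolding convolve_def by (intro sum.mono_neutral_left) auto
    also have "\<dots> = (\<Sum>i\<le>k. ?a (?h i) * ?b (q - ?h i))"
      using n by (subst sum.reindex) (auto simp: inj_on_def)
    also have "\<dots> = (\<Sum>i\<le>k. s $ i * t $ (k - i))"
      using n by (intro sum.cong refl) (simp only: sub atMost_iff pcoeff_ramify)
    also have "\<dots> = (s * t) $ k" by (simp add: fps_mult_nth atLeast0AtMost)
    also have "\<dots> = pcoeff (ramify n (s * t)) q" using n q by simp
    finally show ?thesis .
  next
    case False
    have "?S = {}"
    proof (rule ccontr)
      assume "?S \<noteq> {}"
      then obtain p where "p \<in> ?S" by blast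
      then obtain i j where "p = of_nat i / of_nat n" "q - p = of_nat j / of_nat n"
        using S by blast
      then have "q = of_nat (i + j) / of_nat n" by (simp add: add_divide_distrib algebra_simps)
      with False show False by blast
    qed
    then have "convolve ?a ?b q = 0" unfolding convolve_def by (simp only: sum.empty)
    then show ?thesis using False by (simp add: pcoeff_ramify_outside)
  qed
qed

instantiation puiseux :: comm_ring_1
begin

lift_definition zero_puiseux :: puiseux is "\<lambda>_. 0" by auto
lift_definition one_puiseux :: puiseux is "\<lambda>q. if q = 0 then 1 else 0"
  by (intro exI[of _ 1]) auto
lift_definition uminus_puiseux :: "puiseux \<Rightarrow> puiseux" is "\<lambda>a q. - a q" by auto
lift_definition plus_puiseux :: "puiseux \<Rightarrow> puiseux \<Rightarrow> puiseux" is "\<lambda>a b q. a q + b q"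
proof -
  fix a b :: "rat \<Rightarrow> complex"
  assume a: "\<exists>n>0. \<forall>q. a q \<noteq> 0 \<longrightarrow> (\<exists>k. q = of_nat k / of_nat n)"
    and b: "\<exists>n>0. \<forall>q. b q \<noteq> 0 \<longrightarrow> (\<exists>k. q = of_nat k / of_nat n)"
  obtain n s t where n: "n > 0" and *: "Abs_puiseux a = ramify n s" "Abs_puiseux b = ramify n t"
    using ex_ramify2 by blast
  have "a = pcoeff (Abs_puiseux a)" "b = pcoeff (Abs_puiseux b)"
    using a b by (simp_all add: Abs_puiseux_inverse)
  then have ab: "a = pcoeff (ramify n s)" "b = pcoeff (ramify n t)"
    unfolding * by this+
  have "\<exists>k. q = of_nat k / of_nat n" if "a q + b q \<noteq> 0" for q
    using that ramify_support[of n s q] ramify_support[of n t q] unfolding ab by force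
  with n show "\<exists>n>0. \<forall>q. a q + b q \<noteq> 0 \<longrightarrow> (\<exists>k. q = of_nat k / of_nat n)"
    by blast
qed
definition minus_puiseux :: "puiseux \<Rightarrow> puiseux \<Rightarrow> puiseux" where "a - b = a + - (b :: puiseux)"
lift_definition times_puiseux :: "puiseux \<Rightarrow> puiseux \<Rightarrow> puiseux" is convolve
proof -
  fix a b :: "rat \<Rightarrow> complex"
  assume a: "\<exists>n>0. \<forall>q. a q \<noteq> 0 \<longrightarrow> (\<exists>k. q = of_nat k / of_nat n)"
    and b: "\<exists>n>0. \<forall>q. b q \<noteq> 0 \<longrightarrow> (\<exists>k. q = of_nat k / of_nat n)"
  obtain n s t where n: "n > 0" and *: "Abs_puiseux a = ramify n s" "Abs_puiseux b = ramify n t"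
    using ex_ramify2 by blast
  have "a = pcoeff (Abs_puiseux a)" "b = pcoeff (Abs_puiseux b)"
    using a b by (simp_all add: Abs_puiseux_inverse)
  then have ab: "a = pcoeff (ramify n s)" "b = pcoeff (ramify n t)"
    unfolding * by this+
  show "\<exists>n>0. \<forall>q. convolve a b q \<noteq> 0 \<longrightarrow> (\<exists>k. q = of_nat k / of_nat n)"
    unfolding ab convolve_ramify[OF n] using n ramify_support by blast
qed

lemma ramify_mult: "n > 0 \<Longrightarrow> ramify n s * ramify n t = ramify n (s * t)"
  by (rule puiseux_eqI) (simp add: times_puiseux.rep_eq convolve_ramify)

lemma ramify_add: "ramify n s + ramify n t = ramify n (s + t)"
  by (rule puiseux_eqI) (simp add: plus_puiseux.rep_eq ramify.rep_eq)

lemma ramify_1: "n > 0 \<Longrightarrow> ramify n 1 = 1"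
  by (rule puiseux_eqI) (auto simp: one_puiseux.rep_eq ramify.rep_eq dest: spec[of _ 0])

instance
proof
  fix a b c :: puiseux
  obtain n s t v where r: "n > 0" "a = ramify n s" "b = ramify n t" "c = ramify n v"
    using ex_ramify3 by blast
  show "a * b * c = a * (b * c)" "a * b = b * a" "(a + b) * c = a * c + b * c"
    using r by (simp_all add: ramify_mult ramify_add algebra_simps)
  show "1 * a = a" using r by (metis ramify_1 ramify_mult mult_1)
  show "a + b + c = a + (b + c)" "a + b = b + a" "0 + a = a" "- a + a = 0"
    by (transfer; simp add: fun_eq_iff algebra_simps)+
  show "a - b = a + - b" by (rule minus_puiseux_def)
  show "(0::puiseux) \<noteq> 1" by transfer (auto simp: fun_eq_iff)
qed

end

text \<open>\<open>monomial c e\<close> is \<open>c y^e\<close> for \<open>e \<ge> 0\<close> (and \<open>0\<close> for \<open>e < 0\<close>, which never occurs below).\<close>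

lift_definition monomial :: "complex \<Rightarrow> rat \<Rightarrow> puiseux" is
  "\<lambda>c e q. if q = e \<and> e \<ge> 0 then c else 0"
proof -
  fix c :: complex and e :: rat
  obtain a b where ab: "quotient_of e = (a, b)" by force
  then have b: "b > 0" and e: "e = of_int a / of_int b"
    by (auto simp: quotient_of_denom_pos quotient_of_div)
  show "\<exists>n>0. \<forall>q. (if q = e \<and> e \<ge> 0 then c else 0) \<noteq> 0 \<longrightarrow> (\<exists>k. q = of_nat k / of_nat n)"
  proof (cases "e \<ge> 0")
    case True
    then have "a \<ge> 0" using b e by (simp add: zero_le_divide_iff)
    then have "e = of_nat (nat a) / of_nat (nat b)" using b e by simp
    then show ?thesis using b by (intro exI[of _ "nat b"]) auto
  qed auto
qed

text \<open>This is \<open>O_y\<close>, with value \<open>\<infinity>\<close> at \<open>0\<close>.\<close>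

definition ord_y :: "puiseux \<Rightarrow> rat extended" where
  "ord_y a = (if a = 0 then Pinf else Fin (LEAST q. pcoeff a q \<noteq> 0))"

definition contact :: "puiseux \<Rightarrow> puiseux \<Rightarrow> rat extended" where
  "contact a b = ord_y (a - b)"

lift_definition truncate_below :: "rat \<Rightarrow> puiseux \<Rightarrow> puiseux" is
  "\<lambda>h a q. if q < h then a q else 0"
  by auto


section \<open>Substitution and Newton--Puiseux roots\<close>

text \<open>Products of factors \<open>x - \<gamma>(y)\<close> live in \<^typ>\<open>puiseux fps\<close>, the power series in \<open>x\<close>
  whose coefficients are fractional power series in \<open>y\<close>; \<open>of_germ\<close> maps \<open>\<complex>{x,y}\<close> into it.\<close>

definition of_germ :: "germ \<Rightarrow> puiseux fps" where
  "of_germ F = Abs_fps (\<lambda>i. ramify 1 (Rep_germ F $ i))"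

definition root_factor :: "puiseux \<Rightarrow> puiseux fps" where
  "root_factor \<gamma> = fps_X - fps_const \<gamma>"

text \<open>\<open>subst F \<xi>\<close> is \<open>F(\<xi>(y), y)\<close>, formed coefficient by coefficient. If \<open>\<xi>\<close> has positive order
  the sum for each coefficient is finite. If \<open>\<xi>\<close> has order \<open>0\<close>, which is needed only to define
  \<open>\<nu>\<close> on the ground bar, it converges when the constant term of \<open>\<xi>\<close> is small.\<close>

definition subst :: "germ \<Rightarrow> puiseux \<Rightarrow> puiseux" where
  "subst F \<xi> = Abs_puiseux (\<lambda>q. \<Sum>i. pcoeff (of_germ F $ i * \<xi> ^ i) q)"

lemma ramify_power: "n > 0 \<Longrightarrow> ramify n s ^ i = ramify n (s ^ i)"
  by (induction i) (simp_all add: ramify_1 ramify_mult)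

lemma pcoeff_subst: "pcoeff (subst F \<xi>) q = (\<Sum>i. pcoeff (of_germ F $ i * \<xi> ^ i) q)"
proof -
  obtain n s where n: "n > 0" and s: "\<xi> = ramify n s" using ex_ramify by blast
  have "\<exists>t. of_germ F $ i * \<xi> ^ i = ramify n t" for i
  proof -
    obtain t where "ramify 1 (Rep_germ F $ i) = ramify (1 * n) t"
      using ramify_refine[of 1 n] n by auto
    then show ?thesis
      using n by (auto simp: of_germ_def s ramify_power ramify_mult)
  qed
  then have supp: "pcoeff (of_germ F $ i * \<xi> ^ i) q \<noteq> 0 \<Longrightarrow> \<exists>k. q = of_nat k / of_nat n" for i q
    using ramify_support by metis
  have "(\<Sum>i. pcoeff (of_germ F $ i * \<xi> ^ i) q) \<noteq> 0 \<longrightarrow> (\<exists>k. q = of_nat k / of_nat n)" for q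
  proof (cases "\<exists>k. q = of_nat k / of_nat n")
    case False
    then have "pcoeff (of_germ F $ i * \<xi> ^ i) q = 0" for i using supp by blast
    then show ?thesis by simp
  qed blast
  then have "(\<lambda>q. \<Sum>i. pcoeff (of_germ F $ i * \<xi> ^ i) q) \<in>
      {c. \<exists>n>0. \<forall>q. c q \<noteq> 0 \<longrightarrow> (\<exists>k. q = of_nat k / of_nat n)}"
    using n by blast
  then show ?thesis unfolding subst_def by (simp add: Abs_puiseux_inverse)
qed

definition np_root :: "germ \<Rightarrow> puiseux \<Rightarrow> bool" where
  "np_root F \<gamma> \<longleftrightarrow> 0 < ord_y \<gamma> \<and> subst F \<gamma> = 0"

definition root_multiplicity :: "germ \<Rightarrow> puiseux \<Rightarrow> nat" where
  "root_multiplicity F \<gamma> = Max {m. root_factor \<gamma> ^ m dvd of_germ F}"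

definition polar_root :: "germ \<Rightarrow> germ \<Rightarrow> puiseux \<Rightarrow> bool" where
  "polar_root f g \<gamma> \<longleftrightarrow> np_root (germ_jacobian f g) \<gamma> \<and> subst f \<gamma> * subst g \<gamma> \<noteq> 0"

definition polar_product :: "germ \<Rightarrow> germ \<Rightarrow> (puiseux \<Rightarrow> bool) \<Rightarrow> puiseux fps" where
  "polar_product f g S =
     (\<Prod>\<gamma> | polar_root f g \<gamma> \<and> S \<gamma>. root_factor \<gamma> ^ root_multiplicity (germ_jacobian f g) \<gamma>)"


section \<open>The tree\<close>

text \<open>A trunk is the set of its members. A bar is recorded by its height and the set of all
  roots in the trunks growing on it; apart from the ground bar, this set is the trunk which
  the bar is on top of. Bars of infinite height are not represented.\<close>

datatype bar = Bar (bar_height: rat) (bar_roots: "puiseux set")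

text \<open>On the ground bar, of height \<open>0\<close>, the relation is total since all roots have positive
  order; so the only trunk there is the main trunk.\<close>

definition trunks :: "bar \<Rightarrow> puiseux set set" where
  "trunks B = bar_roots B //
     {(r, s). r \<in> bar_roots B \<and> s \<in> bar_roots B \<and> Fin (bar_height B) < contact r s}"

text \<open>Since \<open>contact r r = \<infinity>\<close>, the pairs on the diagonal only matter if the trunk has a single
  member, where the height of the bar on top is \<open>\<infinity>\<close>.\<close>

definition height_on_top :: "puiseux set \<Rightarrow> rat extended" where
  "height_on_top T = Min ((\<lambda>(r, s). contact r s) ` (T \<times> T))"

definition ground_bar :: "puiseux set \<Rightarrow> bar" where
  "ground_bar \<Lambda> = Bar 0 \<Lambda>"

inductive_set bars :: "puiseux set \<Rightarrow> bar set" for \<Lambda> :: "puiseux set" where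
  ground: "ground_bar \<Lambda> \<in> bars \<Lambda>"
| on_top: "\<lbrakk>B \<in> bars \<Lambda>; T \<in> trunks B; height_on_top T = Fin h\<rbrakk> \<Longrightarrow> Bar h T \<in> bars \<Lambda>"

definition stem :: "bar \<Rightarrow> puiseux" where
  "stem B = truncate_below (bar_height B) (SOME r. r \<in> bar_roots B)"

definition climbs_at :: "bar \<Rightarrow> complex \<Rightarrow> puiseux \<Rightarrow> bool" where
  "climbs_at B a \<xi> \<longleftrightarrow> Fin (bar_height B) < ord_y (\<xi> - (stem B + monomial a (bar_height B)))"

definition climbs_over :: "bar \<Rightarrow> puiseux \<Rightarrow> bool" where
  "climbs_over B \<xi> \<longleftrightarrow> (\<exists>a. climbs_at B a \<xi>)"

definition bounded_by :: "puiseux \<Rightarrow> bar \<Rightarrow> bool" where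
  "bounded_by \<xi> B \<longleftrightarrow> contact \<xi> (stem B) < Fin (bar_height B)"

definition grows_at :: "bar \<Rightarrow> complex \<Rightarrow> puiseux set \<Rightarrow> bool" where
  "grows_at B c T \<longleftrightarrow> T \<in> trunks B \<and> (\<forall>r\<in>T. climbs_at B c r)"

definition growth_points :: "bar \<Rightarrow> complex set" where
  "growth_points B = {c. \<exists>T. grows_at B c T}"

definition trunk_at :: "bar \<Rightarrow> complex \<Rightarrow> puiseux set" where
  "trunk_at B c = (THE T. grows_at B c T)"

definition leaves_tree_on :: "bar \<Rightarrow> puiseux \<Rightarrow> bool" where
  "leaves_tree_on B \<xi> \<longleftrightarrow> (\<exists>a. climbs_at B a \<xi> \<and> a \<notin> growth_points B)"

definition postbar_at :: "bar \<Rightarrow> complex \<Rightarrow> bar \<Rightarrow> bool" where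
  "postbar_at B c B' \<longleftrightarrow>
     grows_at B c (bar_roots B') \<and> height_on_top (bar_roots B') = Fin (bar_height B')"

definition postbar :: "bar \<Rightarrow> bar \<Rightarrow> bool" where
  "postbar B B' \<longleftrightarrow> (\<exists>c. postbar_at B c B')"

definition lies_above :: "bar \<Rightarrow> bar \<Rightarrow> bool" where
  "lies_above B' B \<longleftrightarrow> postbar\<^sup>+\<^sup>+ B B'"

definition lies_over :: "bar \<Rightarrow> bar \<Rightarrow> complex \<Rightarrow> bool" where
  "lies_over B' B c \<longleftrightarrow> (\<exists>B1. postbar_at B c B1 \<and> postbar\<^sup>*\<^sup>* B1 B')"

definition conjugate :: "bar \<Rightarrow> bar \<Rightarrow> bool" where
  "conjugate B B' \<longleftrightarrow> bar_height B = bar_height B' \<and>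
     (\<exists>p :: germ. irreducible p \<and>
        (\<exists>\<xi>. np_root p \<xi> \<and> climbs_over B \<xi>) \<and> (\<exists>\<xi>. np_root p \<xi> \<and> climbs_over B' \<xi>))"

definition bar_classes :: "puiseux set \<Rightarrow> bar set set" where
  "bar_classes \<Lambda> = bars \<Lambda> // {(B, B'). B \<in> bars \<Lambda> \<and> B' \<in> bars \<Lambda> \<and> conjugate B B'}"

definition class_height :: "bar set \<Rightarrow> rat" where
  "class_height \<B> = the_elem (bar_height ` \<B>)"


section \<open>Collinearity\<close>

text \<open>\<open>z\<close> generic means: small and outside a finite set, that is, in a punctured neighbourhood of
  \<open>0\<close>. Smallness is forced on the ground bar, where \<open>\<lambda>_B + z y^0 = z\<close> has to lie in the domain
  of \<open>F\<close>; on a bar of positive height, the leading coefficient is a polynomial in \<open>z\<close>, so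
  the value is the same for all but finitely many \<open>z\<close>.\<close>

definition nu :: "germ \<Rightarrow> bar \<Rightarrow> rat" where
  "nu F B = (THE v. \<forall>\<^sub>F z in at 0. ord_y (subst F (stem B + monomial z (bar_height B))) = Fin v)"

text \<open>From here on \<open>A\<close> is the set of the roots \<open>\<alpha>\<^sub>i\<close> of \<open>f\<close> and \<open>D\<close> the set of the
  roots \<open>\<beta>\<^sub>j\<close> of \<open>g\<close>.\<close>

context
  fixes f g :: germ and A D :: "puiseux set"
begin

definition Delta :: "bar \<Rightarrow> complex \<Rightarrow> rat" where
  "Delta B c = nu f B * of_nat (card (trunk_at B c \<inter> D)) - nu g B * of_nat (card (trunk_at B c \<inter> A))"

definition collinear_points :: "bar \<Rightarrow> complex set" where
  "collinear_points B = {c \<in> growth_points B. Delta B c = 0}"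

definition noncollinear_points :: "bar \<Rightarrow> complex set" where
  "noncollinear_points B = {c \<in> growth_points B. Delta B c \<noteq> 0}"

definition collinear_bar :: "bar \<Rightarrow> bool" where
  "collinear_bar B \<longleftrightarrow> noncollinear_points B = {}"

text \<open>The second disjunct is a chain \<open>B, B\<^sub>1, \<dots>, B\<^sub>r, B'\<close> with all \<open>B\<^sub>i\<close>
  collinear.\<close>

definition is_cover :: "bar \<Rightarrow> complex \<Rightarrow> bar set \<Rightarrow> bool" where
  "is_cover B c S \<longleftrightarrow>
     (\<forall>B'\<in>S. B' \<in> bars (A \<union> D) \<and> \<not> collinear_bar B' \<and> lies_over B' B c \<and>
        (postbar_at B c B' \<or>
         (\<exists>B1 Br. postbar_at B c B1 \<and> collinear_bar B1 \<and>
            (\<lambda>X Y. postbar X Y \<and> collinear_bar Y)\<^sup>*\<^sup>* B1 Br \<and> postbar Br B'))) \<and>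
     (\<forall>r\<in>A \<union> D. climbs_at B c r \<longrightarrow> (\<exists>!B'. B' \<in> S \<and> climbs_over B' r))"

definition cover :: "bar \<Rightarrow> complex \<Rightarrow> bar set" where
  "cover B c = (THE S. is_cover B c S)"

definition noncollinear_classes :: "bar set set" where
  "noncollinear_classes = {\<B> \<in> bar_classes (A \<union> D). \<forall>B\<in>\<B>. \<not> collinear_bar B}"

definition minimal_noncollinear_bars :: "bar set" where
  "minimal_noncollinear_bars =
     {B \<in> bars (A \<union> D). \<not> collinear_bar B \<and>
        \<not> (\<exists>B'\<in>bars (A \<union> D). \<not> collinear_bar B' \<and> lies_above B B')}"

definition P_factor :: "bar set \<Rightarrow> puiseux fps" where
  "P_factor \<B> = polar_product f g (\<lambda>\<gamma>. \<exists>B\<in>\<B>. leaves_tree_on B \<gamma>)"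

definition Q_factor :: "bar set \<Rightarrow> puiseux fps" where
  "Q_factor \<B> = polar_product f g
     (\<lambda>\<gamma>. \<exists>B\<in>\<B>. \<exists>c\<in>collinear_points B. climbs_at B c \<gamma> \<and> (\<forall>B'\<in>cover B c. bounded_by \<gamma> B'))"

definition Q_ground :: "puiseux fps" where
  "Q_ground = polar_product f g (\<lambda>\<gamma>. \<forall>B\<in>minimal_noncollinear_bars. bounded_by \<gamma> B)"

end

end

theory Submission
  imports Defs "HOL-Computational_Algebra.Polynomial_FPS"
    "HOL-Computational_Algebra.Fundamental_Theorem_Algebra"
begin

text \<open>
A root \<open>\<gamma>\<close> of the Jacobian \<open>J\<close> is assigned to a factor by the highest non-collinear bar \<open>B\<close> over which
it climbs. If there is none, \<open>\<gamma>\<close> is bounded by all minimal non-collinear bars and contributes to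
the factor of the ground bar. Otherwise \<open>\<gamma>\<close> climbs over \<open>B\<close> at some point \<open>c\<close>. If no trunk grows
at \<open>c\<close>, then \<open>\<gamma>\<close> leaves the tree and contributes to the factor \<open>P\<close> of \<open>B\<close>. If \<open>c\<close> is collinear,
\<open>\<gamma>\<close> contributes to the factor \<open>Q\<close> of \<open>B\<close>, for the cover of \<open>c\<close> consists of the first
non-collinear bars above \<open>c\<close>, and \<open>\<gamma>\<close> climbs over none of them (\<open>cover_exists\<close>,
\<open>bounded_by_cover_iff\<close>).

The remaining case, a non-collinear point \<open>c\<close>, does not occur
(\<open>no_root_at_noncollinear_point\<close>). The bar on top of the trunk at \<open>c\<close> would be non-collinear again
(\<open>postbar_noncollinear\<close>), so \<open>\<gamma>\<close> stays below it. Let \<open>[p,q]\<close> be the bimultiplicity of the trunk.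
Then \<open>\<gamma>\<close> differs from all members of the trunk by the same term \<open>d y\<^sup>k\<close>, where
\<open>k > h(B)\<close>. Along \<open>\<gamma>\<close>, the quotients \<open>f\<^sub>x/f\<close> and \<open>g\<^sub>x/g\<close> begin with \<open>p/d\<close> and \<open>q/d\<close> times
\<open>y\<^sup>-\<^sup>k\<close>, while \<open>f\<close> and \<open>g\<close> have the orders \<open>\<nu>\<^sub>f(B) + p (k - h(B))\<close> and
\<open>\<nu>\<^sub>g(B) + q (k - h(B))\<close>. By the chain rule \<open>y J = y (f \<circ> \<gamma>)' g\<^sub>x - f\<^sub>x y (g \<circ> \<gamma>)'\<close>, so
\<open>y J / (f g)\<close> begins with \<open>(\<nu>\<^sub>f(B) q - \<nu>\<^sub>g(B) p) / d\<close> times \<open>y\<^sup>-\<^sup>k\<close>, and this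
coefficient is not zero.

That the factors lie in \<open>\<complex>{x,y}\<close> is Galois theory. Continuation of \<open>y\<close> around the origin, \<open>galois\<close>
below, permutes the roots of every germ and hence acts on the tree. The roots of an irreducible
germ form a single orbit (\<open>irreducible_roots_conjugate\<close>), so the classes of conjugate bars are the orbits
of bars (\<open>conjugate_iff\<close>), and the sets of roots described above are invariant. An invariant
product of convergent root factors is a germ (\<open>galois_invariant_imp_germ\<close>).

All of this presupposes that a nonzero germ is a unit times a power of \<open>y\<close> times convergent root factors
(\<open>germ_root_factorization\<close>). The first part of the text proves this, from a convergent
Weierstrass preparation theorem and an induction on the degree for Newton--Puiseux roots.
\<close>


section \<open>Weierstrass preparation\<close>

text \<open>A truncation of the weighted norm \<open>\<Sum> |F\<^sub>i\<^sub>j| a\<^sup>i b\<^sup>j\<close>. Working with a bound on all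
  truncations avoids every question about the convergence of that sum.\<close>

definition wsum :: "real \<Rightarrow> real \<Rightarrow> complex fps fps \<Rightarrow> nat \<Rightarrow> real" where
  "wsum a b F n = (\<Sum>i\<le>n. \<Sum>j\<le>n. norm (F $ i $ j) * a ^ i * b ^ j)"

definition wbound :: "real \<Rightarrow> real \<Rightarrow> complex fps fps \<Rightarrow> real \<Rightarrow> bool" where
  "wbound a b F B \<longleftrightarrow> (\<forall>n. wsum a b F n \<le> B)"

lemma fps_fps_mult_nth:
  "(F * G :: complex fps fps) $ i $ j = (\<Sum>p\<le>i. \<Sum>q\<le>j. F $ p $ q * G $ (i - p) $ (j - q))"
  by (simp add: fps_mult_nth fps_sum_nth atLeast0AtMost)

lemma wsum_nonneg: "a \<ge> 0 \<Longrightarrow> b \<ge> 0 \<Longrightarrow> wsum a b F n \<ge> 0"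
  unfolding wsum_def by (intro sum_nonneg) auto

lemma sum_convolution_le:
  fixes c :: "nat \<Rightarrow> nat \<Rightarrow> real"
  assumes "\<And>p k. c p k \<ge> 0"
  shows "(\<Sum>i\<le>n. \<Sum>p\<le>i. c p (i - p)) \<le> (\<Sum>p\<le>n. \<Sum>k\<le>n. c p k)"
proof -
  have "(\<Sum>i\<le>n. \<Sum>p\<le>i. c p (i - p)) = (\<Sum>(i, j)\<in>{(i, j). i + j \<le> n}. c i j)"
    by (rule sum.triangle_reindex_eq[symmetric])
  also have "\<dots> \<le> (\<Sum>(i, j)\<in>{..n} \<times> {..n}. c i j)"
    using assms by (intro sum_mono2) auto
  also have "\<dots> = (\<Sum>p\<le>n. \<Sum>k\<le>n. c p k)"
    by (simp add: sum.cartesian_product)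
  finally show ?thesis .
qed

lemma wsum_mult:
  assumes "a \<ge> 0" "b \<ge> 0"
  shows "wsum a b (F * G) n \<le> wsum a b F n * wsum a b G n"
proof -
  define f where "f i j = norm (F $ i $ j) * a ^ i * b ^ j" for i j
  define g where "g i j = norm (G $ i $ j) * a ^ i * b ^ j" for i j
  have pos: "f i j \<ge> 0" "g i j \<ge> 0" for i j using assms by (auto simp: f_def g_def)
  have 1: "norm ((F * G) $ i $ j) * a ^ i * b ^ j
      \<le> (\<Sum>p\<le>i. \<Sum>q\<le>j. f p q * g (i - p) (j - q))" for i j
  proof -
    have "norm ((F * G) $ i $ j) * (a ^ i * b ^ j)
        \<le> (\<Sum>p\<le>i. \<Sum>q\<le>j. norm (F $ p $ q * G $ (i - p) $ (j - q))) * (a ^ i * b ^ j)"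
      unfolding fps_fps_mult_nth using assms
      by (intro mult_right_mono sum_norm_le) (auto intro: sum_norm_le)
    also have "\<dots> = (\<Sum>p\<le>i. \<Sum>q\<le>j. f p q * g (i - p) (j - q))"
      unfolding sum_distrib_right
    proof (intro sum.cong refl)
      fix p q assume "p \<in> {..i}" "q \<in> {..j}"
      then have "a ^ i = a ^ p * a ^ (i - p)" "b ^ j = b ^ q * b ^ (j - q)"
        by (simp_all add: power_add[symmetric])
      then show "norm (F $ p $ q * G $ (i - p) $ (j - q)) * (a ^ i * b ^ j)
          = f p q * g (i - p) (j - q)"
        by (simp add: f_def g_def norm_mult mult_ac)
    qed
    finally show ?thesis by (simp add: mult.assoc)
  qed
  have "wsum a b (F * G) n \<le> (\<Sum>i\<le>n. \<Sum>j\<le>n. \<Sum>p\<le>i. \<Sum>q\<le>j. f p q * g (i - p) (j - q))"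
    unfolding wsum_def by (intro sum_mono 1)
  also have "\<dots> = (\<Sum>i\<le>n. \<Sum>p\<le>i. \<Sum>j\<le>n. \<Sum>q\<le>j. f p q * g (i - p) (j - q))"
    by (intro sum.cong refl sum.swap)
  also have "\<dots> \<le> (\<Sum>i\<le>n. \<Sum>p\<le>i. \<Sum>q\<le>n. \<Sum>l\<le>n. f p q * g (i - p) l)"
    by (intro sum_mono sum_convolution_le[of "\<lambda>q l. f _ q * g _ l"]) (simp add: pos)
  also have "\<dots> \<le> (\<Sum>p\<le>n. \<Sum>k\<le>n. \<Sum>q\<le>n. \<Sum>l\<le>n. f p q * g k l)"
    by (rule sum_convolution_le[of "\<lambda>p k. \<Sum>q\<le>n. \<Sum>l\<le>n. f p q * g k l"])
      (intro sum_nonneg mult_nonneg_nonneg pos)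
  also have "\<dots> = (\<Sum>p\<le>n. \<Sum>q\<le>n. f p q) * (\<Sum>k\<le>n. \<Sum>l\<le>n. g k l)"
    by (simp only: sum_product)
  finally show ?thesis by (simp add: wsum_def f_def g_def)
qed

lemma wsum_add:
  assumes "a \<ge> 0" "b \<ge> 0"
  shows "wsum a b (F + G) n \<le> wsum a b F n + wsum a b G n"
  unfolding wsum_def sum.distrib[symmetric]
proof (intro sum_mono)
  fix i j
  have "norm ((F + G) $ i $ j) * (a ^ i * b ^ j)
      \<le> (norm (F $ i $ j) + norm (G $ i $ j)) * (a ^ i * b ^ j)"
    using assms by (intro mult_right_mono) (auto intro: norm_triangle_ineq)
  then show "norm ((F + G) $ i $ j) * a ^ i * b ^ j
      \<le> norm (F $ i $ j) * a ^ i * b ^ j + norm (G $ i $ j) * a ^ i * b ^ j"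
    by (simp add: algebra_simps)
qed

lemma wsum_uminus [simp]: "wsum a b (- F) n = wsum a b F n"
  by (simp add: wsum_def)

lemma wsum_one [simp]: "wsum a b 1 n = 1"
proof -
  have "norm ((1 :: complex fps fps) $ i $ j) * a ^ i * b ^ j
      = (if i = 0 then if j = 0 then 1 else 0 else 0)" for i j
    by auto
  then have "wsum a b 1 n = (\<Sum>i\<le>n. \<Sum>j\<le>n. if i = 0 then if j = 0 then 1 else 0 else 0)"
    unfolding wsum_def by (intro sum.cong refl)
  also have "\<dots> = (\<Sum>i\<le>n. if i = 0 then 1 else 0)"
    by (intro sum.cong refl) simp
  finally show ?thesis by simp
qed

lemma convergent2_imp_wbound:
  assumes "convergent2 F"
  obtains r B where "r > 0" "B > 0" "wbound r r F B"
proof -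
  obtain r where r: "r > 0"
    and s: "(\<lambda>(i, j). norm (F $ i $ j) * r ^ (i + j)) summable_on (UNIV :: (nat \<times> nat) set)"
    using assms unfolding convergent2_def by blast
  define B where "B = infsum (\<lambda>(i, j). norm (F $ i $ j) * r ^ (i + j)) UNIV"
  have "wsum r r F n \<le> B" for n
  proof -
    have "wsum r r F n = (\<Sum>(i, j)\<in>{..n} \<times> {..n}. norm (F $ i $ j) * r ^ (i + j))"
    proof -
      have "norm (F $ i $ j) * r ^ i * r ^ j = norm (F $ i $ j) * r ^ (i + j)" for i j
        by (simp add: power_add)
      then have "wsum r r F n = (\<Sum>i\<le>n. \<Sum>j\<le>n. norm (F $ i $ j) * r ^ (i + j))"
        by (simp only: wsum_def)
      also have "\<dots> = (\<Sum>(i, j)\<in>{..n} \<times> {..n}. norm (F $ i $ j) * r ^ (i + j))"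
        by (rule sum.cartesian_product)
      finally show ?thesis .
    qed
    also have "\<dots> \<le> B"
      unfolding B_def by (rule finite_sum_le_infsum[OF s]) (use r in auto)
    finally show ?thesis .
  qed
  then have "wbound r r F (max B 1)" unfolding wbound_def by (simp add: le_max_iff_disj)
  with r show ?thesis by (intro that[of r "max B 1"]) auto
qed

lemma wbound_nth:
  assumes "wbound a b F B" "a \<ge> 0" "b \<ge> 0"
  shows "norm (F $ i $ j) * a ^ i * b ^ j \<le> B"
proof -
  let ?n = "max i j"
  have "norm (F $ i $ j) * a ^ i * b ^ j \<le> (\<Sum>j\<le>?n. norm (F $ i $ j) * a ^ i * b ^ j)"
    using assms by (intro member_le_sum[of j _ "\<lambda>j. norm (F $ i $ j) * a ^ i * b ^ j"]) auto
  also have "\<dots> \<le> wsum a b F ?n"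
    unfolding wsum_def using assms
    by (intro member_le_sum[of i _ "\<lambda>i. \<Sum>j\<le>?n. norm (F $ i $ j) * a ^ i * b ^ j"])
      (auto intro: sum_nonneg)
  finally show ?thesis using assms(1) unfolding wbound_def by (meson order_trans)
qed

lemma wbound_imp_convergent2:
  assumes "wbound a b F B" "a > 0" "b > 0"
  shows "convergent2 F"
proof -
  let ?r = "min a b"
  have "norm (F $ i $ j) * ?r ^ (i + j) \<le> B" for i j
  proof -
    have "norm (F $ i $ j) * ?r ^ (i + j) = norm (F $ i $ j) * (?r ^ i * ?r ^ j)"
      by (simp add: power_add)
    also have "\<dots> \<le> norm (F $ i $ j) * (a ^ i * b ^ j)"
      using assms by (intro mult_left_mono mult_mono power_mono) auto
    also have "\<dots> \<le> B"
      using wbound_nth[OF assms(1), of i j] assms(2,3) by (simp add: mult.assoc)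
    finally show ?thesis .
  qed
  then show ?thesis unfolding convergent2_iff_bound using assms(2,3)
    by (intro exI[of _ ?r]) auto
qed

text \<open>Series divisible by \<open>y\<close> become small when only the radius in \<open>y\<close> shrinks. Weierstrass
  division needs this with a fixed radius in \<open>x\<close>, because dividing by \<open>x\<^sup>d\<close> costs a factor
  \<open>a\<^sup>-\<^sup>d\<close>.\<close>

lemma wsum_scale_y:
  assumes "\<And>i. F $ i $ 0 = 0" "0 \<le> e" "e \<le> 1" "0 \<le> a" "0 \<le> b"
  shows "wsum a (e * b) F n \<le> e * wsum a b F n"
  unfolding wsum_def sum_distrib_left
proof (intro sum_mono)
  fix i j :: nat
  show "norm (F $ i $ j) * a ^ i * (e * b) ^ j \<le> e * (norm (F $ i $ j) * a ^ i * b ^ j)"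
  proof (cases j)
    case (Suc k)
    have "e ^ k \<le> 1" using assms by (simp add: power_le_one)
    then have "e ^ j \<le> e" unfolding Suc using assms by (simp add: mult_left_le)
    then have "e ^ j * (norm (F $ i $ j) * a ^ i * b ^ j) \<le> e * (norm (F $ i $ j) * a ^ i * b ^ j)"
      using assms by (intro mult_right_mono) auto
    then show ?thesis by (simp add: power_mult_distrib mult_ac)
  qed (simp add: assms)
qed

lemma wsum_scale_both:
  assumes "F $ 0 $ 0 = 0" "0 \<le> e" "e \<le> 1" "0 \<le> a" "0 \<le> b"
  shows "wsum (e * a) (e * b) F n \<le> e * wsum a b F n"
  unfolding wsum_def sum_distrib_left
proof (intro sum_mono)
  fix i j :: nat
  show "norm (F $ i $ j) * (e * a) ^ i * (e * b) ^ j \<le> e * (norm (F $ i $ j) * a ^ i * b ^ j)"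
  proof (cases "i + j")
    case (Suc k)
    have "e ^ k \<le> 1" using assms by (simp add: power_le_one)
    then have "e ^ (i + j) \<le> e" unfolding Suc using assms by (simp add: mult_left_le)
    then have "e ^ (i + j) * (norm (F $ i $ j) * a ^ i * b ^ j)
        \<le> e * (norm (F $ i $ j) * a ^ i * b ^ j)"
      using assms by (intro mult_right_mono) auto
    then show ?thesis by (simp add: power_mult_distrib power_add mult_ac)
  qed (use assms in simp)
qed

lemma convergent2_uminus: "convergent2 F \<Longrightarrow> convergent2 (- F)"
  by (simp add: convergent2_def)

lemma convergent2_diff: "convergent2 F \<Longrightarrow> convergent2 G \<Longrightarrow> convergent2 (F - G)"
  using convergent2_add[OF _ convergent2_uminus, of F G] by simp

text \<open>The formal inverse \<open>G\<close> of \<open>F = c - M\<close> satisfies \<open>c G = 1 + M G\<close>. On a polydisc where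
  \<open>M\<close> has norm at most \<open>|c|/2\<close> this bounds the norm of \<open>G\<close> by \<open>2/|c|\<close>.\<close>

lemma convergent2_inverse:
  assumes "convergent2 F" "F $ 0 $ 0 \<noteq> 0"
  obtains G where "convergent2 G" "F * G = 1"
proof -
  define c where "c = F $ 0 $ 0"
  define C :: "complex fps fps" where "C = fps_const (fps_const c)"
  have C: "(C * H) $ i $ j = c * H $ i $ j" for H i j by (simp add: C_def)
  have convC: "convergent2 C"
    by (rule convergent2_finite[of 0]) (auto simp: C_def)
  define M where "M = C - F"
  have M00: "M $ 0 $ 0 = 0" by (simp add: M_def C_def c_def)
  define G where "G = fps_right_inverse F (inverse (F $ 0))"
  have "F $ 0 * inverse (F $ 0) = 1" using assms(2) by (simp add: inverse_mult_eq_1')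
  then have FG: "F * G = 1" unfolding G_def by (rule fps_right_inverse)
  have "convergent2 M" unfolding M_def by (rule convergent2_diff[OF convC assms(1)])
  then obtain r B where rB: "r > 0" "B > 0" "wbound r r M B" by (rule convergent2_imp_wbound)
  define e where "e = min 1 (norm c / (2 * B))"
  have e: "0 < e" "e \<le> 1" "e * B \<le> norm c / 2"
    using rB assms(2) by (auto simp: e_def c_def min_def field_simps)
  have small: "wsum (e * r) (e * r) M n \<le> norm c / 2" for n
  proof -
    have "wsum (e * r) (e * r) M n \<le> e * wsum r r M n"
      using M00 e rB by (intro wsum_scale_both) auto
    also have "\<dots> \<le> e * B" using rB(3) e by (auto simp: wbound_def)
    finally show ?thesis using e by linarith
  qed
  have "wsum (e * r) (e * r) G n \<le> 2 / norm c" for n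
  proof -
    let ?w = "\<lambda>H. wsum (e * r) (e * r) H n"
    have er: "e * r \<ge> 0" using e rB by simp
    have "C * G = 1 + M * G" using FG by (simp add: M_def algebra_simps)
    then have "?w (C * G) \<le> 1 + ?w M * ?w G"
      using wsum_add[OF er er, of 1 "M * G" n] wsum_mult[OF er er, of M G n] by simp
    also have "\<dots> \<le> 1 + norm c / 2 * ?w G"
      using small wsum_nonneg[OF er er] by (intro add_left_mono mult_right_mono) auto
    also have "?w (C * G) = norm c * ?w G"
      by (simp add: wsum_def C norm_mult sum_distrib_left mult_ac)
    finally show ?thesis using assms(2) by (simp add: c_def field_simps)
  qed
  then have "convergent2 G"
    using e rB by (intro wbound_imp_convergent2[of "e * r" "e * r" G "2 / norm c"])
      (auto simp: wbound_def)
  with FG show ?thesis by (rule that[rotated])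
qed

text \<open>Write \<open>F = x\<^sup>d V + P\<close> with \<open>V\<close> a unit and \<open>P\<close> divisible by \<open>y\<close>. A series
  \<open>Q = Z/V\<close> makes \<open>Q F\<close> monic of degree \<open>d\<close> in \<open>x\<close> exactly if \<open>Z + L Z = 1\<close>, where \<open>L H\<close>
  is \<open>H P/V\<close> without its terms of degree below \<open>d\<close>, divided by \<open>x\<^sup>d\<close>. Each application
  of \<open>L\<close> raises the order in \<open>y\<close>, and it halves the norm if the radius in \<open>y\<close> is small. So the
  iterates of \<open>Z \<mapsto> 1 - L Z\<close> become stationary in every coefficient and stay bounded.\<close>

theorem weierstrass_preparation:
  assumes F: "convergent2 F" and Fd: "F $ d $ 0 \<noteq> 0" and Fi: "\<And>i. i < d \<Longrightarrow> F $ i $ 0 = 0"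
  obtains U W where "convergent2 U" "U $ 0 $ 0 \<noteq> 0" "convergent2 W" "F = U * W"
    "W $ d = 1" "\<And>i. i > d \<Longrightarrow> W $ i = 0" "\<And>i. i < d \<Longrightarrow> W $ i $ 0 = 0"
proof -
  obtain rF BF where rF: "rF > 0" "BF > 0" "wbound rF rF F BF"
    using F by (rule convergent2_imp_wbound)
  have shift_le: "wsum a b (fps_shift d H) n \<le> wsum a b H (n + d) / a ^ d"
    if "a > 0" "b > 0" for a b H n
  proof -
    have "wsum a b (fps_shift d H) n * a ^ d
        = (\<Sum>i\<le>n. \<Sum>j\<le>n. norm (H $ (i + d) $ j) * a ^ (i + d) * b ^ j)"
      unfolding wsum_def sum_distrib_right by (simp add: power_add mult_ac)
    also have "\<dots> = (\<Sum>i\<in>{d..n + d}. \<Sum>j\<le>n. norm (H $ i $ j) * a ^ i * b ^ j)"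
      using sum.shift_bounds_cl_nat_ivl[of "\<lambda>i. \<Sum>j\<le>n. norm (H $ i $ j) * a ^ i * b ^ j" 0 d n]
      by (simp add: atLeast0AtMost)
    also have "\<dots> \<le> (\<Sum>i\<le>n + d. \<Sum>j\<le>n. norm (H $ i $ j) * a ^ i * b ^ j)"
      using that by (intro sum_mono2) (auto intro!: sum_nonneg)
    also have "\<dots> \<le> wsum a b H (n + d)"
      unfolding wsum_def using that by (intro sum_mono sum_mono2) auto
    finally show ?thesis using that by (simp add: field_simps)
  qed
  define V where "V = fps_shift d F"
  have "convergent2 V"
  proof (rule wbound_imp_convergent2[of rF rF V "BF / rF ^ d"])
    show "wbound rF rF V (BF / rF ^ d)"
      unfolding wbound_def V_def
    proof
      fix n
      have "wsum rF rF (fps_shift d F) n \<le> wsum rF rF F (n + d) / rF ^ d"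
        by (rule shift_le) (use rF in auto)
      also have "\<dots> \<le> BF / rF ^ d" using rF by (intro divide_right_mono) (auto simp: wbound_def)
      finally show "wsum rF rF (fps_shift d F) n \<le> BF / rF ^ d" .
    qed
  qed (use rF in auto)
  moreover have "V $ 0 $ 0 \<noteq> 0" using Fd by (simp add: V_def)
  ultimately obtain I where I: "convergent2 I" "V * I = 1" by (rule convergent2_inverse)
  define P where "P = F - fps_X ^ d * V"
  have FP: "F = fps_X ^ d * V + P" by (simp add: P_def)
  have P0: "P $ i $ 0 = 0" for i
    by (cases "i < d") (auto simp: P_def V_def fps_X_power_mult_nth Fi)
  have convX: "convergent2 (fps_X ^ d)"
    by (rule convergent2_finite[of d]) (auto simp: fps_X_power_iff)
  define K where "K = I * P"
  have K0: "K $ i $ 0 = 0" for i unfolding K_def fps_fps_mult_nth by (simp add: P0)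
  have "convergent2 K"
    unfolding K_def P_def
    by (intro convergent2_mult convergent2_diff I F convX \<open>convergent2 V\<close>)
  then obtain r B where rB: "r > 0" "B > 0" "wbound r r K B" by (rule convergent2_imp_wbound)
  define e where "e = min 1 (r ^ d / (2 * B))"
  have e: "0 < e" "e \<le> 1" "e * B \<le> r ^ d / 2"
    using rB by (auto simp: e_def min_def field_simps)
  define L where "L H = fps_shift d (H * K)" for H
  let ?w = "wsum r (e * r)"
  have er: "e * r > 0" "r > 0" "e * r \<ge> 0" "r \<ge> 0" using e rB by auto
  have L_bound: "wbound r (e * r) (L H) (b / 2)" if "wbound r (e * r) H b" for H b
    unfolding wbound_def
  proof
    fix n
    have "?w K m \<le> r ^ d / 2" for m
    proof -
      have "?w K m \<le> e * wsum r r K m" using K0 e rB by (intro wsum_scale_y) auto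
      also have "\<dots> \<le> e * B" using rB e by (auto simp: wbound_def)
      finally show ?thesis using e by linarith
    qed
    then have K_small: "?w K (n + d) \<le> r ^ d / 2" .
    have H_le: "?w H (n + d) \<le> b" using that by (simp add: wbound_def)
    have "?w (H * K) (n + d) \<le> ?w H (n + d) * ?w K (n + d)"
      by (rule wsum_mult[OF er(4,3)])
    also have "\<dots> \<le> b * (r ^ d / 2)"
      using wsum_nonneg[OF er(4,3)] order_trans[OF wsum_nonneg[OF er(4,3)] H_le]
      by (intro mult_mono H_le K_small)
    finally have "?w (H * K) (n + d) \<le> b * (r ^ d / 2)" .
    then have "?w (H * K) (n + d) / r ^ d \<le> b / 2"
      using rB by (simp add: field_simps)
    then show "?w (L H) n \<le> b / 2"
      unfolding L_def using shift_le[OF er(2,1), of "H * K" n] by linarith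
  qed
  have L_dep: "L G $ i $ j = L H $ i $ j" if "\<And>a b. b < j \<Longrightarrow> G $ a $ b = H $ a $ b" for G H i j
    unfolding L_def fps_shift_nth fps_fps_mult_nth
  proof (intro sum.cong refl)
    fix a b assume "b \<in> {..j}"
    then show "G $ a $ b * K $ (i + d - a) $ (j - b) = H $ a $ b * K $ (i + d - a) $ (j - b)"
      using that K0 by (cases "b = j") auto
  qed
  \<comment> \<open>The iterates: those from the \<open>j\<close>-th on agree in all coefficients of \<open>y\<^sup>j\<close>.\<close>
  define zs where "zs = rec_nat 1 (\<lambda>_ H. 1 - L H)"
  have zs: "zs 0 = 1" "zs (Suc m) = 1 - L (zs m)" for m by (simp_all add: zs_def)
  have zs_bound: "wbound r (e * r) (zs m) 2" for m
  proof (induction m)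
    case 0
    show ?case by (simp add: zs wbound_def)
  next
    case (Suc m)
    have "?w (1 + - L (zs m)) n \<le> 1 + 1" for n
    proof -
      have "?w (L (zs m)) n \<le> 1" using L_bound[OF Suc] by (simp add: wbound_def)
      then show ?thesis using wsum_add[OF er(4,3), of 1 "- L (zs m)" n]
        unfolding wsum_uminus wsum_one by linarith
    qed
    then show ?case by (simp add: zs wbound_def)
  qed
  have zs_step: "zs (Suc m) $ i $ j = zs m $ i $ j" if "j \<le> m" for m i j
    using that
  proof (induction m arbitrary: i j)
    case 0
    have "L 1 $ i $ 0 = L 0 $ i $ 0" by (rule L_dep) simp
    also have "\<dots> = 0" by (simp add: L_def)
    finally show ?case using 0 by (simp add: zs)
  next
    case (Suc m)
    have "L (zs (Suc m)) $ i $ j = L (zs m) $ i $ j"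
      by (rule L_dep, rule Suc.IH) (use Suc.prems in simp)
    then show ?case by (simp add: zs)
  qed
  have zs_stable: "zs m $ i $ j = zs j $ i $ j" if "j \<le> m" for m i j
    using that by (induction m rule: dec_induct) (auto simp: zs_step)
  define Z where "Z = Abs_fps (\<lambda>i. Abs_fps (\<lambda>j. zs j $ i $ j))"
  have Zn: "Z $ i $ j = zs j $ i $ j" for i j by (simp add: Z_def)
  have "?w Z n \<le> 2" for n
  proof -
    have "?w Z n = ?w (zs n) n"
      unfolding wsum_def by (intro sum.cong refl) (simp add: Zn zs_stable[symmetric])
    then show ?thesis using zs_bound[of n] by (simp add: wbound_def)
  qed
  then have convZ: "convergent2 Z"
    using er by (intro wbound_imp_convergent2[of r "e * r" Z 2]) (auto simp: wbound_def)
  have LZ: "Z + L Z = 1"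
  proof (intro fps_ext)
    fix i j
    have "L Z $ i $ j = L (zs j) $ i $ j"
      by (rule L_dep) (simp add: Zn zs_stable[symmetric])
    also have "\<dots> = (1 - zs (Suc j)) $ i $ j" by (simp add: zs)
    also have "\<dots> = (1 - Z) $ i $ j" by (simp add: Zn zs_step)
    finally show "(Z + L Z) $ i $ j = 1 $ i $ j" by simp
  qed
  define Q where "Q = Z * I"
  define W where "W = Q * F"
  have convQ: "convergent2 Q" unfolding Q_def by (intro convergent2_mult convZ I)
  have "W = fps_X ^ d * Z * (V * I) + Z * K"
    by (simp add: W_def Q_def K_def FP algebra_simps)
  then have W: "W = fps_X ^ d * Z + Z * K" by (simp add: I)
  have "fps_shift d W = Z + L Z"
    by (rule fps_ext) (simp add: W L_def fps_X_power_mult_nth)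
  then have shiftW: "fps_shift d W = 1" by (simp only: LZ)
  have Wd: "W $ d = 1" using arg_cong[OF shiftW, of "\<lambda>H. H $ 0"] by simp
  have Wgt: "W $ i = 0" if "i > d" for i
    using arg_cong[OF shiftW, of "\<lambda>H. H $ (i - d)"] that by simp
  have Wlt: "W $ i $ 0 = 0" if "i < d" for i
    unfolding W_def fps_fps_mult_nth using that by (simp add: Fi)
  have "1 = W $ d $ 0" by (simp add: Wd)
  also have "\<dots> = (\<Sum>p\<le>d. Q $ p $ 0 * F $ (d - p) $ 0)"
    by (simp add: W_def fps_fps_mult_nth)
  also have "\<dots> = (\<Sum>p\<in>{0}. Q $ p $ 0 * F $ (d - p) $ 0)"
    by (rule sum.mono_neutral_right) (auto simp: Fi)
  finally have Q0: "Q $ 0 $ 0 \<noteq> 0" by auto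
  obtain U where U: "convergent2 U" "Q * U = 1" using convergent2_inverse[OF convQ Q0] .
  have "1 = (Q * U) $ 0 $ 0" by (simp add: U)
  also have "\<dots> = Q $ 0 $ 0 * U $ 0 $ 0" by simp
  finally have U0: "U $ 0 $ 0 \<noteq> 0" by auto
  have "U * W = (Q * U) * F" by (simp only: W_def mult_ac)
  then have FUW: "F = U * W" by (simp add: U)
  have "convergent2 W" unfolding W_def by (intro convergent2_mult convQ F)
  then show ?thesis using that[OF U(1) U0 _ FUW Wd Wgt Wlt] by simp
qed


section \<open>Arithmetic of fractional power series\<close>

lemma ramify_inject: "n > 0 \<Longrightarrow> ramify n s = ramify n t \<longleftrightarrow> s = t"
  by (metis fps_ext pcoeff_ramify)

lemma pcoeff_zero [simp]: "pcoeff 0 q = 0"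
  by (simp add: zero_puiseux.rep_eq)

lemma pcoeff_one: "pcoeff 1 q = (if q = 0 then 1 else 0)"
  by (simp add: one_puiseux.rep_eq)

lemma pcoeff_add [simp]: "pcoeff (a + b) q = pcoeff a q + pcoeff b q"
  by (simp add: plus_puiseux.rep_eq)

lemma pcoeff_uminus [simp]: "pcoeff (- a) q = - pcoeff a q"
  by (simp add: uminus_puiseux.rep_eq)

lemma pcoeff_diff [simp]: "pcoeff (a - b) q = pcoeff a q - pcoeff b q"
  unfolding minus_puiseux_def by (simp del: add_uminus_conv_diff)

lemma pcoeff_sum: "pcoeff (sum f A) q = (\<Sum>i\<in>A. pcoeff (f i) q)"
  by (induction A rule: infinite_finite_induct) auto

lemma ramify_0 [simp]: "ramify n 0 = 0"
  by (rule puiseux_eqI) (simp add: ramify.rep_eq)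

lemma ramify_uminus: "ramify n (- s) = - ramify n s"
  by (rule puiseux_eqI) (simp add: ramify.rep_eq)

lemma ramify_sum: "ramify n (sum f A) = (\<Sum>i\<in>A. ramify n (f i))"
  by (induction A rule: infinite_finite_induct) (auto simp: ramify_add[symmetric])

instance puiseux :: idom
proof
  fix a b :: puiseux
  assume ab: "a \<noteq> 0" "b \<noteq> 0"
  obtain n s t where n: "n > 0" "a = ramify n s" "b = ramify n t" using ex_ramify2 by blast
  then have "s \<noteq> 0" "t \<noteq> 0" using ab by auto
  then show "a * b \<noteq> 0" using n by (simp add: ramify_mult) (metis ramify_0 ramify_inject mult_eq_0_iff)
qed

lemma pcoeff_neg: "q < 0 \<Longrightarrow> pcoeff a q = 0"
proof (rule ccontr)
  assume q: "q < 0" "pcoeff a q \<noteq> 0"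
  obtain n s where "n > 0" "a = ramify n s" using ex_ramify by blast
  then obtain k where "q = of_nat k / of_nat n" using q ramify_support by metis
  then show False using q by (simp add: divide_less_0_iff)
qed

text \<open>This is \<open>O\<^sub>y(a) \<ge> c\<close>, the case \<open>a = 0\<close> included.\<close>

definition vanishes_below :: "rat \<Rightarrow> puiseux \<Rightarrow> bool" where
  "vanishes_below c a \<longleftrightarrow> (\<forall>q<c. pcoeff a q = 0)"

lemma vanishes_below_0 [simp]: "vanishes_below c 0"
  by (simp add: vanishes_below_def)

lemma vanishes_below_trivial: "c \<le> 0 \<Longrightarrow> vanishes_below c a"
  by (auto simp: vanishes_below_def intro: pcoeff_neg)

lemma vanishes_below_mono: "vanishes_below c a \<Longrightarrow> c' \<le> c \<Longrightarrow> vanishes_below c' a"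
  by (auto simp: vanishes_below_def)

lemma vanishes_below_add:
  "vanishes_below c a \<Longrightarrow> vanishes_below c b \<Longrightarrow> vanishes_below c (a + b)"
  by (auto simp: vanishes_below_def)

lemma vanishes_below_mult:
  assumes "vanishes_below c a" "vanishes_below d b"
  shows "vanishes_below (c + d) (a * b)"
  unfolding vanishes_below_def
proof (intro allI impI)
  fix q assume q: "q < c + d"
  have "{p. pcoeff a p \<noteq> 0 \<and> pcoeff b (q - p) \<noteq> 0} = {}"
  proof (rule ccontr)
    assume "{p. pcoeff a p \<noteq> 0 \<and> pcoeff b (q - p) \<noteq> 0} \<noteq> {}"
    then obtain p where "pcoeff a p \<noteq> 0" "pcoeff b (q - p) \<noteq> 0" by blast
    then have "\<not> p < c" "\<not> q - p < d" using assms by (auto simp: vanishes_below_def)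
    with q show False by simp
  qed
  then show "pcoeff (a * b) q = 0"
    unfolding times_puiseux.rep_eq convolve_def by (simp only: sum.empty)
qed

lemma pcoeff_mult_leading:
  assumes "vanishes_below c a" "vanishes_below d b"
  shows "pcoeff (a * b) (c + d) = pcoeff a c * pcoeff b d"
proof -
  have "{p. pcoeff a p \<noteq> 0 \<and> pcoeff b (c + d - p) \<noteq> 0} \<subseteq> {c}"
  proof
    fix p assume "p \<in> {p. pcoeff a p \<noteq> 0 \<and> pcoeff b (c + d - p) \<noteq> 0}"
    then have "\<not> p < c" "\<not> c + d - p < d" using assms by (auto simp: vanishes_below_def)
    then show "p \<in> {c}" by simp
  qed
  then have "pcoeff (a * b) (c + d) = (\<Sum>p\<in>{c}. pcoeff a p * pcoeff b (c + d - p))"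
    unfolding times_puiseux.rep_eq convolve_def by (intro sum.mono_neutral_left) auto
  then show ?thesis by simp
qed

lemma vanishes_below_power: "vanishes_below c a \<Longrightarrow> vanishes_below (of_nat n * c) (a ^ n)"
proof (induction n)
  case (Suc n)
  then show ?case using vanishes_below_mult[of c a "of_nat n * c" "a ^ n"]
    by (simp add: algebra_simps)
qed (simp add: vanishes_below_trivial)

lemma pcoeff_0_mult [simp]: "pcoeff (a * b) 0 = pcoeff a 0 * pcoeff b 0"
  using pcoeff_mult_leading[of 0 a 0 b] by (simp add: vanishes_below_trivial)

text \<open>The order of a nonzero series as a rational number, for sums and products of orders.\<close>

definition pord :: "puiseux \<Rightarrow> rat" where
  "pord a = (LEAST q. pcoeff a q \<noteq> 0)"

lemma ramify_order:
  assumes "n > 0" "s \<noteq> 0"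
  shows "pcoeff (ramify n s) (of_nat (subdegree s) / of_nat n) \<noteq> 0"
    "vanishes_below (of_nat (subdegree s) / of_nat n) (ramify n s)"
proof -
  show "pcoeff (ramify n s) (of_nat (subdegree s) / of_nat n) \<noteq> 0"
    using assms by simp
  show "vanishes_below (of_nat (subdegree s) / of_nat n) (ramify n s)"
    unfolding vanishes_below_def
  proof (intro allI impI, rule ccontr)
    fix q assume q: "q < of_nat (subdegree s) / of_nat n" "pcoeff (ramify n s) q \<noteq> 0"
    then obtain k where k: "q = of_nat k / of_nat n" using ramify_support by blast
    have "(of_nat k :: rat) < of_nat (subdegree s)"
      using q(1) assms(1) unfolding k by (simp only: divide_less_cancel of_nat_0_less_iff)
    then have "k < subdegree s" unfolding of_nat_less_iff .
    then have "s $ k = 0" by (rule nth_less_subdegree_zero)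
    then show False using q(2) pcoeff_ramify[OF assms(1), of s k] unfolding k by metis
  qed
qed

lemma pord_eqI:
  assumes "vanishes_below c a" "pcoeff a c \<noteq> 0"
  shows "pord a = c"
  unfolding pord_def
  by (rule Least_equality) (use assms in \<open>auto simp: vanishes_below_def not_le[symmetric]\<close>)

lemma pord_props:
  assumes "a \<noteq> 0"
  shows "pcoeff a (pord a) \<noteq> 0" "vanishes_below (pord a) a" "pord a \<ge> 0"
proof -
  obtain n s where n: "n > 0" "a = ramify n s" using ex_ramify by blast
  then have s: "s \<noteq> 0" using assms by auto
  have *: "pord a = of_nat (subdegree s) / of_nat n"
    unfolding n using ramify_order[OF n(1) s] by (intro pord_eqI)
  show "pcoeff a (pord a) \<noteq> 0" "vanishes_below (pord a) a"
    unfolding * using ramify_order[OF n(1) s] n by auto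
  show "pord a \<ge> 0" unfolding * by simp
qed

lemma pord_mult:
  assumes "a \<noteq> 0" "b \<noteq> 0"
  shows "pord (a * b) = pord a + pord b"
  using pcoeff_mult_leading[OF pord_props(2)[OF assms(1)] pord_props(2)[OF assms(2)]]
    vanishes_below_mult[OF pord_props(2)[OF assms(1)] pord_props(2)[OF assms(2)]]
    pord_props(1)[OF assms(1)] pord_props(1)[OF assms(2)]
  by (intro pord_eqI) auto

lemma ord_y_eq: "a \<noteq> 0 \<Longrightarrow> ord_y a = Fin (pord a)"
  by (simp add: ord_y_def pord_def)

lemma less_ord_y_iff: "Fin h < ord_y a \<longleftrightarrow> (\<forall>q\<le>h. pcoeff a q = 0)"
proof (cases "a = 0")
  case False
  have "h < pord a \<longleftrightarrow> (\<forall>q\<le>h. pcoeff a q = 0)"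
    using pord_props[OF False] by (auto simp: vanishes_below_def not_less[symmetric])
  with False show ?thesis by (simp add: ord_y_eq)
qed (simp add: ord_y_def)

lemma le_ord_y_iff: "Fin h \<le> ord_y a \<longleftrightarrow> vanishes_below h a"
proof (cases "a = 0")
  case False
  have "h \<le> pord a \<longleftrightarrow> vanishes_below h a"
    using pord_props[OF False] by (auto simp: vanishes_below_def not_less[symmetric])
  with False show ?thesis by (simp add: ord_y_eq)
qed (simp add: ord_y_def)

text \<open>Exponents are nonnegative, so positive order means that there is no constant term.\<close>

definition pos :: "puiseux \<Rightarrow> bool" where
  "pos a \<longleftrightarrow> pcoeff a 0 = 0"

lemma zero_less_ord_y_iff: "0 < ord_y a \<longleftrightarrow> pos a"
  unfolding zero_extended_def less_ord_y_iff pos_def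
  using pcoeff_neg by (metis order_le_less)

lemma pos_vanishes:
  assumes "pos a"
  obtains e where "e > 0" "vanishes_below e a"
proof (cases "a = 0")
  case True
  then show ?thesis by (intro that[of 1]) auto
next
  case False
  then have "pord a \<noteq> 0" using assms pord_props(1)[OF False] unfolding pos_def by metis
  then show ?thesis using that[of "pord a"] pord_props[OF False] by simp
qed

lemma pcoeff_monomial: "pcoeff (monomial c e) q = (if q = e \<and> e \<ge> 0 then c else 0)"
  by (simp add: monomial.rep_eq)

lemma pcoeff_truncate: "pcoeff (truncate_below h a) q = (if q < h then pcoeff a q else 0)"
  by (simp add: truncate_below.rep_eq)

lemma monomial_mult: "a \<ge> 0 \<Longrightarrow> b \<ge> 0 \<Longrightarrow> monomial c a * monomial d b = monomial (c * d) (a + b)"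
proof (rule puiseux_eqI)
  fix q assume ab: "a \<ge> 0" "b \<ge> 0"
  have "{p. pcoeff (monomial c a) p \<noteq> 0 \<and> pcoeff (monomial d b) (q - p) \<noteq> 0} \<subseteq>
      (if q = a + b then {a} else {})"
    by (auto simp: pcoeff_monomial split: if_splits)
  then have "pcoeff (monomial c a * monomial d b) q =
      (\<Sum>p\<in>(if q = a + b then {a} else {}). pcoeff (monomial c a) p * pcoeff (monomial d b) (q - p))"
    unfolding times_puiseux.rep_eq convolve_def by (intro sum.mono_neutral_left) auto
  then show "pcoeff (monomial c a * monomial d b) q = pcoeff (monomial (c * d) (a + b)) q"
    using ab by (auto simp: pcoeff_monomial)
qed

lemma monomial_0_1 [simp]: "monomial 1 0 = 1"
  by (rule puiseux_eqI) (simp add: pcoeff_monomial pcoeff_one)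

lemma monomial_power: "a \<ge> 0 \<Longrightarrow> monomial c a ^ n = monomial (c ^ n) (of_nat n * a)"
proof (induction n)
  case (Suc n)
  then show ?case by (simp add: monomial_mult algebra_simps)
qed simp

lemma pcoeff_monomial_mult:
  assumes "e \<ge> 0"
  shows "pcoeff (monomial c e * a) q = c * pcoeff a (q - e)"
proof -
  have "{p. pcoeff (monomial c e) p \<noteq> 0 \<and> pcoeff a (q - p) \<noteq> 0} \<subseteq> {e}"
    by (auto simp: pcoeff_monomial split: if_splits)
  then have "pcoeff (monomial c e * a) q
      = (\<Sum>p\<in>{e}. pcoeff (monomial c e) p * pcoeff a (q - p))"
    unfolding times_puiseux.rep_eq convolve_def by (intro sum.mono_neutral_left) auto
  with assms show ?thesis by (simp add: pcoeff_monomial)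
qed

lemma ramify_refine_explicit:
  assumes "n > 0" "m > 0"
  shows "ramify n s = ramify (n * m) (Abs_fps (\<lambda>k. if m dvd k then s $ (k div m) else 0))"
proof (rule puiseux_eqI)
  fix q
  let ?t = "Abs_fps (\<lambda>k. if m dvd k then s $ (k div m) else 0)"
  show "pcoeff (ramify n s) q = pcoeff (ramify (n * m) ?t) q"
  proof (cases "\<exists>k. q = of_nat k / of_nat (n * m)")
    case True
    then obtain k where k: "q = of_nat k / of_nat (n * m)" by blast
    have nm: "n * m > 0" using assms by simp
    show ?thesis
    proof (cases "m dvd k")
      case True
      then obtain l where l: "k = m * l" by blast
      have "q = of_nat l / of_nat n" using assms by (simp add: k l)
      then have "pcoeff (ramify n s) q = s $ l" using assms by simp
      moreover have "pcoeff (ramify (n * m) ?t) q = ?t $ k"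
        unfolding k using nm by (rule pcoeff_ramify)
      ultimately show ?thesis using assms by (simp add: l)
    next
      case False
      have "\<nexists>l. q = of_nat l / of_nat n"
      proof
        assume "\<exists>l. q = of_nat l / of_nat n"
        then obtain l where "of_nat k / of_nat (n * m) = (of_nat l / of_nat n :: rat)"
          unfolding k by blast
        moreover have "of_nat l / of_nat n = (of_nat (m * l) / of_nat (n * m) :: rat)"
          using assms by simp
        ultimately have "k = m * l" using of_nat_divide_inject[OF nm, of k "m * l"] by metis
        with False show False by simp
      qed
      then have "pcoeff (ramify n s) q = 0" by (rule pcoeff_ramify_outside)
      moreover have "pcoeff (ramify (n * m) ?t) q = ?t $ k"
        unfolding k using nm by (rule pcoeff_ramify)
      ultimately show ?thesis using False by simp
    qed
  next
    case False
    then have "\<nexists>k. q = of_nat k / of_nat n"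
      using assms
      by (metis mult_divide_mult_cancel_right of_nat_0_eq_iff of_nat_mult less_numeral_extra(3))
    with False show ?thesis by (simp add: pcoeff_ramify_outside)
  qed
qed


section \<open>Power series in \<open>x\<close> with a common denominator\<close>

definition lift :: "nat \<Rightarrow> complex fps fps \<Rightarrow> puiseux fps" where
  "lift n G = Abs_fps (\<lambda>i. ramify n (G $ i))"

lemma lift_nth [simp]: "lift n G $ i = ramify n (G $ i)"
  by (simp add: lift_def)

lemma lift_mult: "n > 0 \<Longrightarrow> lift n (F * G) = lift n F * lift n G"
  by (rule fps_ext) (simp add: fps_mult_nth ramify_sum ramify_mult)

lemma lift_add: "lift n (F + G) = lift n F + lift n G"
  by (rule fps_ext) (simp add: ramify_add[symmetric])

lemma lift_uminus: "lift n (- F) = - lift n F"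
  by (rule fps_ext) (simp add: ramify_uminus)

lemma lift_const: "lift n (fps_const s) = fps_const (ramify n s)"
  by (rule fps_ext) simp

lemma lift_X: "n > 0 \<Longrightarrow> lift n fps_X = fps_X"
  by (rule fps_ext) (auto simp: fps_X_def ramify_1)

lemma lift_inject: "n > 0 \<Longrightarrow> lift n F = lift n G \<longleftrightarrow> F = G"
  by (metis fps_ext lift_nth ramify_inject)

text \<open>This is \<open>G(x, y\<^sup>m)\<close>.\<close>

definition refine :: "nat \<Rightarrow> complex fps fps \<Rightarrow> complex fps fps" where
  "refine m G = Abs_fps (\<lambda>i. Abs_fps (\<lambda>k. if m dvd k then G $ i $ (k div m) else 0))"

lemma lift_refine: "n > 0 \<Longrightarrow> m > 0 \<Longrightarrow> lift n G = lift (n * m) (refine m G)"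
  by (rule fps_ext) (simp only: lift_nth refine_def fps_nth_Abs_fps ramify_refine_explicit[of n m])

lemma convergent2_boundE:
  assumes "convergent2 F"
  obtains r M where "r > 0" "M \<ge> 0" "\<And>i j. norm (F $ i $ j) * r ^ (i + j) \<le> M"
  using convergent2_common_bound[OF assms assms] by metis

lemma convergent2_refine:
  assumes "convergent2 G" "m > 0"
  shows "convergent2 (refine m G)"
proof -
  obtain r M where r: "r > 0" and M0: "M \<ge> 0" and M: "\<And>i j. norm (G $ i $ j) * r ^ (i + j) \<le> M"
    using convergent2_boundE[OF assms(1)] by metis
  define r' where "r' = min r 1"
  have r': "0 < r'" "r' \<le> 1" "r' \<le> r" using r by (auto simp: r'_def)
  have "norm (refine m G $ i $ j) * r' ^ (i + j) \<le> M" for i j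
  proof (cases "m dvd j")
    case True
    then obtain k where k: "j = m * k" by blast
    have "i + k \<le> i + j" using assms(2) by (simp add: k)
    then have "r' ^ (i + j) \<le> r' ^ (i + k)" using r' by (intro power_decreasing) auto
    also have "\<dots> \<le> r ^ (i + k)" using r' by (intro power_mono) auto
    finally have "norm (G $ i $ k) * r' ^ (i + j) \<le> norm (G $ i $ k) * r ^ (i + k)"
      by (intro mult_left_mono) auto
    also have "\<dots> \<le> M" by (rule M)
    finally have "norm (G $ i $ k) * r' ^ (i + j) \<le> M" .
    moreover have "refine m G $ i $ j = G $ i $ k" using assms(2) by (simp add: refine_def k)
    ultimately show ?thesis by simp
  next
    case False
    then have "refine m G $ i $ j = 0" by (simp add: refine_def)
    then show ?thesis using M0 by simp
  qed
  then show ?thesis unfolding convergent2_iff_bound using r'(1) by blast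
qed

text \<open>An arbitrary power series over the fractional power series may have coefficients with
  unbounded denominators; then its value at an arc need not be a fractional power series.\<close>

definition bounded_denom :: "puiseux fps \<Rightarrow> bool" where
  "bounded_denom F \<longleftrightarrow> (\<exists>n>0. \<exists>G. F = lift n G)"

definition conv_series :: "puiseux fps \<Rightarrow> bool" where
  "conv_series F \<longleftrightarrow> (\<exists>n>0. \<exists>G. convergent2 G \<and> F = lift n G)"

lemma conv_series_bounded: "conv_series F \<Longrightarrow> bounded_denom F"
  by (auto simp: conv_series_def bounded_denom_def)

lemma bounded_denom2:
  assumes "bounded_denom F" "bounded_denom H"
  obtains n G K where "n > 0" "F = lift n G" "H = lift n K"
proof -
  obtain n G where 1: "n > 0" "F = lift n G" using assms(1) unfolding bounded_denom_def by blast
  obtain m K where 2: "m > 0" "H = lift m K" using assms(2) unfolding bounded_denom_def by blast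
  show ?thesis
  proof (rule that[of "n * m" "refine m G" "refine n K"])
    show "n * m > 0" using 1(1) 2(1) by simp
    show "F = lift (n * m) (refine m G)" using lift_refine[OF 1(1) 2(1)] 1(2) by simp
    show "H = lift (n * m) (refine n K)" using lift_refine[OF 2(1) 1(1)] 2(2)
      by (simp add: mult.commute)
  qed
qed

lemma conv_series2:
  assumes "conv_series F" "conv_series H"
  obtains n G K where "n > 0" "convergent2 G" "convergent2 K" "F = lift n G" "H = lift n K"
proof -
  obtain n G where 1: "n > 0" "convergent2 G" "F = lift n G"
    using assms unfolding conv_series_def by blast
  obtain m K where 2: "m > 0" "convergent2 K" "H = lift m K"
    using assms unfolding conv_series_def by blast
  show ?thesis
  proof (rule that[of "n * m" "refine m G" "refine n K"])
    show "n * m > 0" using 1(1) 2(1) by simp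
    show "F = lift (n * m) (refine m G)" using lift_refine[OF 1(1) 2(1)] 1(3) by simp
    show "H = lift (n * m) (refine n K)" using lift_refine[OF 2(1) 1(1)] 2(3)
      by (simp add: mult.commute)
    show "convergent2 (refine m G)" by (rule convergent2_refine[OF 1(2) 2(1)])
    show "convergent2 (refine n K)" by (rule convergent2_refine[OF 2(2) 1(1)])
  qed
qed

lemma bounded_denom_lift: "n > 0 \<Longrightarrow> bounded_denom (lift n G)"
  by (auto simp: bounded_denom_def)

lemma conv_series_lift: "n > 0 \<Longrightarrow> convergent2 G \<Longrightarrow> conv_series (lift n G)"
  by (auto simp: conv_series_def)

lemma bounded_denom_const: "bounded_denom (fps_const a)"
proof -
  obtain n s where "n > 0" "a = ramify n s" using ex_ramify by blast
  then show ?thesis using bounded_denom_lift[of n "fps_const s"] by (simp add: lift_const)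
qed

lemma bounded_denom_X: "bounded_denom fps_X"
  using bounded_denom_lift[of 1 fps_X] by (simp add: lift_X)

lemma bounded_denom_mult: "bounded_denom F \<Longrightarrow> bounded_denom G \<Longrightarrow> bounded_denom (F * G)"
  by (erule (1) bounded_denom2) (simp add: lift_mult[symmetric] bounded_denom_lift)

lemma bounded_denom_add: "bounded_denom F \<Longrightarrow> bounded_denom G \<Longrightarrow> bounded_denom (F + G)"
  by (erule (1) bounded_denom2) (simp add: lift_add[symmetric] bounded_denom_lift)

lemma bounded_denom_uminus: "bounded_denom F \<Longrightarrow> bounded_denom (- F)"
  unfolding bounded_denom_def using lift_uminus by metis

lemma bounded_denom_one: "bounded_denom 1"
  using bounded_denom_const[of 1] by simp

lemma conv_series_mult: "conv_series F \<Longrightarrow> conv_series G \<Longrightarrow> conv_series (F * G)"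
  by (erule (1) conv_series2) (simp add: lift_mult[symmetric] conv_series_lift convergent2_mult)

lemma conv_series_add: "conv_series F \<Longrightarrow> conv_series G \<Longrightarrow> conv_series (F + G)"
  by (erule (1) conv_series2) (simp add: lift_add[symmetric] conv_series_lift convergent2_add)

lemma conv_series_uminus: "conv_series F \<Longrightarrow> conv_series (- F)"
  unfolding conv_series_def using lift_uminus convergent2_uminus by metis

lemma conv_series_X: "conv_series fps_X"
proof -
  have "convergent2 fps_X" by (rule convergent2_finite[of 1]) (auto simp: fps_X_def)
  then show ?thesis using conv_series_lift[of 1 fps_X] by (simp add: lift_X)
qed

definition conv_puiseux :: "puiseux \<Rightarrow> bool" where
  "conv_puiseux a \<longleftrightarrow> conv_series (fps_const a)"

lemma conv_puiseux_mult: "conv_puiseux a \<Longrightarrow> conv_puiseux b \<Longrightarrow> conv_puiseux (a * b)"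
  using conv_series_mult[of "fps_const a" "fps_const b"] by (simp add: conv_puiseux_def)

lemma conv_puiseux_add: "conv_puiseux a \<Longrightarrow> conv_puiseux b \<Longrightarrow> conv_puiseux (a + b)"
  using conv_series_add[of "fps_const a" "fps_const b"] by (simp add: conv_puiseux_def)

lemma conv_puiseux_uminus: "conv_puiseux a \<Longrightarrow> conv_puiseux (- a)"
  using conv_series_uminus[of "fps_const a"] by (simp add: conv_puiseux_def)

lemma convergent2_const_iff:
  "convergent2 (fps_const s) \<longleftrightarrow> (\<exists>r>0. \<exists>M. \<forall>k. norm (s $ k) * r ^ k \<le> M)"
proof
  assume "convergent2 (fps_const s)"
  then obtain r M where *: "r > 0" "M \<ge> 0" "\<And>i j. norm (fps_const s $ i $ j) * r ^ (i + j) \<le> M"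
    by (rule convergent2_boundE) blast
  have "norm (s $ k) * r ^ k \<le> M" for k using *(3)[of 0 k] by simp
  with *(1) show "\<exists>r>0. \<exists>M. \<forall>k. norm (s $ k) * r ^ k \<le> M" by blast
next
  assume "\<exists>r>0. \<exists>M. \<forall>k. norm (s $ k) * r ^ k \<le> M"
  then obtain r M where r: "r > 0" and M: "\<And>k. norm (s $ k) * r ^ k \<le> M" by blast
  have "0 \<le> norm (s $ 0) * r ^ 0" by simp
  then have "M \<ge> 0" using M[of 0] by linarith
  have "norm (fps_const s $ i $ j) * r ^ (i + j) \<le> M" for i j
  proof (cases "i = 0")
    case True
    then show ?thesis using M[of j] by simp
  next
    case False
    then have "fps_const s $ i = 0" by simp
    then show ?thesis using \<open>M \<ge> 0\<close> by simp
  qed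
  with r show "convergent2 (fps_const s)" unfolding convergent2_iff_bound by blast
qed

lemma convergent2_row: "convergent2 G \<Longrightarrow> convergent2 (fps_const (G $ i))"
proof -
  assume "convergent2 G"
  then obtain r M where r: "r > 0" and "M \<ge> 0" and M: "\<And>i j. norm (G $ i $ j) * r ^ (i + j) \<le> M"
    by (rule convergent2_boundE) blast
  have "norm (G $ i $ k) * r ^ k \<le> M / r ^ i" for k
  proof -
    have "norm (G $ i $ k) * r ^ k * r ^ i \<le> M" using M[of i k] by (simp add: power_add mult_ac)
    then show ?thesis using r by (simp only: pos_le_divide_eq zero_less_power)
  qed
  with r show ?thesis unfolding convergent2_const_iff by blast
qed

lemma conv_puiseuxE:
  assumes "conv_puiseux a"
  obtains n s where "n > 0" "convergent2 (fps_const s)" "a = ramify n s"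
proof -
  obtain n G where n: "n > 0" "convergent2 G" "fps_const a = lift n G"
    using assms unfolding conv_puiseux_def conv_series_def by blast
  have "a = ramify n (G $ 0)" using arg_cong[OF n(3), of "\<lambda>F. F $ 0"] by simp
  with n show ?thesis using that convergent2_row by blast
qed

lemma conv_puiseuxI: "n > 0 \<Longrightarrow> convergent2 (fps_const s) \<Longrightarrow> conv_puiseux (ramify n s)"
  unfolding conv_puiseux_def conv_series_def lift_const[symmetric] by blast

lemma conv_puiseux_monomial: "conv_puiseux (monomial c e)"
proof -
  obtain n s where n: "n > 0" "monomial c e = ramify n s" using ex_ramify by blast
  have "convergent2 (fps_const s)"
  proof (rule convergent2_finite[of "nat \<lfloor>e * of_nat n\<rfloor>"])
    fix i j assume ij: "nat \<lfloor>e * of_nat n\<rfloor> < i + j"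
    have "s $ j = 0" if "nat \<lfloor>e * of_nat n\<rfloor> < j"
    proof -
      have "of_nat j / of_nat n \<noteq> e"
      proof
        assume "of_nat j / of_nat n = e"
        then have "e * of_nat n = of_nat j" using n by auto
        then show False using that by simp
      qed
      then show ?thesis using pcoeff_ramify[OF n(1), of s j] unfolding n(2)[symmetric]
        by (simp add: pcoeff_monomial)
    qed
    then show "fps_const s $ i $ j = 0" using ij by (cases i) auto
  qed
  with n show ?thesis by (simp add: conv_puiseuxI)
qed

lemma monomial_coeff_0 [simp]: "monomial 0 e = 0"
  by (rule puiseux_eqI) (simp add: pcoeff_monomial)

lemma conv_puiseux_0: "conv_puiseux 0"
  using conv_puiseux_monomial[of 0 0] by simp

lemma conv_puiseux_1: "conv_puiseux 1"
  using conv_puiseux_monomial[of 1 0] by simp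

lemma conv_puiseux_sum: "(\<And>i. i \<in> A \<Longrightarrow> conv_puiseux (f i)) \<Longrightarrow> conv_puiseux (sum f A)"
  by (induction A rule: infinite_finite_induct) (auto intro: conv_puiseux_0 conv_puiseux_add)

section \<open>Evaluation of power series in \<open>x\<close> at arcs\<close>

text \<open>For \<open>s\<close> without constant term only the powers \<open>s\<^sup>i\<close> with \<open>i \<le> k\<close> contribute to
  the \<open>k\<close>-th coefficient of \<open>G(s)\<close>.\<close>

definition eval2 :: "complex fps fps \<Rightarrow> complex fps \<Rightarrow> complex fps" where
  "eval2 G s = Abs_fps (\<lambda>k. (\<Sum>i\<le>k. G $ i * s ^ i) $ k)"

lemma power_nth_zero: "s $ 0 = 0 \<Longrightarrow> j < i \<Longrightarrow> (a * s ^ i :: complex fps) $ j = 0"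
proof -
  assume s: "s $ 0 = 0" and "j < i"
  then have "(s ^ i) $ k = 0" if "k \<le> j" for k
    using that by (intro startsby_zero_power_prefix[rule_format]) auto
  then show ?thesis by (auto simp: fps_mult_nth intro!: sum.neutral)
qed

lemma eval2_nth:
  assumes "s $ 0 = 0" "k \<le> N"
  shows "eval2 G s $ k = (\<Sum>i\<le>N. G $ i * s ^ i) $ k"
proof -
  have "(\<Sum>i\<le>N. (G $ i * s ^ i) $ k) = (\<Sum>i\<le>k. (G $ i * s ^ i) $ k)"
    using assms by (intro sum.mono_neutral_right) (auto intro: power_nth_zero)
  then show ?thesis by (simp add: eval2_def fps_sum_nth)
qed

lemma fps_mult_nth_cong:
  assumes "\<And>j. j \<le> k \<Longrightarrow> a $ j = a' $ j" "\<And>j. j \<le> k \<Longrightarrow> b $ j = b' $ j"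
  shows "(a * b) $ k = (a' * b' :: complex fps) $ k"
  unfolding fps_mult_nth using assms by (intro sum.cong) auto

lemma eval2_mult:
  assumes s: "s $ 0 = 0"
  shows "eval2 (F * G) s = eval2 F s * eval2 G s"
proof (rule fps_ext)
  fix k
  have "(eval2 F s * eval2 G s) $ k = ((\<Sum>i\<le>k. F $ i * s ^ i) * (\<Sum>i\<le>k. G $ i * s ^ i)) $ k"
    by (rule fps_mult_nth_cong) (auto simp: eval2_nth[OF s])
  also have "\<dots> = (\<Sum>i\<le>k. \<Sum>j\<le>k. (F $ i * G $ j * s ^ (i + j)) $ k)"
    by (simp add: sum_product fps_sum_nth power_add mult_ac)
  also have "\<dots> = (\<Sum>(i, j)\<in>{..k} \<times> {..k}. (F $ i * G $ j * s ^ (i + j)) $ k)"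
    by (simp add: sum.cartesian_product)
  also have "\<dots> = (\<Sum>(i, j)\<in>{(i, j). i + j \<le> k}. (F $ i * G $ j * s ^ (i + j)) $ k)"
    using s by (intro sum.mono_neutral_right) (auto intro: power_nth_zero)
  also have "\<dots> = (\<Sum>m\<le>k. \<Sum>i\<le>m. (F $ i * G $ (m - i) * s ^ (i + (m - i))) $ k)"
    by (rule sum.triangle_reindex_eq)
  also have "\<dots> = (\<Sum>m\<le>k. (\<Sum>i\<le>m. F $ i * G $ (m - i) * s ^ m) $ k)"
    unfolding fps_sum_nth by (intro sum.cong refl) simp
  also have "\<dots> = eval2 (F * G) s $ k"
    by (simp add: eval2_def fps_sum_nth fps_mult_nth[of F G] atLeast0AtMost sum_distrib_right)
  finally show "eval2 (F * G) s $ k = (eval2 F s * eval2 G s) $ k" ..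
qed

lemma eval2_add: "eval2 (F + G) s = eval2 F s + eval2 G s"
  by (rule fps_ext) (simp add: eval2_def distrib_right sum.distrib)

lemma eval2_const: "s $ 0 = 0 \<Longrightarrow> eval2 (fps_const a) s = a"
proof (rule fps_ext)
  fix k assume "s $ 0 = 0"
  have "(\<Sum>i\<le>k. fps_const a $ i * s ^ i) = (\<Sum>i\<in>{0}. fps_const a $ i * s ^ i)"
    by (rule sum.mono_neutral_right) auto
  then show "eval2 (fps_const a) s $ k = a $ k" by (simp add: eval2_def)
qed

lemma eval2_X: "s $ 0 = 0 \<Longrightarrow> eval2 fps_X s = s"
proof (rule fps_ext)
  fix k assume s: "s $ 0 = 0"
  have "(\<Sum>i\<le>Suc k. fps_X $ i * s ^ i) = (\<Sum>i\<in>{1}. fps_X $ i * s ^ i)"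
    by (rule sum.mono_neutral_right) (auto simp: fps_X_def)
  then show "eval2 fps_X s $ k = s $ k" using eval2_nth[OF s, of k "Suc k" fps_X] by simp
qed

text \<open>The chain rule, for \<open>y d/dy\<close> because \<open>d/dy\<close> would lead to negative exponents.\<close>

lemma eval2_chain:
  assumes s: "s $ 0 = 0"
  shows "fps_X * fps_deriv (eval2 G s)
    = eval2 (fps_deriv G) s * (fps_X * fps_deriv s)
      + eval2 (Abs_fps (\<lambda>i. fps_X * fps_deriv (G $ i))) s"
proof (rule fps_ext)
  fix k
  define D where "D a = fps_X * fps_deriv a" for a :: "complex fps"
  have Dn: "D a $ k = of_nat k * a $ k" for a k by (cases k) (auto simp: D_def)
  have Dmult: "D (a * b) = D a * b + a * D b" for a b by (simp add: D_def algebra_simps)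
  have Dpow: "D (a ^ n) = of_nat n * a ^ (n - 1) * D a" for a n
    by (simp add: D_def fps_deriv_power' mult_ac)
  have "D (eval2 G s) $ k = (\<Sum>i\<le>k. D (G $ i * s ^ i) $ k)"
    by (simp add: Dn eval2_def fps_sum_nth sum_distrib_left)
  also have "\<dots> = (\<Sum>i\<le>k. (D (G $ i) * s ^ i) $ k)
      + (\<Sum>i\<le>k. (G $ i * (of_nat i * s ^ (i - 1) * D s)) $ k)"
    by (simp add: Dmult Dpow sum.distrib)
  also have "(\<Sum>i\<le>k. (D (G $ i) * s ^ i) $ k) = eval2 (Abs_fps (\<lambda>i. D (G $ i))) s $ k"
    by (simp add: eval2_def fps_sum_nth)
  also have "(\<Sum>i\<le>k. (G $ i * (of_nat i * s ^ (i - 1) * D s)) $ k)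
      = (eval2 (fps_deriv G) s * D s) $ k"
  proof -
    have last: "(G $ Suc k * (of_nat (Suc k) * s ^ k * D s)) $ k = 0"
    proof -
      have *: "(s ^ k * D s) $ j = 0" if "j \<le> k" for j
      proof -
        have "s ^ k $ i * D s $ (j - i) = 0" if "i \<le> j" for i
          using that \<open>j \<le> k\<close> s startsby_zero_power_prefix[of s k]
          by (cases "i < k") (auto simp: Dn)
        then show ?thesis by (auto simp: fps_mult_nth intro!: sum.neutral)
      qed
      have "(G $ Suc k * (of_nat (Suc k) * s ^ k * D s)) $ k
          = ((G $ Suc k * of_nat (Suc k)) * (s ^ k * D s)) $ k" by (simp only: mult_ac)
      also have "\<dots> = 0" unfolding fps_mult_nth[of "G $ Suc k * of_nat (Suc k)"]
        using * by (intro sum.neutral) auto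
      finally show ?thesis .
    qed
    have "(eval2 (fps_deriv G) s * D s) $ k = ((\<Sum>i\<le>k. fps_deriv G $ i * s ^ i) * D s) $ k"
      by (rule fps_mult_nth_cong) (auto simp: eval2_nth[OF s])
    also have "\<dots> = (\<Sum>i\<le>k. (G $ Suc i * (of_nat (Suc i) * s ^ i * D s)) $ k)"
      unfolding sum_distrib_right fps_sum_nth
      by (intro sum.cong refl arg_cong[where f = "\<lambda>a. a $ k"])
        (simp add: mult_ac del: of_nat_Suc)
    also have "\<dots> = (\<Sum>i\<in>{Suc 0..Suc k}. (G $ i * (of_nat i * s ^ (i - 1) * D s)) $ k)"
      using sum.shift_bounds_cl_Suc_ivl[of "\<lambda>i. (G $ i * (of_nat i * s ^ (i - 1) * D s)) $ k" 0 k]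
      by (simp add: atLeast0AtMost)
    also have "\<dots> = (\<Sum>i\<le>Suc k. (G $ i * (of_nat i * s ^ (i - 1) * D s)) $ k)"
      by (rule sum.mono_neutral_left) (auto simp: not_le)
    also have "\<dots> = (\<Sum>i\<le>k. (G $ i * (of_nat i * s ^ (i - 1) * D s)) $ k)"
      using last by simp
    finally show ?thesis ..
  qed
  finally show "(fps_X * fps_deriv (eval2 G s)) $ k = (eval2 (fps_deriv G) s * (fps_X * fps_deriv s)
      + eval2 (Abs_fps (\<lambda>i. fps_X * fps_deriv (G $ i))) s) $ k"
    by (simp add: D_def)
qed

text \<open>The formula of \<open>subst\<close>, for series which need not be germs.\<close>

definition peval :: "puiseux fps \<Rightarrow> puiseux \<Rightarrow> puiseux" where
  "peval F \<xi> = Abs_puiseux (\<lambda>q. \<Sum>i. pcoeff (F $ i * \<xi> ^ i) q)"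

lemma subst_eq_peval: "subst F \<xi> = peval (of_germ F) \<xi>"
  by (simp add: subst_def peval_def)

lemma peval_lift:
  assumes n: "n > 0" and s: "s $ 0 = 0"
  shows "peval (lift n G) (ramify n s) = ramify n (eval2 G s)"
proof -
  have "(\<Sum>i. pcoeff (lift n G $ i * ramify n s ^ i) q) = pcoeff (ramify n (eval2 G s)) q" for q
  proof (cases "\<exists>k. q = of_nat k / of_nat n")
    case True
    then obtain k where k: "q = of_nat k / of_nat n" by blast
    have "(\<Sum>i. pcoeff (lift n G $ i * ramify n s ^ i) q) = (\<Sum>i. (G $ i * s ^ i) $ k)"
      using n by (simp add: ramify_power ramify_mult k)
    also have "\<dots> = (\<Sum>i\<le>k. (G $ i * s ^ i) $ k)"
      by (rule suminf_finite) (auto intro: power_nth_zero[OF s])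
    finally show ?thesis using n by (simp add: k eval2_def fps_sum_nth)
  next
    case False
    then show ?thesis using n by (simp add: ramify_power ramify_mult pcoeff_ramify_outside)
  qed
  then show ?thesis by (simp add: peval_def pcoeff_inverse)
qed

lemma bounded_denom_pos2:
  assumes "bounded_denom F" "bounded_denom H" "pos \<gamma>"
  obtains n G K s where "n > 0" "s $ 0 = 0" "F = lift n G" "H = lift n K" "\<gamma> = ramify n s"
proof -
  obtain n G K where 1: "n > 0" "F = lift n G" "H = lift n K"
    using bounded_denom2[OF assms(1,2)] .
  obtain m t where 2: "m > 0" "\<gamma> = ramify m t" using ex_ramify by blast
  let ?s = "Abs_fps (\<lambda>k. if n dvd k then t $ (k div n) else 0)"
  show ?thesis
  proof (rule that[of "n * m" ?s "refine m G" "refine m K"])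
    show \<gamma>: "\<gamma> = ramify (n * m) ?s"
      using ramify_refine_explicit[OF 2(1) 1(1), of t] 2(2) by (simp add: mult.commute)
    show "?s $ 0 = 0"
      using assms(3) 2(2) pcoeff_ramify[OF 2(1), of t 0] by (simp add: pos_def)
    show "n * m > 0" using 1(1) 2(1) by simp
    show "F = lift (n * m) (refine m G)" using lift_refine[OF 1(1) 2(1)] 1(2) by simp
    show "H = lift (n * m) (refine m K)" using lift_refine[OF 1(1) 2(1)] 1(3) by simp
  qed
qed

lemma peval_mult:
  "bounded_denom F \<Longrightarrow> bounded_denom G \<Longrightarrow> pos \<gamma> \<Longrightarrow> peval (F * G) \<gamma> = peval F \<gamma> * peval G \<gamma>"
  by (erule (2) bounded_denom_pos2)
    (simp add: lift_mult[symmetric] peval_lift eval2_mult ramify_mult)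

lemma peval_add:
  "bounded_denom F \<Longrightarrow> bounded_denom G \<Longrightarrow> pos \<gamma> \<Longrightarrow> peval (F + G) \<gamma> = peval F \<gamma> + peval G \<gamma>"
  by (erule (2) bounded_denom_pos2)
    (simp add: lift_add[symmetric] peval_lift eval2_add ramify_add)

lemma peval_const:
  assumes "pos \<gamma>"
  shows "peval (fps_const a) \<gamma> = a"
proof -
  obtain n s t where n: "n > 0" and \<gamma>: "\<gamma> = ramify n s" and a: "a = ramify n t"
    using ex_ramify2 by blast
  have "s $ 0 = 0" using assms pcoeff_ramify[OF n, of s 0] by (simp add: \<gamma> pos_def)
  then show ?thesis
    unfolding a \<gamma> lift_const[symmetric] using n by (simp add: peval_lift eval2_const)
qed

lemma peval_X:
  assumes "pos \<gamma>"
  shows "peval fps_X \<gamma> = \<gamma>"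
proof -
  obtain n s where n: "n > 0" and \<gamma>: "\<gamma> = ramify n s" using ex_ramify by blast
  have "s $ 0 = 0" using assms pcoeff_ramify[OF n, of s 0] by (simp add: \<gamma> pos_def)
  then show ?thesis
    unfolding \<gamma> lift_X[OF n, symmetric] using n by (simp add: peval_lift eval2_X)
qed

lemma peval_uminus:
  assumes "bounded_denom F" "pos \<gamma>"
  shows "peval (- F) \<gamma> = - peval F \<gamma>"
proof -
  have "peval (fps_const (- 1) * F) \<gamma> = (- 1) * peval F \<gamma>"
    using assms by (subst peval_mult) (auto simp: bounded_denom_const peval_const)
  moreover have "fps_const (- 1) * F = - F"
    by (metis fps_const_1_eq_1 fps_const_neg mult_minus1)
  ultimately show ?thesis by simp
qed

lemma root_factor_eq: "root_factor a = fps_X + fps_const (- a)"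
  by (simp add: root_factor_def)

lemma bounded_denom_root_factor: "bounded_denom (root_factor a)"
  unfolding root_factor_eq by (intro bounded_denom_add bounded_denom_X bounded_denom_const)

lemma peval_root_factor: "pos \<gamma> \<Longrightarrow> peval (root_factor a) \<gamma> = \<gamma> - a"
  unfolding root_factor_eq
  using peval_add[OF bounded_denom_X bounded_denom_const, of \<gamma> "- a"]
  by (simp only: peval_const peval_X) simp

lemma bounded_denom_prod: "(\<And>i. i \<in> A \<Longrightarrow> bounded_denom (F i)) \<Longrightarrow> bounded_denom (prod F A)"
  by (induction A rule: infinite_finite_induct) (auto intro: bounded_denom_one bounded_denom_mult)

lemma bounded_denom_power: "bounded_denom F \<Longrightarrow> bounded_denom (F ^ n)"
  by (induction n) (auto intro: bounded_denom_one bounded_denom_mult)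

lemma peval_one: "pos \<gamma> \<Longrightarrow> peval 1 \<gamma> = 1"
  using peval_const[of \<gamma> 1] by simp

lemma peval_power: "bounded_denom F \<Longrightarrow> pos \<gamma> \<Longrightarrow> peval (F ^ n) \<gamma> = peval F \<gamma> ^ n"
  by (induction n) (auto simp: peval_one peval_mult bounded_denom_power)

lemma peval_prod:
  "(\<And>i. i \<in> A \<Longrightarrow> bounded_denom (F i)) \<Longrightarrow> pos \<gamma> \<Longrightarrow> peval (prod F A) \<gamma> = (\<Prod>i\<in>A. peval (F i) \<gamma>)"
  by (induction A rule: infinite_finite_induct) (auto simp: peval_one peval_mult bounded_denom_prod)

text \<open>The cofactor may have unbounded denominators, so the evaluation map, which only makes sense
  with bounded denominators, cannot be applied to it; the partial sums telescope instead.\<close>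

lemma root_factor_dvd_imp_peval_0:
  assumes "root_factor \<gamma> dvd F" "pos \<gamma>"
  shows "peval F \<gamma> = 0"
proof -
  obtain H where F: "F = root_factor \<gamma> * H" using assms(1) by blast
  obtain e where e: "e > 0" "vanishes_below e \<gamma>" using assms(2) by (rule pos_vanishes)
  have tele: "(\<Sum>i<Suc N. F $ i * \<gamma> ^ i) = - (\<gamma> ^ Suc N * H $ N)" for N
  proof (induction N)
    case 0
    show ?case by (simp add: F root_factor_def left_diff_distrib)
  next
    case (Suc N)
    have "F $ Suc N = H $ N - \<gamma> * H $ Suc N" by (simp add: F root_factor_def left_diff_distrib)
    then have "(\<Sum>i<Suc (Suc N). F $ i * \<gamma> ^ i)
        = - (\<gamma> ^ Suc N * H $ N) + (H $ N - \<gamma> * H $ Suc N) * \<gamma> ^ Suc N"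
      by (simp only: sum.lessThan_Suc[of _ "Suc N"] Suc)
    also have "\<dots> = - (\<gamma> ^ Suc (Suc N) * H $ Suc N)" by (simp add: algebra_simps)
    finally show ?case .
  qed
  have "(\<lambda>i. pcoeff (F $ i * \<gamma> ^ i) q) sums 0" for q
    unfolding sums_def
  proof (rule tendsto_eventually)
    obtain N0 :: nat where N0: "q / e < of_nat N0" using reals_Archimedean2 by blast
    have "(\<Sum>i<N. pcoeff (F $ i * \<gamma> ^ i) q) = 0" if "N \<ge> Suc N0" for N
    proof -
      define M where "M = N - 1"
      then have M: "N = Suc M" "N0 \<le> M" using that by auto
      have "vanishes_below (of_nat N * e + 0) (\<gamma> ^ N * H $ M)"
        by (intro vanishes_below_mult vanishes_below_power e vanishes_below_trivial) simp
      moreover have "q < of_nat N * e"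
      proof -
        have "q < of_nat N0 * e" using N0 e by (simp add: field_simps)
        also have "\<dots> \<le> of_nat N * e" using e M by (intro mult_right_mono) auto
        finally show ?thesis .
      qed
      ultimately have "pcoeff (\<gamma> ^ N * H $ M) q = 0" by (simp add: vanishes_below_def)
      then show ?thesis using tele[of M] unfolding M(1) pcoeff_sum[symmetric] by simp
    qed
    then show "\<forall>\<^sub>F N in sequentially. (\<Sum>i<N. pcoeff (F $ i * \<gamma> ^ i) q) = 0"
      by (auto simp: eventually_sequentially)
  qed
  then have "(\<lambda>q. \<Sum>i. pcoeff (F $ i * \<gamma> ^ i) q) = pcoeff 0"
    by (intro ext) (simp add: sums_iff)
  then show ?thesis unfolding peval_def by (simp only: pcoeff_inverse)
qed


section \<open>The derivation \<open>y d/dy\<close>\<close>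

lift_definition theta :: "puiseux \<Rightarrow> puiseux" is "\<lambda>a q. of_rat q * a q"
  by auto

lemma pcoeff_theta [simp]: "pcoeff (theta a) q = of_rat q * pcoeff a q"
  by (simp add: theta.rep_eq)

lemma theta_ramify: "n > 0 \<Longrightarrow> theta (ramify n s) = ramify n (fps_const (1 / of_nat n) * (fps_X * fps_deriv s))"
proof (rule puiseux_eqI)
  fix q assume n: "n > 0"
  show "pcoeff (theta (ramify n s)) q = pcoeff (ramify n (fps_const (1 / of_nat n) * (fps_X * fps_deriv s))) q"
  proof (cases "\<exists>k. q = of_nat k / of_nat n")
    case True
    then obtain k where k: "q = of_nat k / of_nat n" by blast
    have "pcoeff (theta (ramify n s)) q = of_nat k / of_nat n * s $ k"
      unfolding pcoeff_theta k pcoeff_ramify[OF n] by (simp add: of_rat_divide)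
    moreover have "(fps_X * fps_deriv s) $ k = of_nat k * s $ k" by (cases k) auto
    ultimately show ?thesis unfolding k pcoeff_ramify[OF n] by simp
  next
    case False
    then show ?thesis by (simp add: pcoeff_ramify_outside)
  qed
qed

definition theta_coeffs :: "puiseux fps \<Rightarrow> puiseux fps" where
  "theta_coeffs F = Abs_fps (\<lambda>i. theta (F $ i))"

lemma ramify_of_nat: "n > 0 \<Longrightarrow> ramify n (of_nat k) = of_nat k"
  by (induction k) (auto simp: ramify_add[symmetric] ramify_1)

lemma fps_deriv_lift: "n > 0 \<Longrightarrow> fps_deriv (lift n G) = lift n (fps_deriv G)"
  by (rule fps_ext) (simp add: ramify_mult[symmetric] ramify_add[symmetric] ramify_1 ramify_of_nat)

lemma theta_coeffs_lift:
  "n > 0 \<Longrightarrow> theta_coeffs (lift n G)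
    = lift n (fps_const (fps_const (1 / of_nat n)) * Abs_fps (\<lambda>i. fps_X * fps_deriv (G $ i)))"
  by (rule fps_ext) (simp add: theta_coeffs_def theta_ramify)

lemma theta_peval:
  assumes "bounded_denom F" "pos \<gamma>"
  shows "theta (peval F \<gamma>) = peval (fps_deriv F) \<gamma> * theta \<gamma> + peval (theta_coeffs F) \<gamma>"
proof -
  obtain n G s where n: "n > 0" and s: "s $ 0 = 0" and F: "F = lift n G" and \<gamma>: "\<gamma> = ramify n s"
    using bounded_denom_pos2[OF assms(1,1,2)] by metis
  let ?c = "fps_const (1 / of_nat n) :: complex fps"
  have "theta (peval F \<gamma>) = ramify n (?c * (fps_X * fps_deriv (eval2 G s)))"
    unfolding F \<gamma> using n s by (simp add: peval_lift theta_ramify)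
  also have "?c * (fps_X * fps_deriv (eval2 G s))
      = eval2 (fps_deriv G) s * (?c * (fps_X * fps_deriv s))
        + eval2 (fps_const ?c * Abs_fps (\<lambda>i. fps_X * fps_deriv (G $ i))) s"
    unfolding eval2_chain[OF s] eval2_mult[OF s] eval2_const[OF s] by (simp only: algebra_simps)
  also have "ramify n \<dots> = peval (fps_deriv F) \<gamma> * theta \<gamma> + peval (theta_coeffs F) \<gamma>"
    unfolding F \<gamma> fps_deriv_lift[OF n] theta_coeffs_lift[OF n] theta_ramify[OF n]
      peval_lift[OF n s] using n by (simp only: ramify_mult ramify_add)
  finally show ?thesis .
qed

lemma bounded_denom_deriv: "bounded_denom F \<Longrightarrow> bounded_denom (fps_deriv F)"
  unfolding bounded_denom_def using fps_deriv_lift by metis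

lemma bounded_denom_theta: "bounded_denom F \<Longrightarrow> bounded_denom (theta_coeffs F)"
  unfolding bounded_denom_def using theta_coeffs_lift by metis


section \<open>Conjugation of fractional power series\<close>

text \<open>\<open>galois j\<close> continues \<open>y\<close> \<open>j\<close> times around the origin: \<open>y^q\<close> becomes
  \<open>exp (2 \<pi> i j q) y^q\<close>.\<close>

lift_definition galois :: "int \<Rightarrow> puiseux \<Rightarrow> puiseux" is
  "\<lambda>j a q. cis (2 * pi * (of_int j * of_rat q)) * a q"
  by auto

lemma pcoeff_galois: "pcoeff (galois j a) q = cis (2 * pi * (of_int j * of_rat q)) * pcoeff a q"
  by (simp add: galois.rep_eq)

lemma pcoeff_galois_eq_0_iff [simp]: "pcoeff (galois j a) q = 0 \<longleftrightarrow> pcoeff a q = 0"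
  by (simp add: pcoeff_galois)

lemma galois_add: "galois j (a + b) = galois j a + galois j b"
  by (rule puiseux_eqI) (simp add: pcoeff_galois algebra_simps)

lemma galois_diff: "galois j (a - b) = galois j a - galois j b"
  by (rule puiseux_eqI) (simp add: pcoeff_galois algebra_simps)

lemma galois_0 [simp]: "galois j 0 = 0"
  by (rule puiseux_eqI) (simp add: pcoeff_galois)

lemma galois_1 [simp]: "galois j 1 = 1"
  by (rule puiseux_eqI) (simp add: pcoeff_galois pcoeff_one)

lemma galois_mult: "galois j (a * b) = galois j a * galois j b"
proof (rule puiseux_eqI)
  fix q
  let ?c = "\<lambda>q. cis (2 * pi * (of_int j * of_rat q))"
  have c: "?c q = ?c p * ?c (q - p)" for p
    by (simp add: cis_mult algebra_simps of_rat_diff)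
  have "pcoeff (galois j a * galois j b) q
      = (\<Sum>p | pcoeff a p \<noteq> 0 \<and> pcoeff b (q - p) \<noteq> 0. ?c q * (pcoeff a p * pcoeff b (q - p)))"
    unfolding times_puiseux.rep_eq convolve_def pcoeff_galois_eq_0_iff
  proof (intro sum.cong refl)
    fix p
    show "pcoeff (galois j a) p * pcoeff (galois j b) (q - p) = ?c q * (pcoeff a p * pcoeff b (q - p))"
      unfolding pcoeff_galois c[of p] by (simp only: mult_ac)
  qed
  also have "\<dots> = pcoeff (galois j (a * b)) q"
    unfolding pcoeff_galois times_puiseux.rep_eq convolve_def sum_distrib_left ..
  finally show "pcoeff (galois j (a * b)) q = pcoeff (galois j a * galois j b) q" ..
qed

lemma galois_power: "galois j (a ^ n) = galois j a ^ n"
  by (induction n) (auto simp: galois_mult)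

lemma galois_galois [simp]: "galois i (galois j a) = galois (i + j) a"
proof (rule puiseux_eqI)
  fix q
  have "2 * pi * (of_int i * of_rat q) + 2 * pi * (of_int j * of_rat q)
      = 2 * pi * (of_int (i + j) * of_rat q)"
    by (simp add: distrib_left distrib_right)
  then have "cis (2 * pi * (of_int i * of_rat q)) * cis (2 * pi * (of_int j * of_rat q))
      = cis (2 * pi * (of_int (i + j) * of_rat q))"
    by (simp only: cis_mult)
  then show "pcoeff (galois i (galois j a)) q = pcoeff (galois (i + j) a) q"
    unfolding pcoeff_galois by (metis mult.assoc)
qed

lemma galois_zero_index [simp]: "galois 0 a = a"
  by (rule puiseux_eqI) (simp add: pcoeff_galois)

lemma galois_inject [simp]: "galois j a = galois j b \<longleftrightarrow> a = b"
  by (metis galois_galois galois_zero_index add.left_inverse)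

lemma galois_ramify:
  assumes "n > 0"
  shows "galois j (ramify n s) = ramify n (Abs_fps (\<lambda>k. cis (2 * pi * (of_int j * (of_nat k / of_nat n))) * s $ k))"
    (is "_ = ramify n ?t")
proof (rule puiseux_eqI)
  fix q
  show "pcoeff (galois j (ramify n s)) q = pcoeff (ramify n ?t) q"
  proof (cases "\<exists>k. q = of_nat k / of_nat n")
    case True
    then obtain k where k: "q = of_nat k / of_nat n" by blast
    show ?thesis using assms by (simp add: k pcoeff_galois of_rat_divide)
  next
    case False
    then show ?thesis by (simp add: pcoeff_ramify_outside)
  qed
qed

lemma conv_puiseux_galois: "conv_puiseux a \<Longrightarrow> conv_puiseux (galois j a)"
  by (erule conv_puiseuxE) (simp add: galois_ramify conv_puiseuxI convergent2_const_iff norm_mult)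

lemma galois_ramify_1 [simp]: "galois j (ramify 1 s) = ramify 1 s"
proof -
  have "cis (2 * pi * (of_int j * real k)) = 1" for k
    using cis_multiple_2pi[of "of_int j * real k"] by (simp add: Ints_mult)
  then have "Abs_fps (\<lambda>k. cis (2 * pi * (of_int j * (of_nat k / of_nat 1))) * s $ k) = s"
    by (intro fps_ext) simp
  then show ?thesis using galois_ramify[of 1 j s] by simp
qed

text \<open>The fixed series of \<open>galois\<close> are exactly the power series in \<open>y\<close>, since
  \<open>exp (2 \<pi> i q) = 1\<close> only for integers \<open>q\<close>.\<close>

lemma galois_fixed_imp:
  assumes "galois 1 a = a"
  obtains s where "a = ramify 1 s"
proof -
  obtain n t where n: "n > 0" "a = ramify n t" using ex_ramify by blast
  have supp: "q \<in> \<int>" if "pcoeff a q \<noteq> 0" for q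
  proof -
    have "cis (2 * pi * of_rat q) = 1"
      using arg_cong[OF assms(1), of "\<lambda>a. pcoeff a q"] that by (simp add: pcoeff_galois)
    then obtain m where "of_rat q = (of_int m :: real)"
      by (auto simp: complex_eq_iff cos_one_2pi_int)
    then have "q = of_int m" by (metis of_rat_eq_iff of_rat_of_int_eq)
    then show ?thesis by simp
  qed
  define s where "s = Abs_fps (\<lambda>k. t $ (k * n))"
  have "a = ramify 1 s"
  proof (rule puiseux_eqI)
    fix q
    show "pcoeff a q = pcoeff (ramify 1 s) q"
    proof (cases "\<exists>k. q = of_nat k / of_nat 1")
      case True
      then obtain k where k: "q = of_nat k" by auto
      have "q = of_nat (k * n) / of_nat n" using n by (simp add: k)
      then have "pcoeff a q = t $ (k * n)" unfolding n(2) using n(1) by (metis pcoeff_ramify)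
      also have "\<dots> = s $ k" by (simp add: s_def)
      also have "\<dots> = pcoeff (ramify 1 s) q" using pcoeff_ramify[of 1 s k] by (simp add: k)
      finally show ?thesis .
    next
      case False
      have "pcoeff a q = 0"
      proof (rule ccontr)
        assume nz: "pcoeff a q \<noteq> 0"
        then obtain m where m: "q = of_int m" using supp by (auto elim: Ints_cases)
        have "\<not> q < 0" using nz pcoeff_neg by blast
        then have "q = of_nat (nat m) / of_nat 1" using m by simp
        with False show False by blast
      qed
      with False show ?thesis by (simp add: pcoeff_ramify_outside)
    qed
  qed
  then show ?thesis by (rule that)
qed

definition galois_coeffs :: "int \<Rightarrow> puiseux fps \<Rightarrow> puiseux fps" where
  "galois_coeffs j F = Abs_fps (\<lambda>i. galois j (F $ i))"

lemma galois_sum: "galois j (sum f A) = (\<Sum>i\<in>A. galois j (f i))"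
  by (induction A rule: infinite_finite_induct) (auto simp: galois_add)

lemma galois_coeffs_mult: "galois_coeffs j (F * G) = galois_coeffs j F * galois_coeffs j G"
  by (rule fps_ext) (simp add: galois_coeffs_def fps_mult_nth galois_sum galois_mult)

lemma galois_coeffs_one [simp]: "galois_coeffs j 1 = 1"
  by (rule fps_ext) (simp add: galois_coeffs_def)

lemma galois_coeffs_power: "galois_coeffs j (F ^ n) = galois_coeffs j F ^ n"
  by (induction n) (auto simp: galois_coeffs_mult)

lemma galois_coeffs_prod: "galois_coeffs j (prod F A) = (\<Prod>i\<in>A. galois_coeffs j (F i))"
  by (induction A rule: infinite_finite_induct) (auto simp: galois_coeffs_mult)

lemma galois_coeffs_root_factor: "galois_coeffs j (root_factor a) = root_factor (galois j a)"
  by (rule fps_ext) (auto simp: galois_coeffs_def root_factor_def fps_X_def galois_diff)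

lemma galois_of_germ_nth: "galois j (of_germ F $ i) = of_germ F $ i"
  unfolding of_germ_def fps_nth_Abs_fps by (rule galois_ramify_1)

lemma galois_coeffs_of_germ [simp]: "galois_coeffs j (of_germ F) = of_germ F"
  by (rule fps_ext) (simp add: galois_coeffs_def galois_of_germ_nth)

lemma pos_galois [simp]: "pos (galois j a) \<longleftrightarrow> pos a"
  by (simp add: pos_def)

lemma ord_y_galois [simp]: "ord_y (galois j a) = ord_y a"
  by (cases "a = 0") (auto simp: ord_y_def dest: arg_cong[of _ _ "galois (- j)"])

lemma of_germ_eq_lift: "of_germ F = lift 1 (Rep_germ F)"
  by (simp add: of_germ_def lift_def)

lemma conv_series_of_germ: "conv_series (of_germ F)"
  unfolding conv_series_def of_germ_eq_lift using Rep_germ[of F] by auto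

lemma bounded_denom_of_germ: "bounded_denom (of_germ F)"
  by (rule conv_series_bounded[OF conv_series_of_germ])

lemma of_germ_mult: "of_germ (F * G) = of_germ F * of_germ G"
  by (simp add: of_germ_eq_lift times_germ.rep_eq lift_mult)

lemma of_germ_add: "of_germ (F + G) = of_germ F + of_germ G"
  by (simp add: of_germ_eq_lift plus_germ.rep_eq lift_add)

lemma of_germ_one [simp]: "of_germ 1 = 1"
  by (rule fps_ext) (simp add: of_germ_eq_lift one_germ.rep_eq ramify_1)

lemma of_germ_zero [simp]: "of_germ 0 = 0"
  by (rule fps_ext) (simp add: of_germ_eq_lift zero_germ.rep_eq)

lemma of_germ_uminus: "of_germ (- F) = - of_germ F"
  by (simp add: of_germ_eq_lift uminus_germ.rep_eq lift_uminus)

lemma of_germ_inject [simp]: "of_germ F = of_germ G \<longleftrightarrow> F = G"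
  by (simp add: of_germ_eq_lift lift_inject Rep_germ_inject)

lemma of_germ_power: "of_germ (F ^ n) = of_germ F ^ n"
  by (induction n) (auto simp: of_germ_mult)

lemma galois_subst:
  assumes "pos \<gamma>"
  shows "subst F (galois j \<gamma>) = galois j (subst F \<gamma>)"
proof (rule puiseux_eqI)
  fix q
  let ?c = "cis (2 * pi * (of_int j * of_rat q))"
  obtain e where e: "e > 0" "vanishes_below e \<gamma>" using assms by (rule pos_vanishes)
  obtain N0 :: nat where N0: "q / e < of_nat N0" using reals_Archimedean2 by blast
  have fin: "pcoeff (of_germ F $ i * \<gamma> ^ i) q = 0" if "i \<notin> {..N0}" for i
  proof -
    have "vanishes_below (0 + of_nat i * e) (of_germ F $ i * \<gamma> ^ i)"
      by (intro vanishes_below_mult vanishes_below_power e vanishes_below_trivial) simp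
    moreover have "q < of_nat N0 * e" using N0 e by (simp add: field_simps)
    moreover have "of_nat N0 * e \<le> of_nat i * e"
      using that e by (intro mult_right_mono) auto
    ultimately show ?thesis by (simp add: vanishes_below_def)
  qed
  have coeff: "of_germ F $ i * galois j \<gamma> ^ i = galois j (of_germ F $ i * \<gamma> ^ i)" for i
    by (simp add: galois_mult galois_power galois_of_germ_nth)
  have "pcoeff (subst F (galois j \<gamma>)) q = (\<Sum>i. ?c * pcoeff (of_germ F $ i * \<gamma> ^ i) q)"
    unfolding pcoeff_subst coeff by (simp only: pcoeff_galois)
  also have "\<dots> = ?c * (\<Sum>i. pcoeff (of_germ F $ i * \<gamma> ^ i) q)"
    by (rule suminf_mult, rule summable_finite[of "{..N0}"]) (auto intro: fin)
  finally show "pcoeff (subst F (galois j \<gamma>)) q = pcoeff (galois j (subst F \<gamma>)) q"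
    by (simp add: pcoeff_subst pcoeff_galois)
qed

lemma np_root_iff: "np_root F \<gamma> \<longleftrightarrow> pos \<gamma> \<and> peval (of_germ F) \<gamma> = 0"
  by (simp add: np_root_def zero_less_ord_y_iff subst_eq_peval)

lemma np_root_galois: "np_root F \<gamma> \<Longrightarrow> np_root F (galois j \<gamma>)"
  by (simp add: np_root_def zero_less_ord_y_iff galois_subst)


section \<open>The Newton--Puiseux theorem\<close>

definition conv_poly :: "puiseux poly \<Rightarrow> bool" where
  "conv_poly p \<longleftrightarrow> (\<forall>i. conv_puiseux (coeff p i))"

lemma conv_poly_0: "conv_poly 0"
  by (simp add: conv_poly_def conv_puiseux_0)

lemma conv_poly_pCons_iff: "conv_poly (pCons a p) \<longleftrightarrow> conv_puiseux a \<and> conv_poly p"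
  unfolding conv_poly_def
proof safe
  assume *: "\<forall>i. conv_puiseux (coeff (pCons a p) i)"
  show "conv_puiseux a" using *[rule_format, of 0] by simp
  show "conv_puiseux (coeff p i)" for i using *[rule_format, of "Suc i"] by simp
next
  fix i assume "conv_puiseux a" "\<forall>i. conv_puiseux (coeff p i)"
  then show "conv_puiseux (coeff (pCons a p) i)" by (cases i) auto
qed

lemma conv_poly_add: "conv_poly p \<Longrightarrow> conv_poly q \<Longrightarrow> conv_poly (p + q)"
  by (simp add: conv_poly_def conv_puiseux_add)

lemma conv_poly_mult: "conv_poly p \<Longrightarrow> conv_poly q \<Longrightarrow> conv_poly (p * q)"
  unfolding conv_poly_def coeff_mult by (auto intro!: conv_puiseux_sum conv_puiseux_mult)

lemma conv_poly_pcompose: "conv_poly p \<Longrightarrow> conv_poly q \<Longrightarrow> conv_poly (pcompose p q)"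
proof (induction p)
  case (pCons a p)
  then show ?case
    unfolding pcompose_pCons conv_poly_pCons_iff
    by (intro conv_poly_add conv_poly_mult) (auto simp: conv_poly_pCons_iff conv_poly_0)
qed (simp add: conv_poly_0)

lemma conv_series_const: "conv_puiseux a \<Longrightarrow> conv_series (fps_const a)"
  by (simp add: conv_puiseux_def)

lemma conv_series_fps_of_poly: "conv_poly p \<Longrightarrow> conv_series (fps_of_poly p)"
proof (induction p)
  case 0
  show ?case using conv_series_const[OF conv_puiseux_0] by simp
next
  case (pCons a p)
  then show ?case unfolding fps_of_poly_pCons conv_poly_pCons_iff
    by (intro conv_series_add conv_series_mult conv_series_const conv_series_X) auto
qed

lemma bounded_denom_fps_of_poly: "bounded_denom (fps_of_poly p)"
proof (induction p)
  case 0
  show ?case using bounded_denom_const[of 0] by simp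
next
  case (pCons a p)
  then show ?case unfolding fps_of_poly_pCons
    by (intro bounded_denom_add bounded_denom_mult bounded_denom_const bounded_denom_X) auto
qed

lemma peval_fps_of_poly: "pos \<gamma> \<Longrightarrow> peval (fps_of_poly p) \<gamma> = poly p \<gamma>"
proof (induction p)
  case 0
  then show ?case using peval_const[of \<gamma> 0] by simp
next
  case (pCons a p)
  have "peval (fps_const a + fps_of_poly p * fps_X) \<gamma> = a + poly p \<gamma> * \<gamma>"
    using pCons.IH[OF pCons.prems] pCons.prems
    by (simp add: peval_add peval_mult bounded_denom_mult bounded_denom_fps_of_poly
        bounded_denom_const bounded_denom_X peval_const peval_X)
  then show ?case by (simp add: fps_of_poly_pCons mult.commute)
qed

lemma pcoeff_0_peval:
  assumes "bounded_denom F" "pos \<gamma>"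
  shows "pcoeff (peval F \<gamma>) 0 = pcoeff (F $ 0) 0"
proof -
  obtain n G s where n: "n > 0" "s $ 0 = 0" "F = lift n G" "\<gamma> = ramify n s"
    using bounded_denom_pos2[OF assms(1,1,2)] by metis
  have "pcoeff (ramify n t) 0 = t $ 0" for t using pcoeff_ramify[OF n(1), of t 0] by simp
  then show ?thesis unfolding n(3,4) peval_lift[OF n(1,2)] by (simp add: eval2_def)
qed

text \<open>Over a common denominator \<open>n\<close> of the coefficients this is Weierstrass preparation in
  \<open>x\<close> and \<open>y\<^sup>1\<^sup>/\<^sup>n\<close>.\<close>

lemma puiseux_weierstrass:
  assumes F: "conv_series F" and Fm: "pcoeff (F $ m) 0 \<noteq> 0"
    and Fi: "\<And>i. i < m \<Longrightarrow> pcoeff (F $ i) 0 = 0"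
  obtains U p where "conv_series U" "pcoeff (U $ 0) 0 \<noteq> 0" "F = U * fps_of_poly p"
    "conv_poly p" "lead_coeff p = 1" "degree p = m" "\<And>i. i < m \<Longrightarrow> pcoeff (coeff p i) 0 = 0"
proof -
  obtain n G where n: "n > 0" "convergent2 G" "F = lift n G"
    using F unfolding conv_series_def by blast
  have c0: "pcoeff (ramify n t) 0 = t $ 0" for t using pcoeff_ramify[OF n(1), of t 0] by simp
  have Gm: "G $ m $ 0 \<noteq> 0" using Fm by (simp add: n(3) c0)
  have Gi: "G $ i $ 0 = 0" if "i < m" for i using Fi[OF that] by (simp add: n(3) c0)
  obtain U W where U: "convergent2 U" "U $ 0 $ 0 \<noteq> 0" and W: "convergent2 W" "W $ m = 1"
      "\<And>i. i > m \<Longrightarrow> W $ i = 0" "\<And>i. i < m \<Longrightarrow> W $ i $ 0 = 0" and GUW: "G = U * W"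
    using weierstrass_preparation[OF n(2) Gm Gi] by metis
  define p where "p = (\<Sum>i\<le>m. monom (ramify n (W $ i)) i)"
  have cp: "coeff p i = ramify n (W $ i)" for i
    by (cases "i \<le> m") (auto simp: p_def coeff_sum W(3))
  have dp: "degree p = m"
    using W(2,3) n(1) by (intro antisym degree_le le_degree) (auto simp: cp ramify_1)
  have pW: "fps_of_poly p = lift n W" by (rule fps_ext) (simp add: cp)
  show ?thesis
  proof (rule that[of "lift n U" p])
    show "conv_series (lift n U)" by (rule conv_series_lift[OF n(1) U(1)])
    show "pcoeff (lift n U $ 0) 0 \<noteq> 0" using U(2) by (simp add: c0)
    show "F = lift n U * fps_of_poly p" by (simp add: pW n(3) GUW lift_mult[OF n(1)])
    show "conv_poly p"
      unfolding conv_poly_def cp using W(1) by (auto intro: conv_puiseuxI[OF n(1)] convergent2_row)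
    show "lead_coeff p = 1" by (simp add: dp cp W(2) ramify_1[OF n(1)])
    show "degree p = m" by (rule dp)
    show "pcoeff (coeff p i) 0 = 0" if "i < m" for i using W(4)[OF that] by (simp add: cp c0)
  qed
qed

lemma coeff_pcompose_shift_top:
  fixes p :: "'a::idom poly"
  assumes "degree p \<le> k"
  shows "coeff (pcompose p [:\<phi>, 1:]) k = coeff p k"
proof (cases "degree p = k")
  case True
  have "degree (pcompose p [:\<phi>, 1:]) = k" using True by (simp add: degree_pcompose)
  then show ?thesis using lead_coeff_comp[of "[:\<phi>, 1:]" p] True by simp
next
  case False
  then have "degree p < k" "degree (pcompose p [:\<phi>, 1:]) < k" using assms
    by (auto simp: degree_pcompose)
  then show ?thesis by (simp add: coeff_eq_0)
qed

text \<open>For a suitable \<open>\<phi>\<close> the translated polynomial therefore has no second coefficient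
  (the Tschirnhaus shift). Over \<open>\<complex>\<close> the formula also shows that a monic polynomial without second
  coefficient is not a \<open>d\<close>-th power of \<open>x - c\<close> with \<open>c \<noteq> 0\<close>.\<close>

lemma coeff_pcompose_shift_second:
  fixes p :: "'a::idom poly"
  shows "degree p \<le> Suc n \<Longrightarrow>
    coeff (pcompose p [:\<phi>, 1:]) n = coeff p n + of_nat (Suc n) * \<phi> * coeff p (Suc n)"
proof (induction p arbitrary: n)
  case 0
  then show ?case by simp
next
  case (pCons a p)
  let ?q = "pcompose p [:\<phi>, 1:]"
  have dp: "degree p \<le> n" using pCons.prems by (cases "p = 0") auto
  have *: "coeff (pcompose (pCons a p) [:\<phi>, 1:]) n = coeff [:a:] n + (\<phi> * coeff ?q n + coeff (pCons 0 ?q) n)"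
    by (simp add: pcompose_pCons)
  show ?case
  proof (cases n)
    case 0
    then show ?thesis using * coeff_pcompose_shift_top[of p 0 \<phi>] dp by simp
  next
    case (Suc m)
    have "coeff ?q m = coeff p m + of_nat (Suc m) * \<phi> * coeff p (Suc m)"
      using pCons.IH[of m] dp Suc by simp
    moreover have "coeff ?q (Suc m) = coeff p (Suc m)"
      using coeff_pcompose_shift_top[of p "Suc m" \<phi>] dp Suc by simp
    ultimately show ?thesis using * Suc by (simp add: algebra_simps)
  qed
qed

text \<open>Negative exponents do not exist here, so a quotient by \<open>y\<^sup>e\<close> has to be constructed.\<close>

lemma puiseux_divide_monomial:
  assumes e: "e \<ge> 0" and a: "vanishes_below e a"
  shows "\<exists>b. a = monomial 1 e * b \<and> (conv_puiseux a \<longrightarrow> conv_puiseux b)"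
proof -
  obtain n s where n: "n > 0" "a = ramify n s" "conv_puiseux a \<longrightarrow> convergent2 (fps_const s)"
    using ex_ramify[of a] conv_puiseuxE[of a] by metis
  obtain m t where m: "m > 0" "monomial 1 e = ramify m t" using ex_ramify by blast
  have "pcoeff (ramify m t) e \<noteq> 0" unfolding m(2)[symmetric] using e by (simp add: pcoeff_monomial)
  then obtain k where k: "e = of_nat k / of_nat m" using ramify_support by blast
  have nm: "n * m > 0" using n(1) m(1) by simp
  define s' where "s' = refine m (fps_const s) $ 0"
  have a': "a = ramify (n * m) s'"
    using lift_refine[OF n(1) m(1), of "fps_const s"] n(2)
    unfolding s'_def lift_const by (metis fps_nth_fps_const lift_nth)
  have conv': "conv_puiseux a \<longrightarrow> convergent2 (fps_const s')"
    unfolding s'_def using n(3) convergent2_refine[OF _ m(1)] convergent2_row by blast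
  have ek: "e = of_nat (n * k) / of_nat (n * m)" using n(1) by (simp add: k)
  define b where "b = ramify (n * m) (fps_shift (n * k) s')"
  have low: "s' $ j = 0" if "j < n * k" for j
  proof -
    have "(of_nat j :: rat) / of_nat (n * m) < e"
      unfolding ek using that nm by (intro divide_strict_right_mono) (simp_all only: of_nat_less_iff of_nat_0_less_iff)
    then have "pcoeff a (of_nat j / of_nat (n * m)) = 0" using a by (simp add: vanishes_below_def)
    then show ?thesis unfolding a' pcoeff_ramify[OF nm] .
  qed
  have "monomial 1 e = ramify (n * m) (fps_X ^ (n * k))"
  proof (rule puiseux_eqI)
    fix q
    show "pcoeff (monomial 1 e) q = pcoeff (ramify (n * m) (fps_X ^ (n * k))) q"
    proof (cases "\<exists>j. q = of_nat j / of_nat (n * m)")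
      case True
      then obtain j where j: "q = of_nat j / of_nat (n * m)" by blast
      have "q = e \<longleftrightarrow> j = n * k" unfolding ek j by (rule of_nat_divide_inject[OF nm])
      then have "pcoeff (monomial 1 e) q = (fps_X ^ (n * k)) $ j"
        using e by (simp add: pcoeff_monomial fps_X_power_iff)
      then show ?thesis unfolding j pcoeff_ramify[OF nm] .
    next
      case False
      then have "q \<noteq> e" using ek by blast
      with False show ?thesis by (simp add: pcoeff_monomial pcoeff_ramify_outside)
    qed
  qed
  then have "monomial 1 e * b = ramify (n * m) (fps_X ^ (n * k) * fps_shift (n * k) s')"
    by (simp only: b_def ramify_mult[OF nm])
  also have "fps_X ^ (n * k) * fps_shift (n * k) s' = s'"
    by (rule fps_ext) (simp add: fps_X_power_mult_nth low)
  finally have "a = monomial 1 e * b" by (simp only: a')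
  moreover have "conv_puiseux b" if "conv_puiseux a"
  proof -
    have "convergent2 (fps_const s')" using conv' that by blast
    then obtain r M where r: "r > 0" and M: "\<And>j. norm (s' $ j) * r ^ j \<le> M"
      unfolding convergent2_const_iff by blast
    have "norm (fps_shift (n * k) s' $ j) * r ^ j \<le> M / r ^ (n * k)" for j
    proof -
      have "norm (s' $ (j + n * k)) * r ^ j * r ^ (n * k) \<le> M"
        using M[of "j + n * k"] by (simp only: power_add mult.assoc)
      then show ?thesis using r by (simp add: pos_le_divide_eq)
    qed
    then have "convergent2 (fps_const (fps_shift (n * k) s'))"
      unfolding convergent2_const_iff using r by blast
    then show ?thesis unfolding b_def by (rule conv_puiseuxI[OF nm])
  qed
  ultimately show ?thesis by blast
qed

text \<open>The polynomial at \<open>y = 0\<close>.\<close>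

definition const_terms :: "puiseux poly \<Rightarrow> complex poly" where
  "const_terms p = map_poly (\<lambda>a. pcoeff a 0) p"

lemma coeff_const_terms: "coeff (const_terms p) i = pcoeff (coeff p i) 0"
  by (simp add: const_terms_def coeff_map_poly)

lemma const_terms_add: "const_terms (p + q) = const_terms p + const_terms q"
  by (rule poly_eqI) (simp add: coeff_const_terms)

lemma const_terms_mult: "const_terms (p * q) = const_terms p * const_terms q"
  by (rule poly_eqI) (simp add: coeff_const_terms coeff_mult pcoeff_sum)

lemma const_terms_pCons: "const_terms (pCons a p) = pCons (pcoeff a 0) (const_terms p)"
  by (rule poly_eqI) (simp add: coeff_const_terms coeff_pCons split: nat.split)

lemma const_terms_pcompose: "const_terms (pcompose p q) = pcompose (const_terms p) (const_terms q)"
proof (induction p)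
  case 0
  have "const_terms 0 = 0" by (rule poly_eqI) (simp add: coeff_const_terms)
  then show ?case by simp
next
  case (pCons a p)
  have "const_terms [:a:] = [:pcoeff a 0:]"
    by (rule poly_eqI) (simp add: coeff_const_terms coeff_pCons split: nat.split)
  then show ?case
    by (simp add: pcompose_pCons const_terms_add const_terms_mult const_terms_pCons pCons.IH)
qed

lemma pcoeff_0_poly: "pcoeff (poly p a) 0 = poly (const_terms p) (pcoeff a 0)"
proof (induction p)
  case 0
  have "const_terms 0 = 0" by (rule poly_eqI) (simp add: coeff_const_terms)
  then show ?case by simp
qed (simp add: const_terms_pCons)

text \<open>At \<open>y = 0\<close> the equation reads \<open>\<gamma>\<^sup>d = 0\<close>.\<close>

lemma pos_root_of_weierstrass:
  assumes "lead_coeff p = 1" "\<And>i. i < degree p \<Longrightarrow> pcoeff (coeff p i) 0 = 0" "poly p \<gamma> = 0"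
  shows "pos \<gamma>"
proof -
  have "const_terms p = monom 1 (degree p)"
  proof (rule poly_eqI)
    fix i
    consider "i < degree p" | "i = degree p" | "i > degree p" by linarith
    then show "coeff (const_terms p) i = coeff (monom 1 (degree p)) i"
      by cases (use assms(1,2) in \<open>auto simp: coeff_const_terms coeff_eq_0 pcoeff_one\<close>)
  qed
  then have "pcoeff \<gamma> 0 ^ degree p = 0"
    using arg_cong[OF assms(3), of "\<lambda>a. pcoeff a 0"] unfolding pcoeff_0_poly
    by (simp add: poly_monom)
  then show ?thesis by (simp add: pos_def)
qed

lemma of_nat_puiseux: "(of_nat n :: puiseux) = monomial (of_nat n) 0"
proof (induction n)
  case (Suc n)
  have "monomial (a + b) 0 = monomial a 0 + monomial b 0" for a b
    by (rule puiseux_eqI) (simp add: pcoeff_monomial)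
  then show ?case using Suc by simp
qed simp

text \<open>The proof is by induction on the degree \<open>d\<close>. After a Tschirnhaus shift, substitute
  \<open>y\<^sup>r x\<close> for \<open>x\<close>, with \<open>r\<close> the smallest slope of the Newton polygon, and divide by
  \<open>y\<^sup>r\<^sup>d\<close>. At \<open>y = 0\<close> the result \<open>H\<close> is monic of degree \<open>d\<close>, has no second
  coefficient, and is not \<open>x\<^sup>d\<close>. So a root \<open>c\<close> of it has multiplicity \<open>m < d\<close>, and
  Weierstrass preparation of \<open>H(x + c)\<close> leaves a polynomial of degree \<open>m\<close>. All steps
  preserve convergence.\<close>

theorem newton_puiseux_root:
  "conv_poly p \<Longrightarrow> lead_coeff p = 1 \<Longrightarrow> degree p > 0 \<Longrightarrow> \<exists>\<gamma>. conv_puiseux \<gamma> \<and> poly p \<gamma> = 0"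
proof (induction "degree p" arbitrary: p rule: less_induct)
  case less
  define d where "d = degree p"
  have d: "d > 0" using less.prems by (simp add: d_def)
  define \<phi> where "\<phi> = - (monomial (1 / of_nat d) 0 * coeff p (d - 1))"
  define p1 where "p1 = pcompose p [:\<phi>, 1:]"
  have conv\<phi>: "conv_puiseux \<phi>"
    using less.prems(1) unfolding \<phi>_def conv_poly_def
    by (intro conv_puiseux_uminus conv_puiseux_mult conv_puiseux_monomial) blast
  have conv_p1: "conv_poly p1"
    unfolding p1_def using conv\<phi>
    by (intro conv_poly_pcompose less.prems) (simp add: conv_poly_pCons_iff conv_poly_0 conv_puiseux_1)
  have deg_p1: "degree p1 = d" by (simp add: p1_def degree_pcompose d_def)
  have top_p1: "coeff p1 d = 1"
    using coeff_pcompose_shift_top[of p d \<phi>] less.prems by (simp add: p1_def d_def)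
  have second_p1: "coeff p1 (d - 1) = 0"
  proof -
    have "of_nat d * monomial (1 / of_nat d) 0 = (1 :: puiseux)"
      using d by (simp add: of_nat_puiseux monomial_mult)
    then have "of_nat d * \<phi> = - coeff p (d - 1)"
      by (simp add: \<phi>_def mult.assoc[symmetric])
    then show ?thesis
      using coeff_pcompose_shift_second[of p "d - 1" \<phi>] d less.prems by (simp add: p1_def d_def)
  qed
  have root_p: "poly p (\<phi> + w) = 0" if "poly p1 w = 0" for w
    using that by (simp add: p1_def poly_pcompose)
  define I where "I = {i. i < d \<and> coeff p1 i \<noteq> 0}"
  show ?case
  proof (cases "I = {}")
    case True
    then have "coeff p1 0 = 0" using d by (auto simp: I_def)
    then have "poly p1 0 = 0" by (simp add: poly_0_coeff_0)
    then show ?thesis using root_p[of 0] conv\<phi> by auto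
  next
    case False
    have finI: "finite I" by (simp add: I_def)
    \<comment> \<open>The slopes of the Newton polygon, seen from the vertex \<open>x\<^sup>d\<close>.\<close>
    define slope where "slope i = pord (coeff p1 i) / of_nat (d - i)" for i
    define r where "r = Min (slope ` I)"
    have "r \<in> slope ` I" unfolding r_def using False finI by (intro Min_in) auto
    then obtain i0 where i0: "i0 \<in> I" "slope i0 = r" by blast
    have i0': "i0 < d" "coeff p1 i0 \<noteq> 0" using i0 by (auto simp: I_def)
    have r0: "r \<ge> 0" using i0 pord_props(3)[OF i0'(2)] by (auto simp: slope_def)
    have r_min: "r * of_nat (d - i) \<le> pord (coeff p1 i)" if "i \<in> I" for i
    proof -
      have "r \<le> slope i" unfolding r_def using that finI by (intro Min_le) auto
      moreover have "(of_nat (d - i) :: rat) > 0" using that by (simp add: I_def)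
      ultimately show ?thesis by (simp add: slope_def pos_le_divide_eq)
    qed
    have "vanishes_below (r * of_nat (d - i)) (coeff p1 i)" if "i \<le> d" for i
    proof (cases "i \<in> I")
      case True
      then show ?thesis using r_min[OF True] pord_props(2)[of "coeff p1 i"]
        by (auto simp: I_def intro: vanishes_below_mono)
    next
      case False
      then show ?thesis using that by (cases "i = d") (auto simp: I_def vanishes_below_trivial)
    qed
    then have "\<forall>i\<in>{..d}. \<exists>b. coeff p1 i = monomial 1 (r * of_nat (d - i)) * b \<and> conv_puiseux b"
      using puiseux_divide_monomial conv_p1 r0 unfolding conv_poly_def
      by (metis atMost_iff mult_nonneg_nonneg of_nat_0_le_iff)
    then obtain h where h: "\<And>i. i \<le> d \<Longrightarrow> coeff p1 i = monomial 1 (r * of_nat (d - i)) * h i"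
      and conv_h: "\<And>i. i \<le> d \<Longrightarrow> conv_puiseux (h i)"
      by (metis atMost_iff bchoice)
    have hd: "h d = 1" using h[of d] top_p1 by simp
    have mono_nz: "monomial 1 e \<noteq> 0" if "e \<ge> 0" for e
    proof -
      have "pcoeff (monomial 1 e) e = 1" using that by (simp add: pcoeff_monomial)
      then show ?thesis by auto
    qed
    have h_second: "h (d - 1) = 0"
    proof -
      have "monomial 1 (r * of_nat (d - (d - 1))) * h (d - 1) = 0"
        using h[of "d - 1"] second_p1 by simp
      moreover have "monomial 1 (r * of_nat (d - (d - 1))) \<noteq> 0"
        by (rule mono_nz) (use r0 in simp)
      ultimately show ?thesis by simp
    qed
    have h_i0: "pcoeff (h i0) 0 \<noteq> 0"
    proof -
      define e where "e = r * of_nat (d - i0)"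
      have cancel: "a / b * b = a" if "b \<noteq> 0" for a b :: rat using that by simp
      have "(of_nat (d - i0) :: rat) \<noteq> 0" using i0'(1) by simp
      then have e: "e = pord (coeff p1 i0)"
        unfolding e_def i0(2)[symmetric] slope_def by (rule cancel)
      have hi: "coeff p1 i0 = monomial 1 e * h i0"
        unfolding e_def by (rule h) (use i0'(1) in simp)
      have "pcoeff (coeff p1 i0) e \<noteq> 0" unfolding e by (rule pord_props(1)[OF i0'(2)])
      then have "pcoeff (monomial 1 e * h i0) e \<noteq> 0" unfolding hi .
      moreover have "e \<ge> 0" unfolding e by (rule pord_props(3)[OF i0'(2)])
      ultimately show ?thesis by (simp add: pcoeff_monomial_mult)
    qed
    define H where "H = (\<Sum>i\<le>d. monom (h i) i)"
    have cH: "coeff H i = (if i \<le> d then h i else 0)" for i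
      by (simp add: H_def coeff_sum)
    have degH: "degree H = d" by (intro antisym degree_le le_degree) (auto simp: cH hd)
    have conv_H: "conv_poly H" by (simp add: conv_poly_def cH conv_h conv_puiseux_0)
    have root_p1: "poly p1 (monomial 1 r * w) = 0" if "poly H w = 0" for w
    proof -
      have "poly p1 (monomial 1 r * w) = (\<Sum>i\<le>d. monomial 1 (r * of_nat d) * (h i * w ^ i))"
        unfolding poly_altdef deg_p1
      proof (intro sum.cong refl)
        fix i assume "i \<in> {..d}"
        then have i: "i \<le> d" by simp
        have "monomial 1 (r * of_nat (d - i)) * monomial 1 r ^ i = monomial 1 (r * of_nat d)"
        proof -
          have a: "0 \<le> r * of_nat (d - i)" "0 \<le> of_nat i * r"
            by (intro mult_nonneg_nonneg r0 of_nat_0_le_iff)+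
          have "r * of_nat (d - i) + of_nat i * r = r * of_nat d"
            using i by (simp add: of_nat_diff algebra_simps)
          then show ?thesis
            unfolding monomial_power[OF r0] power_one monomial_mult[OF a] by (simp only: mult_1)
        qed
        then show "coeff p1 i * (monomial 1 r * w) ^ i = monomial 1 (r * of_nat d) * (h i * w ^ i)"
          unfolding h[OF i] power_mult_distrib by (metis mult.assoc mult.commute)
      qed
      also have "\<dots> = monomial 1 (r * of_nat d) * poly H w"
        unfolding poly_altdef degH sum_distrib_left by (intro sum.cong) (auto simp: cH)
      finally show ?thesis using that by simp
    qed
    define h0 where "h0 = const_terms H"
    have ch0: "coeff h0 i = (if i \<le> d then pcoeff (h i) 0 else 0)" for i
      by (simp add: h0_def coeff_const_terms cH)
    have deg_h0: "degree h0 = d"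
      by (intro antisym degree_le le_degree) (auto simp: ch0 hd pcoeff_one)
    have "\<not> (\<exists>a l. a \<noteq> 0 \<and> l = 0 \<and> h0 = pCons a l)" using deg_h0 d by auto
    then obtain c where c: "poly h0 c = 0" using fundamental_theorem_of_algebra_alt by blast
    define c' where "c' = monomial c 0"
    define K where "K = pcompose H [:c', 1:]"
    have conv_K: "conv_poly K" unfolding K_def c'_def
      by (intro conv_poly_pcompose conv_H)
        (simp add: conv_poly_pCons_iff conv_poly_0 conv_puiseux_1 conv_puiseux_monomial)
    have "const_terms [:c', 1:] = [:c, 1:]"
      by (rule poly_eqI)
        (simp add: coeff_const_terms coeff_pCons c'_def pcoeff_monomial pcoeff_one split: nat.split)
    then have K0: "const_terms K = pcompose h0 [:c, 1:]"
      by (simp add: K_def const_terms_pcompose h0_def)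
    have K_top: "pcoeff (coeff K d) 0 = 1"
      unfolding coeff_const_terms[symmetric] K0
      using coeff_pcompose_shift_top[of h0 d c] by (simp add: deg_h0 ch0 hd pcoeff_one)
    define m where "m = (LEAST i. pcoeff (coeff K i) 0 \<noteq> 0)"
    have m: "pcoeff (coeff K m) 0 \<noteq> 0" "m \<le> d"
      unfolding m_def using LeastI[of "\<lambda>i. pcoeff (coeff K i) 0 \<noteq> 0" d]
        Least_le[of "\<lambda>i. pcoeff (coeff K i) 0 \<noteq> 0" d] K_top by auto
    have m_low: "pcoeff (coeff K i) 0 = 0" if "i < m" for i
      using not_less_Least[of i "\<lambda>i. pcoeff (coeff K i) 0 \<noteq> 0"] that by (auto simp: m_def)
    have "pcoeff (coeff K 0) 0 = 0"
    proof -
      have "pcoeff (coeff K 0) 0 = poly (pcompose h0 [:c, 1:]) 0"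
        unfolding K0[symmetric] by (simp add: poly_0_coeff_0 coeff_const_terms)
      also have "\<dots> = 0" using c by (simp add: poly_pcompose)
      finally show ?thesis .
    qed
    then have "m > 0" using m(1) by (cases m) auto
    \<comment> \<open>Since \<open>h0\<close> has no term of degree \<open>d - 1\<close>, the root \<open>c\<close> cannot have multiplicity
      \<open>d\<close> unless \<open>c = 0\<close>, which the nonzero lower coefficient at \<open>i0\<close> excludes.\<close>
    have "m \<noteq> d"
    proof
      assume md: "m = d"
      have "pcoeff (coeff K (d - 1)) 0 = 0" using m_low[of "d - 1"] d md by simp
      moreover have "pcoeff (coeff K (d - 1)) 0 = of_nat d * c"
      proof -
        have S: "Suc (d - 1) = d" using d by simp
        have "coeff h0 (d - 1) = 0" unfolding ch0 h_second by simp
        moreover have "coeff h0 d = 1" by (simp add: ch0 hd pcoeff_one)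
        ultimately show ?thesis
          unfolding coeff_const_terms[symmetric] K0
          using coeff_pcompose_shift_second[of h0 "d - 1" c] unfolding S deg_h0 by simp
      qed
      ultimately have "c = 0" using d by simp
      then have "const_terms K = h0" by (simp add: K0)
      then have "pcoeff (coeff K i0) 0 \<noteq> 0"
        unfolding coeff_const_terms[symmetric] using h_i0 i0' by (simp add: ch0)
      then show False using m_low[of i0] md i0' by simp
    qed
    with m have "m < d" by simp
    obtain U W where U: "conv_series U" and UW: "fps_of_poly K = U * fps_of_poly W"
      and W: "conv_poly W" "lead_coeff W = 1" "degree W = m"
        "\<And>i. i < m \<Longrightarrow> pcoeff (coeff W i) 0 = 0"
      using puiseux_weierstrass[OF conv_series_fps_of_poly[OF conv_K], of m] m m_low by auto metis
    obtain \<gamma> where \<gamma>: "conv_puiseux \<gamma>" "poly W \<gamma> = 0"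
      using less.hyps[of W] W \<open>m < d\<close> \<open>m > 0\<close> d_def by auto
    have "pos \<gamma>" using W \<gamma> by (intro pos_root_of_weierstrass[of W]) auto
    then have "poly K \<gamma> = 0"
      using \<gamma>(2) peval_fps_of_poly[of \<gamma> K] peval_fps_of_poly[of \<gamma> W]
        peval_mult[OF conv_series_bounded[OF U] bounded_denom_fps_of_poly, of \<gamma> W]
      by (simp add: UW)
    then have "poly H (c' + \<gamma>) = 0" by (simp add: K_def poly_pcompose)
    then have "poly p (\<phi> + monomial 1 r * (c' + \<gamma>)) = 0" by (intro root_p root_p1)
    moreover have "conv_puiseux (\<phi> + monomial 1 r * (c' + \<gamma>))"
      unfolding c'_def
      by (intro conv_puiseux_add conv_puiseux_mult conv\<phi> conv_puiseux_monomial \<gamma>)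
    ultimately show ?thesis by blast
  qed
qed

lemma newton_puiseux_split:
  "conv_poly p \<Longrightarrow> lead_coeff p = 1 \<Longrightarrow> \<exists>\<gamma>s. (\<forall>\<gamma>\<in>set \<gamma>s. conv_puiseux \<gamma>) \<and> p = (\<Prod>\<gamma>\<leftarrow>\<gamma>s. [:- \<gamma>, 1:])"
proof (induction "degree p" arbitrary: p)
  case 0
  then obtain a where "p = [:a:]" by (metis degree_eq_zeroE)
  then have "p = 1" using "0.prems"(2) by (simp add: one_pCons)
  then show ?case by (intro exI[of _ "[]"]) auto
next
  case (Suc d)
  obtain \<gamma> where \<gamma>: "conv_puiseux \<gamma>" "poly p \<gamma> = 0"
    using newton_puiseux_root[OF Suc.prems] Suc.hyps(2) by auto
  then obtain q where q: "p = [:- \<gamma>, 1:] * q" by (metis poly_eq_0_iff_dvd dvdE)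
  have q1: "lead_coeff q = 1" using Suc.prems(2) unfolding q lead_coeff_mult by simp
  then have "q \<noteq> 0" by auto
  then have dq: "degree q = d"
    using Suc.hyps(2) degree_mult_eq[of "[:- \<gamma>, 1:]" q] by (simp add: q del: mult_pCons_left)
  have cq: "coeff q i = coeff p (Suc i) + \<gamma> * coeff q (Suc i)" for i
    by (simp add: q)
  have "conv_puiseux (coeff q i)" for i
  proof (cases "i \<le> Suc d")
    case True
    then show ?thesis
    proof (induction i rule: inc_induct)
      case base
      then show ?case using dq by (simp add: coeff_eq_0 conv_puiseux_0)
    next
      case (step i)
      show ?case unfolding cq[of i] using Suc.prems(1) step.IH \<gamma>(1)
        by (intro conv_puiseux_add conv_puiseux_mult) (auto simp: conv_poly_def)
    qed
  next
    case False
    then show ?thesis using dq by (simp add: coeff_eq_0 conv_puiseux_0)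
  qed
  then have "conv_poly q" by (simp add: conv_poly_def)
  then obtain \<gamma>s where "\<forall>\<gamma>\<in>set \<gamma>s. conv_puiseux \<gamma>" "q = (\<Prod>\<gamma>\<leftarrow>\<gamma>s. [:- \<gamma>, 1:])"
    using Suc.hyps(1)[of q] dq q1 by auto
  then show ?case using \<gamma>(1) q by (intro exI[of _ "\<gamma> # \<gamma>s"]) auto
qed


section \<open>Factorisation of germs\<close>

lemma convergent2_shift_rows:
  assumes "convergent2 F"
  shows "convergent2 (Abs_fps (\<lambda>i. fps_shift k (F $ i)))"
proof -
  obtain r M where r: "r > 0" "M \<ge> 0" and M: "\<And>i j. norm (F $ i $ j) * r ^ (i + j) \<le> M"
    using convergent2_boundE[OF assms] by metis
  have "norm (Abs_fps (\<lambda>i. fps_shift k (F $ i)) $ i $ j) * r ^ (i + j) \<le> M / r ^ k" for i j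
  proof -
    have "norm (F $ i $ (j + k)) * r ^ (i + j) * r ^ k \<le> M"
      using M[of i "j + k"] by (simp only: power_add mult.assoc)
    then show ?thesis using r by (simp add: pos_le_divide_eq)
  qed
  then show ?thesis unfolding convergent2_iff_bound using r(1) by blast
qed

lemma fps_of_poly_root_factor: "fps_of_poly [:- \<gamma>, 1:] = root_factor \<gamma>"
  by (simp add: fps_of_poly_pCons root_factor_def)

lemma of_germ_y: "of_germ germ_y = fps_const (ramify 1 fps_X)"
  unfolding of_germ_eq_lift germ_y.rep_eq by (rule lift_const)

text \<open>Divide \<open>F\<close> by the highest possible power of \<open>y\<close>, prepare the quotient, and split the
  Weierstrass polynomial. The unit is a germ in \<open>x\<close> and \<open>y\<close>, since preparation needs no
  fractional exponents.\<close>

lemma germ_factorization: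
  assumes "F \<noteq> 0"
  obtains v E \<gamma>s where "v dvd 1" "of_germ F = of_germ (v * germ_y ^ E) * (\<Prod>\<gamma>\<leftarrow>\<gamma>s. root_factor \<gamma>)"
    "\<And>\<gamma>. \<gamma> \<in> set \<gamma>s \<Longrightarrow> conv_puiseux \<gamma> \<and> pos \<gamma>"
proof -
  define R where "R = Rep_germ F"
  have convR: "convergent2 R" using Rep_germ[of F] by (simp add: R_def)
  have "R \<noteq> 0" using assms by (metis R_def Rep_germ_inject zero_germ.rep_eq)
  then obtain i1 j1 where "R $ i1 $ j1 \<noteq> 0" by (metis fps_ext fps_zero_nth)
  then have ex: "\<exists>j. \<exists>i. R $ i $ j \<noteq> 0" by blast
  define E where "E = (LEAST j. \<exists>i. R $ i $ j \<noteq> 0)"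
  have E: "\<exists>i. R $ i $ E \<noteq> 0" unfolding E_def using ex by (rule LeastI_ex)
  have E_low: "R $ i $ j = 0" if "j < E" for i j
    using not_less_Least[OF that[unfolded E_def]] by blast
  define R' where "R' = Abs_fps (\<lambda>i. fps_shift E (R $ i))"
  have R': "convergent2 R'" unfolding R'_def by (rule convergent2_shift_rows[OF convR])
  have RR': "R = fps_const (fps_X ^ E) * R'"
    by (rule fps_ext, rule fps_ext) (simp add: R'_def fps_X_power_mult_nth E_low)
  define m where "m = (LEAST i. R' $ i $ 0 \<noteq> 0)"
  have "\<exists>i. R' $ i $ 0 \<noteq> 0" using E by (simp add: R'_def)
  then have m: "R' $ m $ 0 \<noteq> 0" unfolding m_def by (rule LeastI_ex)
  have m_low: "R' $ i $ 0 = 0" if "i < m" for i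
    using not_less_Least[OF that[unfolded m_def]] by simp
  obtain U W where U: "convergent2 U" "U $ 0 $ 0 \<noteq> 0" and W: "convergent2 W" "W $ m = 1"
      "\<And>i. i > m \<Longrightarrow> W $ i = 0" "\<And>i. i < m \<Longrightarrow> W $ i $ 0 = 0" and UW: "R' = U * W"
    using weierstrass_preparation[OF R' m m_low] by metis
  define p where "p = (\<Sum>i\<le>m. monom (ramify 1 (W $ i)) i)"
  have cp: "coeff p i = ramify 1 (W $ i)" for i
    by (cases "i \<le> m") (auto simp: p_def coeff_sum W(3))
  have one: "ramify 1 1 = 1" by (rule ramify_1) simp
  have dp: "degree p = m"
    using W(2,3) one by (intro antisym degree_le le_degree) (auto simp: cp)
  have pW: "fps_of_poly p = lift 1 W" by (rule fps_ext) (simp only: cp fps_of_poly_nth lift_nth)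
  have lp: "lead_coeff p = 1" by (simp only: dp cp W(2) one)
  have convp: "conv_poly p"
    unfolding conv_poly_def cp using W(1) by (intro allI conv_puiseuxI convergent2_row) auto
  have c0: "pcoeff (ramify 1 t) 0 = t $ 0" for t using pcoeff_ramify[of 1 t 0] by simp
  have lowp: "pcoeff (coeff p i) 0 = 0" if "i < degree p" for i
    using W(4)[of i] that unfolding dp cp c0 by simp
  obtain \<gamma>s where \<gamma>s: "\<forall>\<gamma>\<in>set \<gamma>s. conv_puiseux \<gamma>" "p = (\<Prod>\<gamma>\<leftarrow>\<gamma>s. [:- \<gamma>, 1:])"
    using newton_puiseux_split[OF convp lp] by blast
  have "poly p \<gamma> = 0" if "\<gamma> \<in> set \<gamma>s" for \<gamma>
  proof -
    have "[:- \<gamma>, 1:] dvd p" unfolding \<gamma>s(2) using that by (intro prod_list_dvd) auto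
    then show ?thesis by (simp add: poly_eq_0_iff_dvd)
  qed
  then have posr: "pos \<gamma>" if "\<gamma> \<in> set \<gamma>s" for \<gamma>
    using that lp lowp by (intro pos_root_of_weierstrass[of p]) auto
  define v where "v = Abs_germ U"
  have Rv: "Rep_germ v = U" unfolding v_def using U(1) by (simp add: Abs_germ_inverse)
  obtain G where G: "convergent2 G" "U * G = 1" using convergent2_inverse[OF U] .
  have "v * Abs_germ G = 1"
    using G by (simp add: Rep_germ_inject[symmetric] times_germ.rep_eq one_germ.rep_eq Rv Abs_germ_inverse)
  then have v1: "v dvd 1" by (metis dvd_triv_left)
  have "lift 1 (fps_const (fps_X ^ E)) = fps_const (ramify 1 fps_X) ^ E"
    unfolding lift_const by (simp only: ramify_power[of 1, symmetric] fps_const_power zero_less_one)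
  then have "of_germ F = fps_const (ramify 1 fps_X) ^ E * (lift 1 U * lift 1 W)"
    unfolding of_germ_eq_lift R_def[symmetric] RR' UW by (simp only: lift_mult[of 1] zero_less_one)
  also have "\<dots> = of_germ (v * germ_y ^ E) * lift 1 W"
    unfolding of_germ_mult of_germ_power of_germ_y by (simp only: of_germ_eq_lift Rv mult_ac)
  also have "lift 1 W = (\<Prod>\<gamma>\<leftarrow>\<gamma>s. root_factor \<gamma>)"
    unfolding pW[symmetric] \<gamma>s(2) fps_of_poly_prod_list by (simp add: o_def fps_of_poly_root_factor)
  finally show ?thesis using that[OF v1] \<gamma>s(1) posr by blast
qed

lemma peval_unit: "v dvd 1 \<Longrightarrow> pos \<gamma> \<Longrightarrow> peval (of_germ v) \<gamma> \<noteq> 0"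
proof
  assume v: "v dvd 1" and \<gamma>: "pos \<gamma>" and 0: "peval (of_germ v) \<gamma> = 0"
  obtain w where "v * w = 1" using v by (metis dvdE)
  then have "peval (of_germ v * of_germ w) \<gamma> = 1"
    using \<gamma> by (simp add: of_germ_mult[symmetric] peval_one)
  then show False using 0 \<gamma> by (simp add: peval_mult bounded_denom_of_germ)
qed

lemma ramify_X_nonzero: "ramify 1 fps_X \<noteq> 0"
  using ramify_inject[of 1 fps_X 0] by simp

lemma peval_unit_y: "v dvd 1 \<Longrightarrow> pos \<gamma> \<Longrightarrow> peval (of_germ (v * germ_y ^ E)) \<gamma> \<noteq> 0"
  unfolding of_germ_mult of_germ_power of_germ_y
  using ramify_X_nonzero
  by (simp add: peval_mult bounded_denom_of_germ bounded_denom_power bounded_denom_const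
      peval_power peval_const peval_unit del: fps_const_power)

lemma prod_list_eq_prod_count:
  "(\<Prod>x\<leftarrow>xs. f x :: 'b::comm_monoid_mult) = (\<Prod>x\<in>set xs. f x ^ count_list xs x)"
proof -
  have "(\<Prod>x\<leftarrow>xs. f x) = (\<Prod>x\<in>A. f x ^ count_list xs x)" if "finite A" "set xs \<subseteq> A" for A
    using that(2)
  proof (induction xs)
    case (Cons y xs)
    have "(\<Prod>x\<in>A. f x ^ count_list (y # xs) x)
        = (\<Prod>x\<in>A. (if y = x then f x else 1) * f x ^ count_list xs x)"
      by (intro prod.cong) auto
    also have "\<dots> = f y * (\<Prod>x\<in>A. f x ^ count_list xs x)"
      using Cons.prems that(1) by (simp add: prod.distrib)
    finally show ?case using Cons by simp
  qed simp
  then show ?thesis by simp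
qed

text \<open>Multiplicities are defined by divisibility among series with arbitrary fractional
  coefficients. A root factor that divides forces the value at the root to vanish, and the
  remaining factors do not vanish there, so no further divisibility arises.\<close>

lemma factorization_roots:
  assumes v: "v dvd 1"
    and F: "of_germ F = of_germ (v * germ_y ^ E) * (\<Prod>\<gamma>\<leftarrow>\<gamma>s. root_factor \<gamma>)"
    and pos: "\<And>\<gamma>. \<gamma> \<in> set \<gamma>s \<Longrightarrow> pos \<gamma>"
  shows "np_root F \<gamma> \<longleftrightarrow> \<gamma> \<in> set \<gamma>s"
    and "pos \<gamma> \<Longrightarrow> root_multiplicity F \<gamma> = count_list \<gamma>s \<gamma>"
proof -
  have F': "of_germ F = of_germ (v * germ_y ^ E) * (\<Prod>\<gamma>\<in>set \<gamma>s. root_factor \<gamma> ^ count_list \<gamma>s \<gamma>)"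
    by (simp add: F prod_list_eq_prod_count)
  have ev: "peval (of_germ F) \<gamma>
      = peval (of_germ (v * germ_y ^ E)) \<gamma> * (\<Prod>\<beta>\<in>set \<gamma>s. (\<gamma> - \<beta>) ^ count_list \<gamma>s \<beta>)" if "pos \<gamma>" for \<gamma>
    unfolding F' using that
    by (simp add: peval_mult bounded_denom_of_germ bounded_denom_prod bounded_denom_power
        bounded_denom_root_factor peval_prod peval_power peval_root_factor)
  show "np_root F \<gamma> \<longleftrightarrow> \<gamma> \<in> set \<gamma>s"
  proof
    assume "np_root F \<gamma>"
    then have "pos \<gamma>" "peval (of_germ F) \<gamma> = 0" by (auto simp: np_root_iff)
    then have "(\<Prod>\<beta>\<in>set \<gamma>s. (\<gamma> - \<beta>) ^ count_list \<gamma>s \<beta>) = 0"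
      using ev peval_unit_y[OF v] by (metis mult_eq_0_iff)
    then show "\<gamma> \<in> set \<gamma>s" by auto
  next
    assume \<gamma>: "\<gamma> \<in> set \<gamma>s"
    then have "count_list \<gamma>s \<gamma> \<noteq> 0" by (simp add: count_list_0_iff)
    then have "(\<Prod>\<beta>\<in>set \<gamma>s. (\<gamma> - \<beta>) ^ count_list \<gamma>s \<beta>) = 0"
      using \<gamma> by (intro prod_zero) (auto intro!: bexI[of _ \<gamma>])
    then show "np_root F \<gamma>" using ev pos \<gamma> by (simp add: np_root_iff)
  qed
  assume \<gamma>: "pos \<gamma>"
  define c where "c = count_list \<gamma>s \<gamma>"
  define G where "G = of_germ (v * germ_y ^ E)
    * (\<Prod>\<beta>\<in>set \<gamma>s - {\<gamma>}. root_factor \<beta> ^ count_list \<gamma>s \<beta>)"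
  have FG: "of_germ F = root_factor \<gamma> ^ c * G"
  proof (cases "\<gamma> \<in> set \<gamma>s")
    case True
    then show ?thesis
      unfolding F' G_def c_def by (subst prod.remove[of _ \<gamma>]) (simp_all add: mult_ac)
  next
    case False
    then show ?thesis unfolding F' G_def c_def by simp
  qed
  have "peval G \<gamma> = peval (of_germ (v * germ_y ^ E)) \<gamma>
      * (\<Prod>\<beta>\<in>set \<gamma>s - {\<gamma>}. (\<gamma> - \<beta>) ^ count_list \<gamma>s \<beta>)"
    unfolding G_def using \<gamma>
    by (simp add: peval_mult bounded_denom_of_germ bounded_denom_prod bounded_denom_power
        bounded_denom_root_factor peval_prod peval_power peval_root_factor)
  also have "\<dots> \<noteq> 0" using peval_unit_y[OF v \<gamma>] by auto
  finally have G: "\<not> root_factor \<gamma> dvd G" using root_factor_dvd_imp_peval_0[OF _ \<gamma>] by blast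
  have rf: "root_factor \<gamma> \<noteq> 0"
  proof
    assume "root_factor \<gamma> = 0"
    then have "root_factor \<gamma> $ 1 = 0" by simp
    then show False by (simp add: root_factor_def)
  qed
  have "{m. root_factor \<gamma> ^ m dvd of_germ F} = {..c}"
  proof (intro set_eqI iffI)
    fix m assume "m \<in> {m. root_factor \<gamma> ^ m dvd of_germ F}"
    then have m: "root_factor \<gamma> ^ m dvd root_factor \<gamma> ^ c * G" by (simp add: FG)
    show "m \<in> {..c}"
    proof (rule ccontr)
      assume "m \<notin> {..c}"
      then have "Suc c \<le> m" by simp
      then have "root_factor \<gamma> ^ Suc c dvd root_factor \<gamma> ^ c * G"
        using m by (meson dvd_trans le_imp_power_dvd)
      then have "root_factor \<gamma> ^ c * root_factor \<gamma> dvd root_factor \<gamma> ^ c * G"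
        by (simp add: mult.commute)
      then have "root_factor \<gamma> ^ c = 0 \<or> root_factor \<gamma> dvd G" by (simp only: dvd_mult_cancel_left)
      then show False using G rf by simp
    qed
  next
    fix m assume "m \<in> {..c}"
    then have "root_factor \<gamma> ^ m dvd root_factor \<gamma> ^ c" by (intro le_imp_power_dvd) simp
    then show "m \<in> {m. root_factor \<gamma> ^ m dvd of_germ F}" by (simp add: FG)
  qed
  moreover have "Max {..c} = c" by (intro Max_eqI) auto
  ultimately show "root_multiplicity F \<gamma> = count_list \<gamma>s \<gamma>"
    by (simp add: root_multiplicity_def c_def)
qed

text \<open>In particular every formal root of a germ converges, because it is one of the convergent
  roots that the Newton--Puiseux theorem provides.\<close>

theorem germ_root_factorization:
  assumes "F \<noteq> 0"
  obtains v E where "v dvd 1"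
    "of_germ F = of_germ (v * germ_y ^ E) * (\<Prod>\<gamma> | np_root F \<gamma>. root_factor \<gamma> ^ root_multiplicity F \<gamma>)"
    "finite {\<gamma>. np_root F \<gamma>}"
    "\<And>\<gamma>. np_root F \<gamma> \<Longrightarrow> conv_puiseux \<gamma> \<and> root_multiplicity F \<gamma> > 0"
proof -
  obtain v E \<gamma>s where 1: "v dvd 1"
    "of_germ F = of_germ (v * germ_y ^ E) * (\<Prod>\<gamma>\<leftarrow>\<gamma>s. root_factor \<gamma>)"
    "\<And>\<gamma>. \<gamma> \<in> set \<gamma>s \<Longrightarrow> conv_puiseux \<gamma> \<and> pos \<gamma>"
    using germ_factorization[OF assms] by metis
  have R: "np_root F \<gamma> \<longleftrightarrow> \<gamma> \<in> set \<gamma>s" for \<gamma>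
    using factorization_roots(1)[OF 1(1,2)] 1(3) by blast
  then have S: "{\<gamma>. np_root F \<gamma>} = set \<gamma>s" by auto
  have M: "root_multiplicity F \<gamma> = count_list \<gamma>s \<gamma>" if "\<gamma> \<in> set \<gamma>s" for \<gamma>
    using factorization_roots(2)[OF 1(1,2)] 1(3) that by blast
  have "(\<Prod>\<gamma>\<leftarrow>\<gamma>s. root_factor \<gamma>) = (\<Prod>\<gamma>\<in>set \<gamma>s. root_factor \<gamma> ^ root_multiplicity F \<gamma>)"
    unfolding prod_list_eq_prod_count by (intro prod.cong) (auto simp: M)
  then show ?thesis
    using 1 by (intro that[of v E]) (auto simp: S R M count_list_0_iff intro!: Nat.gr0I)
qed


section \<open>Galois-invariant products and irreducible germs\<close>

text \<open>The bound on the series in \<open>y\<^sup>n\<close> transfers with the radius \<open>s\<^sup>n\<close>; the radius is first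
  taken at most \<open>1\<close>, so that this does not enlarge it in \<open>x\<close>.\<close>

lemma convergent2_of_refine:
  assumes "convergent2 (refine n G)" "n > 0"
  shows "convergent2 G"
proof -
  obtain r M where r: "r > 0" and M: "\<And>i j. norm (refine n G $ i $ j) * r ^ (i + j) \<le> M"
    using convergent2_boundE[OF assms(1)] by metis
  define s where "s = min r 1"
  have s: "0 < s" "s \<le> 1" "s \<le> r" using r by (auto simp: s_def)
  have "norm (G $ i $ j) * (s ^ n) ^ (i + j) \<le> M" for i j
  proof -
    have "(s ^ n) ^ (i + j) = s ^ (n * (i + j))" by (rule power_mult[symmetric])
    also have "\<dots> \<le> s ^ (i + n * j)"
      using s assms(2) by (intro power_decreasing) (auto simp: distrib_left)
    also have "\<dots> \<le> r ^ (i + n * j)" using s by (intro power_mono) auto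
    finally have "norm (G $ i $ j) * (s ^ n) ^ (i + j) \<le> norm (G $ i $ j) * r ^ (i + n * j)"
      by (intro mult_left_mono) auto
    also have "\<dots> \<le> M" using M[of i "n * j"] assms(2) by (simp add: refine_def)
    finally show ?thesis .
  qed
  then show ?thesis unfolding convergent2_iff_bound using s(1) by (intro exI[of _ "s ^ n"]) auto
qed

text \<open>Invariant coefficients have integral exponents, so the common denominator can be taken back.
  Convergence is shown for the whole double series, not coefficient by coefficient.\<close>

lemma galois_invariant_imp_germ:
  assumes "conv_series F" "galois_coeffs 1 F = F"
  shows "F \<in> range of_germ"
proof -
  obtain n G where n: "n > 0" "convergent2 G" "F = lift n G"
    using assms(1) unfolding conv_series_def by blast
  have "\<exists>s. F $ i = ramify 1 s" for i
  proof -
    have "galois 1 (F $ i) = F $ i"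
      using arg_cong[OF assms(2), of "\<lambda>F. F $ i"] by (simp add: galois_coeffs_def)
    then show ?thesis using galois_fixed_imp by metis
  qed
  then obtain s where s: "\<And>i. F $ i = ramify 1 (s i)" by metis
  define G' where "G' = Abs_fps s"
  have F: "F = lift 1 G'" by (rule fps_ext) (simp only: s lift_nth G'_def fps_nth_Abs_fps)
  also have "\<dots> = lift n (refine n G')"
    using lift_refine[OF zero_less_one n(1), of G'] unfolding mult_1 .
  finally have "lift n G = lift n (refine n G')" unfolding n(3) .
  then have "G = refine n G'" unfolding lift_inject[OF n(1)] .
  then have "convergent2 (refine n G')" using n(2) by simp
  then have "convergent2 G'" by (rule convergent2_of_refine[OF _ n(1)])
  then have "Rep_germ (Abs_germ G') = G'" by (simp add: Abs_germ_inverse)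
  then have "F = of_germ (Abs_germ G')" by (simp only: F of_germ_eq_lift)
  then show ?thesis by blast
qed

lemma conv_series_one: "conv_series 1"
  using conv_series_const[OF conv_puiseux_1] by simp

lemma conv_series_power: "conv_series F \<Longrightarrow> conv_series (F ^ n)"
  by (induction n) (auto intro: conv_series_one conv_series_mult)

lemma conv_series_prod: "(\<And>i. i \<in> A \<Longrightarrow> conv_series (F i)) \<Longrightarrow> conv_series (prod F A)"
  by (induction A rule: infinite_finite_induct) (auto intro: conv_series_one conv_series_mult)

lemma conv_series_root_factor: "conv_puiseux a \<Longrightarrow> conv_series (root_factor a)"
  unfolding root_factor_eq
  by (intro conv_series_add conv_series_X conv_series_const conv_puiseux_uminus)

lemma galois_image_eqI:
  assumes "\<And>\<gamma>. \<gamma> \<in> S \<Longrightarrow> galois 1 \<gamma> \<in> S" "\<And>\<gamma>. \<gamma> \<in> S \<Longrightarrow> galois (- 1) \<gamma> \<in> S"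
  shows "bij_betw (galois 1) S S"
  by (rule bij_betw_byWitness[of _ "galois (- 1)"]) (use assms in auto)

lemma germ_of_invariant_roots:
  assumes conv: "\<And>\<gamma>. \<gamma> \<in> S \<Longrightarrow> conv_puiseux \<gamma>"
    and inv: "\<And>j \<gamma>. \<gamma> \<in> S \<Longrightarrow> galois j \<gamma> \<in> S"
    and k: "\<And>\<gamma>. \<gamma> \<in> S \<Longrightarrow> k (galois 1 \<gamma>) = k \<gamma>"
  shows "(\<Prod>\<gamma>\<in>S. root_factor \<gamma> ^ k \<gamma>) \<in> range of_germ"
proof (rule galois_invariant_imp_germ)
  show "conv_series (\<Prod>\<gamma>\<in>S. root_factor \<gamma> ^ k \<gamma>)"
    by (intro conv_series_prod conv_series_power conv_series_root_factor conv)
  have "(\<Prod>\<gamma>\<in>S. root_factor \<gamma> ^ k \<gamma>) = (\<Prod>\<gamma>\<in>S. root_factor (galois 1 \<gamma>) ^ k (galois 1 \<gamma>))"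
    by (rule prod.reindex_bij_betw[symmetric], rule galois_image_eqI) (use inv in auto)
  also have "\<dots> = (\<Prod>\<gamma>\<in>S. root_factor (galois 1 \<gamma>) ^ k \<gamma>)"
    by (intro prod.cong) (auto simp: k)
  also have "\<dots> = galois_coeffs 1 (\<Prod>\<gamma>\<in>S. root_factor \<gamma> ^ k \<gamma>)"
    by (simp only: galois_coeffs_prod galois_coeffs_power galois_coeffs_root_factor)
  finally show "galois_coeffs 1 (\<Prod>\<gamma>\<in>S. root_factor \<gamma> ^ k \<gamma>) = (\<Prod>\<gamma>\<in>S. root_factor \<gamma> ^ k \<gamma>)" ..
qed

lemma root_multiplicity_galois: "root_multiplicity F (galois j \<gamma>) = root_multiplicity F \<gamma>"
proof -
  have imp: "root_factor (galois j \<gamma>) ^ m dvd of_germ F" if d: "root_factor \<gamma> ^ m dvd of_germ F" for j \<gamma> m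
  proof -
    obtain H where "of_germ F = root_factor \<gamma> ^ m * H" using d by (rule dvdE)
    then have "galois_coeffs j (of_germ F) = root_factor (galois j \<gamma>) ^ m * galois_coeffs j H"
      by (simp only: galois_coeffs_mult galois_coeffs_power galois_coeffs_root_factor)
    then show ?thesis by simp
  qed
  have "root_factor (galois j \<gamma>) ^ m dvd of_germ F \<longleftrightarrow> root_factor \<gamma> ^ m dvd of_germ F" for m
    using imp[of \<gamma> m j] imp[of "galois j \<gamma>" m "- j"] by auto
  then show ?thesis by (simp add: root_multiplicity_def)
qed

text \<open>The product over the remaining roots is invariant as well, hence a germ; so the quotient
  lies in \<open>\<complex>{x,y}\<close>.\<close>

lemma germ_split_off_roots:
  assumes F: "F \<noteq> 0" and T: "\<And>\<gamma>. \<gamma> \<in> T \<Longrightarrow> np_root F \<gamma>" and inv: "\<And>j \<gamma>. \<gamma> \<in> T \<Longrightarrow> galois j \<gamma> \<in> T"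
    and w: "of_germ w = (\<Prod>\<gamma>\<in>T. root_factor \<gamma>)"
  shows "w dvd F"
proof -
  obtain v E where 1: "of_germ F = of_germ (v * germ_y ^ E)
      * (\<Prod>\<gamma> | np_root F \<gamma>. root_factor \<gamma> ^ root_multiplicity F \<gamma>)"
    and fin: "finite {\<gamma>. np_root F \<gamma>}"
    and 2: "\<And>\<gamma>. np_root F \<gamma> \<Longrightarrow> conv_puiseux \<gamma> \<and> root_multiplicity F \<gamma> > 0"
    using germ_root_factorization[OF F] by metis
  define k where "k \<gamma> = root_multiplicity F \<gamma> - (if \<gamma> \<in> T then 1 else 0)" for \<gamma>
  have Tiff: "galois 1 \<gamma> \<in> T \<longleftrightarrow> \<gamma> \<in> T" for \<gamma>
    using inv[of \<gamma> 1] inv[of "galois 1 \<gamma>" "- 1"] by auto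
  have "(\<Prod>\<gamma> | np_root F \<gamma>. root_factor \<gamma> ^ k \<gamma>) \<in> range of_germ"
    by (rule germ_of_invariant_roots)
      (auto simp: 2 np_root_galois k_def root_multiplicity_galois Tiff)
  then obtain w' where w': "of_germ w' = (\<Prod>\<gamma> | np_root F \<gamma>. root_factor \<gamma> ^ k \<gamma>)" by (metis imageE)
  have "(\<Prod>\<gamma> | np_root F \<gamma>. root_factor \<gamma> ^ root_multiplicity F \<gamma>)
      = (\<Prod>\<gamma> | np_root F \<gamma>. (if \<gamma> \<in> T then root_factor \<gamma> else 1) * root_factor \<gamma> ^ k \<gamma>)"
  proof (intro prod.cong refl)
    fix \<gamma> assume "\<gamma> \<in> {\<gamma>. np_root F \<gamma>}"
    then have "root_multiplicity F \<gamma> > 0" using 2 by simp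
    then show "root_factor \<gamma> ^ root_multiplicity F \<gamma>
        = (if \<gamma> \<in> T then root_factor \<gamma> else 1) * root_factor \<gamma> ^ k \<gamma>"
      by (auto simp: k_def power_Suc[symmetric] simp del: power_Suc)
  qed
  also have "\<dots> = (\<Prod>\<gamma> | np_root F \<gamma>. if \<gamma> \<in> T then root_factor \<gamma> else 1) * of_germ w'"
    by (simp add: prod.distrib w')
  also have "(\<Prod>\<gamma> | np_root F \<gamma>. if \<gamma> \<in> T then root_factor \<gamma> else 1) = of_germ w"
  proof -
    have "T \<subseteq> {\<gamma>. np_root F \<gamma>}" using T by auto
    then have "{\<gamma>. np_root F \<gamma>} \<inter> {\<gamma>. \<gamma> \<in> T} = T" by auto
    then show ?thesis unfolding w using fin by (simp add: prod.If_cases)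
  qed
  finally have "of_germ F = of_germ (w * (v * germ_y ^ E * w'))"
    unfolding 1 of_germ_mult by (simp only: mult_ac)
  then show ?thesis by simp
qed

text \<open>A series in \<open>y\<^sup>1\<^sup>/\<^sup>n\<close> is fixed by \<open>galois n\<close>.\<close>

lemma finite_galois_orbit: "finite (range (\<lambda>j. galois j \<eta>))"
proof -
  obtain n s where n: "n > 0" "\<eta> = ramify n s" using ex_ramify by blast
  have "galois (int n * m) \<eta> = \<eta>" for m
  proof (rule puiseux_eqI)
    fix q
    show "pcoeff (galois (int n * m) \<eta>) q = pcoeff \<eta> q"
    proof (cases "pcoeff \<eta> q = 0")
      case False
      then obtain k where k: "q = of_nat k / of_nat n" using ramify_support n by metis
      have *: "of_int (int n * m) * of_rat q = (of_int (m * int k) :: real)"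
        using n(1) by (simp add: k of_rat_divide)
      have "cis (2 * pi * (of_int (int n * m) * of_rat q)) = 1"
        unfolding * by (rule cis_multiple_2pi) simp
      then show ?thesis unfolding pcoeff_galois by simp
    qed (simp add: pcoeff_galois)
  qed
  then have per: "galois j \<eta> = galois (j mod int n) \<eta>" for j
    using galois_galois[of "j mod int n" "int n * (j div int n)" \<eta>]
    by (simp only: mod_mult_div_eq)
  have "range (\<lambda>j. galois j \<eta>) \<subseteq> (\<lambda>j. galois j \<eta>) ` {0..<int n}"
  proof
    fix \<mu> assume "\<mu> \<in> range (\<lambda>j. galois j \<eta>)"
    then obtain j where "\<mu> = galois j \<eta>" by blast
    then have "\<mu> = galois (j mod int n) \<eta>" using per by simp
    then show "\<mu> \<in> (\<lambda>j. galois j \<eta>) ` {0..<int n}" using n(1) by simp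
  qed
  then show ?thesis by (rule finite_subset) simp
qed

lemma of_germ_eq_0_iff [simp]: "of_germ F = 0 \<longleftrightarrow> F = 0"
  using of_germ_inject[of F 0] by simp

lemma germ_mult_cancel: "w \<noteq> 0 \<Longrightarrow> w * a = w * b \<longleftrightarrow> (a :: germ) = b"
  unfolding of_germ_inject[symmetric] of_germ_mult by (simp add: of_germ_inject)

lemma np_root_mult: "np_root (a * b) \<gamma> \<longleftrightarrow> np_root a \<gamma> \<or> np_root b \<gamma>"
  by (auto simp: np_root_iff of_germ_mult peval_mult bounded_denom_of_germ)

text \<open>The germ is the minimal polynomial of \<open>\<eta>\<close>, the product over its conjugates. In any
  factorization one factor vanishes at \<open>\<eta>\<close>, hence at all conjugates, hence is divisible by the
  whole product.\<close>

lemma orbit_germ: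
  assumes "conv_puiseux \<eta>" "pos \<eta>"
  obtains w where "irreducible w" "\<And>\<xi>. np_root w \<xi> \<longleftrightarrow> (\<exists>j. \<xi> = galois j \<eta>)"
    "\<And>F. np_root F \<eta> \<Longrightarrow> w dvd F"
proof -
  define T where "T = range (\<lambda>j. galois j \<eta>)"
  have finT: "finite T" unfolding T_def by (rule finite_galois_orbit)
  have inv: "galois j \<gamma> \<in> T" if "\<gamma> \<in> T" for j \<gamma> using that by (auto simp: T_def)
  have convT: "conv_puiseux \<gamma>" if "\<gamma> \<in> T" for \<gamma>
    using that assms(1) by (auto simp: T_def conv_puiseux_galois)
  have posT: "pos \<gamma>" if "\<gamma> \<in> T" for \<gamma> using that assms(2) by (auto simp: T_def)
  have \<eta>T: "\<eta> \<in> T" unfolding T_def using galois_zero_index[of \<eta>] by (metis rangeI)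
  have "(\<Prod>\<gamma>\<in>T. root_factor \<gamma> ^ 1) \<in> range of_germ"
    by (rule germ_of_invariant_roots) (auto simp: convT inv)
  then obtain w where w: "of_germ w = (\<Prod>\<gamma>\<in>T. root_factor \<gamma>)" by auto
  have ev: "peval (of_germ w) \<xi> = (\<Prod>\<gamma>\<in>T. \<xi> - \<gamma>)" if "pos \<xi>" for \<xi>
    unfolding w using that by (simp add: peval_prod bounded_denom_root_factor peval_root_factor)
  have roots: "np_root w \<xi> \<longleftrightarrow> \<xi> \<in> T" for \<xi>
    using ev posT finT by (auto simp: np_root_iff)
  have dvd: "w dvd F" if "np_root F \<eta>" for F
  proof (cases "F = 0")
    case False
    show ?thesis
    proof (rule germ_split_off_roots[OF False _ inv w])
      fix \<gamma> assume "\<gamma> \<in> T"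
      then obtain j where "\<gamma> = galois j \<eta>" by (auto simp: T_def)
      then show "np_root F \<gamma>" using np_root_galois[OF that] by simp
    qed
  qed simp
  have w0: "w \<noteq> 0"
  proof
    assume "w = 0"
    then have "(\<Prod>\<gamma>\<in>T. root_factor \<gamma>) = 0" using w by simp
    then obtain \<gamma> where "root_factor \<gamma> = 0" using finT by auto
    then have "root_factor \<gamma> $ 1 = 0" by simp
    then show False by (simp add: root_factor_def)
  qed
  have "irreducible w"
  proof (rule irreducibleI)
    show "w \<noteq> 0" by (rule w0)
    show "\<not> w dvd 1"
    proof
      assume "w dvd 1"
      then have "peval (of_germ w) \<eta> \<noteq> 0" using peval_unit assms(2) by blast
      then show False using roots[of \<eta>] \<eta>T unfolding np_root_iff by blast
    qed
    fix a b assume ab: "w = a * b"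
    have unit: "b dvd 1" if a: "np_root a \<eta>" and ab: "w = a * b" for a b
    proof -
      obtain c where "a = w * c" using dvd[OF a] by (rule dvdE)
      then have "w * (c * b) = w * 1" using ab by (metis mult.assoc mult_1_right)
      then have "c * b = 1" using germ_mult_cancel[OF w0] by blast
      then show ?thesis by (metis dvd_triv_right)
    qed
    have "np_root (a * b) \<eta>" using roots \<eta>T ab by simp
    then show "a dvd 1 \<or> b dvd 1"
      unfolding np_root_mult using unit[of a b] unit[of b a] ab by (metis mult.commute)
  qed
  then show ?thesis using that[of w] roots dvd by (auto simp: T_def)
qed

text \<open>The irreducible \<open>p\<close> is divisible by the minimal polynomial of \<open>\<xi>\<close>, hence associated to
  it.\<close>

theorem irreducible_roots_conjugate:
  assumes p: "irreducible p" and \<xi>: "np_root p \<xi>" and \<xi>': "np_root p \<xi>'"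
  obtains j where "\<xi>' = galois j \<xi>"
proof -
  have p0: "p \<noteq> 0" using p by (auto simp: irreducible_def)
  have "conv_puiseux \<xi>" using germ_root_factorization[OF p0] \<xi> by metis
  moreover have "pos \<xi>" using \<xi> by (simp add: np_root_iff)
  ultimately obtain w where w: "irreducible w" "\<And>\<xi>'. np_root w \<xi>' \<longleftrightarrow> (\<exists>j. \<xi>' = galois j \<xi>)"
    "\<And>F. np_root F \<xi> \<Longrightarrow> w dvd F"
    by (rule orbit_germ) blast
  obtain c where c: "p = w * c" using w(3)[OF \<xi>] by (rule dvdE)
  have "\<not> w dvd 1" using w(1) by (auto simp: irreducible_def)
  then have "c dvd 1" using p c by (auto simp: irreducible_def)
  then have "\<not> np_root c \<xi>'" using peval_unit by (auto simp: np_root_iff)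
  then have "np_root w \<xi>'" using \<xi>' c by (simp add: np_root_mult)
  then show ?thesis using w(2) that by blast
qed


section \<open>The combinatorics of the tree\<close>

lemma less_contact_iff: "Fin h < contact r s \<longleftrightarrow> (\<forall>q\<le>h. pcoeff r q = pcoeff s q)"
  by (simp add: contact_def less_ord_y_iff)

lemma le_contact_iff: "Fin h \<le> contact r s \<longleftrightarrow> (\<forall>q<h. pcoeff r q = pcoeff s q)"
  by (simp add: contact_def le_ord_y_iff vanishes_below_def)

definition trunk_over :: "bar \<Rightarrow> complex \<Rightarrow> puiseux set" where
  "trunk_over B c = {r \<in> bar_roots B. pcoeff r (bar_height B) = c}"

lemma trunks_iff:
  "T \<in> trunks B \<longleftrightarrow>
    (\<exists>r\<in>bar_roots B. T = {s \<in> bar_roots B. \<forall>q\<le>bar_height B. pcoeff s q = pcoeff r q})"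
proof -
  let ?R = "{(r, s). r \<in> bar_roots B \<and> s \<in> bar_roots B \<and> Fin (bar_height B) < contact r s}"
  have "?R `` {r} = {s \<in> bar_roots B. \<forall>q\<le>bar_height B. pcoeff s q = pcoeff r q}"
    if "r \<in> bar_roots B" for r
    using that by (auto simp: less_contact_iff)
  then show ?thesis unfolding trunks_def quotient_def by auto
qed

lemma height_on_top_Fin:
  assumes "finite T" "T \<noteq> {}" "height_on_top T = Fin h"
  shows "\<And>r s q. r \<in> T \<Longrightarrow> s \<in> T \<Longrightarrow> q < h \<Longrightarrow> pcoeff r q = pcoeff s q"
    and "\<exists>r\<in>T. \<exists>s\<in>T. pcoeff r h \<noteq> pcoeff s h"
proof -
  let ?C = "(\<lambda>(r, s). contact r s) ` (T \<times> T)"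
  have fin: "finite ?C" "?C \<noteq> {}" using assms by auto
  have Min: "Min ?C = Fin h" using assms(3) by (simp add: height_on_top_def)
  have le: "Fin h \<le> contact r s" if "r \<in> T" "s \<in> T" for r s
    unfolding Min[symmetric] using fin that by (intro Min_le) auto
  then show "pcoeff r q = pcoeff s q" if "r \<in> T" "s \<in> T" "q < h" for r s q
    using that unfolding le_contact_iff by blast
  have "Fin h \<in> ?C" unfolding Min[symmetric] using fin by (rule Min_in)
  then obtain r s where rs: "r \<in> T" "s \<in> T" "contact r s = Fin h" by auto
  then have "\<not> Fin h < contact r s" by simp
  then obtain q where q: "q \<le> h" "pcoeff r q \<noteq> pcoeff s q" unfolding less_contact_iff by blast
  moreover have "\<not> q < h" using q(2) le[OF rs(1,2)] unfolding le_contact_iff by blast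
  ultimately have "q = h" by simp
  then show "\<exists>r\<in>T. \<exists>s\<in>T. pcoeff r h \<noteq> pcoeff s h" using q rs by blast
qed

text \<open>The diagonal contributes the value \<open>\<infinity>\<close>, so the minimum is finite as soon as the trunk has
  two members.\<close>

lemma height_on_top_finite_of_two:
  assumes "finite T" "r \<in> T" "s \<in> T" "r \<noteq> s"
  obtains h where "height_on_top T = Fin h"
proof -
  let ?C = "(\<lambda>(r, s). contact r s) ` (T \<times> T)"
  have fin: "finite ?C" using assms by auto
  have "contact r s \<in> ?C" using assms by (auto intro!: image_eqI[of _ _ "(r, s)"])
  then have "Min ?C \<le> contact r s" "Min ?C \<in> ?C" using fin by (auto intro: Min_in)
  moreover have "contact r s = Fin (pord (r - s))" using assms by (simp add: contact_def ord_y_eq)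
  ultimately have "height_on_top T \<le> Fin (pord (r - s))" "height_on_top T \<in> ?C"
    by (auto simp: height_on_top_def)
  moreover from this obtain r' s' where "height_on_top T = contact r' s'" by auto
  ultimately show ?thesis
    using that by (cases "r' = s'") (auto simp: contact_def ord_y_def split: if_splits)
qed

definition galois_bar :: "int \<Rightarrow> bar \<Rightarrow> bar" where
  "galois_bar j B = Bar (bar_height B) (galois j ` bar_roots B)"

lemma galois_bar_simps [simp]:
  "bar_height (galois_bar j B) = bar_height B"
  "bar_roots (galois_bar j B) = galois j ` bar_roots B"
  by (simp_all add: galois_bar_def)

lemma galois_bar_galois_bar [simp]: "galois_bar i (galois_bar j B) = galois_bar (i + j) B"
  by (simp add: galois_bar_def image_image)

lemma galois_bar_0 [simp]: "galois_bar 0 B = B"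
  by (cases B) (simp add: galois_bar_def)

lemma pcoeff_galois_eq_iff [simp]:
  "pcoeff (galois j r) q = pcoeff (galois j s) q \<longleftrightarrow> pcoeff r q = pcoeff s q"
  by (simp add: pcoeff_galois)

lemma height_on_top_galois: "height_on_top (galois j ` T) = height_on_top T"
proof -
  have "contact (galois j r) (galois j s) = contact r s" for r s
    by (simp add: contact_def galois_diff[symmetric])
  then have "(\<lambda>(r, s). contact r s) ` (galois j ` T \<times> galois j ` T)
      = (\<lambda>(r, s). contact r s) ` (T \<times> T)"
    by (force simp: image_iff)
  then show ?thesis by (simp add: height_on_top_def)
qed

locale root_tree =
  fixes \<Lambda> :: "puiseux set"
  assumes fin_roots: "finite \<Lambda>" and roots_nonempty: "\<Lambda> \<noteq> {}"
    and roots_pos: "\<And>r. r \<in> \<Lambda> \<Longrightarrow> pos r"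
begin

text \<open>This describes the tree without recursion. A bar of positive height is given by a pair of
  roots: its height is their contact order,
  and its roots are all those which agree with them below that height.\<close>

lemma bar_props:
  assumes "B \<in> bars \<Lambda>"
  shows "bar_roots B \<subseteq> \<Lambda> \<and> bar_roots B \<noteq> {} \<and> bar_height B \<ge> 0 \<and>
    (\<forall>r\<in>bar_roots B. \<forall>s\<in>\<Lambda>. s \<in> bar_roots B \<longleftrightarrow> (\<forall>q<bar_height B. pcoeff s q = pcoeff r q)) \<and>
    (B = ground_bar \<Lambda> \<or> bar_height B > 0 \<and>
      (\<exists>r\<in>bar_roots B. \<exists>s\<in>bar_roots B. pcoeff r (bar_height B) \<noteq> pcoeff s (bar_height B)))"
  using assms
proof (induction rule: bars.induct)
  case ground
  then show ?case using roots_nonempty by (auto simp: ground_bar_def pcoeff_neg)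
next
  case (on_top B T h)
  obtain r0 where r0: "r0 \<in> bar_roots B"
    and T: "T = {s \<in> bar_roots B. \<forall>q\<le>bar_height B. pcoeff s q = pcoeff r0 q}"
    using on_top.hyps(2) unfolding trunks_iff by blast
  have TL: "T \<subseteq> \<Lambda>" "r0 \<in> T" "T \<subseteq> bar_roots B" using on_top.IH r0 by (auto simp: T)
  have finT: "finite T" using TL(1) fin_roots by (rule finite_subset)
  note top = height_on_top_Fin[OF finT _ on_top.hyps(3)]
  have Tne: "T \<noteq> {}" using TL by auto
  obtain r1 s1 where rs1: "r1 \<in> T" "s1 \<in> T" "pcoeff r1 h \<noteq> pcoeff s1 h" using top(2)[OF Tne] by blast
  have lt: "bar_height B < h"
  proof (rule ccontr)
    assume "\<not> bar_height B < h"
    then show False using rs1 by (auto simp: T)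
  qed
  have "s \<in> T \<longleftrightarrow> (\<forall>q<h. pcoeff s q = pcoeff r q)" if "r \<in> T" "s \<in> \<Lambda>" for r s
  proof
    assume "s \<in> T"
    then show "\<forall>q<h. pcoeff s q = pcoeff r q" using top(1)[OF Tne] that by blast
  next
    assume *: "\<forall>q<h. pcoeff s q = pcoeff r q"
    then have "\<forall>q\<le>bar_height B. pcoeff s q = pcoeff r0 q" using lt that(1) by (auto simp: T)
    moreover have "s \<in> bar_roots B"
    proof -
      have "r \<in> bar_roots B" using that(1) TL(3) by blast
      then have "s \<in> bar_roots B \<longleftrightarrow> (\<forall>q<bar_height B. pcoeff s q = pcoeff r q)"
        using on_top.IH that(2) by blast
      then show ?thesis using * lt by auto
    qed
    ultimately show "s \<in> T" by (simp add: T)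
  qed
  then have closed: "\<forall>r\<in>T. \<forall>s\<in>\<Lambda>. s \<in> T \<longleftrightarrow> (\<forall>q<h. pcoeff s q = pcoeff r q)" by blast
  have "bar_height B \<ge> 0" using on_top.IH by blast
  then have "h > 0" using lt by linarith
  have branch: "\<exists>r\<in>T. \<exists>s\<in>T. pcoeff r h \<noteq> pcoeff s h" using rs1 by blast
  show ?case unfolding bar.sel using TL(1) Tne closed branch \<open>h > 0\<close>
    by (intro conjI disjI2) (assumption | rule less_imp_le)+
qed

lemma bar_roots_subset: "B \<in> bars \<Lambda> \<Longrightarrow> bar_roots B \<subseteq> \<Lambda>"
  and bar_roots_nonempty: "B \<in> bars \<Lambda> \<Longrightarrow> bar_roots B \<noteq> {}"
  and bar_height_nonneg: "B \<in> bars \<Lambda> \<Longrightarrow> bar_height B \<ge> 0"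
  and ground_or_branching: "B \<in> bars \<Lambda> \<Longrightarrow> B = ground_bar \<Lambda> \<or> bar_height B > 0 \<and>
      (\<exists>r\<in>bar_roots B. \<exists>s\<in>bar_roots B. pcoeff r (bar_height B) \<noteq> pcoeff s (bar_height B))"
  using bar_props by blast+

lemma bar_rootsI:
  "B \<in> bars \<Lambda> \<Longrightarrow> r \<in> bar_roots B \<Longrightarrow> s \<in> \<Lambda> \<Longrightarrow> (\<And>q. q < bar_height B \<Longrightarrow> pcoeff s q = pcoeff r q)
    \<Longrightarrow> s \<in> bar_roots B"
  using bar_props by blast

lemma bar_roots_agree:
  "B \<in> bars \<Lambda> \<Longrightarrow> r \<in> bar_roots B \<Longrightarrow> s \<in> bar_roots B \<Longrightarrow> q < bar_height B
    \<Longrightarrow> pcoeff s q = pcoeff r q"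
  using bar_props[of B] by blast

lemma finite_bar_roots: "B \<in> bars \<Lambda> \<Longrightarrow> finite (bar_roots B)"
  using bar_roots_subset fin_roots finite_subset by blast

lemma finite_bars: "finite (bars \<Lambda>)"
proof (rule finite_subset)
  show "bars \<Lambda> \<subseteq> insert (ground_bar \<Lambda>) ((\<lambda>T. Bar (THE h. height_on_top T = Fin h) T) ` Pow \<Lambda>)"
  proof
    fix B assume "B \<in> bars \<Lambda>"
    then show "B \<in> insert (ground_bar \<Lambda>) ((\<lambda>T. Bar (THE h. height_on_top T = Fin h) T) ` Pow \<Lambda>)"
    proof cases
      case (on_top B' T h)
      have "T \<subseteq> \<Lambda>" using bar_roots_subset[OF on_top(2)] on_top(3) by (auto simp: trunks_iff)
      moreover have "(THE h. height_on_top T = Fin h) = h" using on_top(4) by simp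
      ultimately show ?thesis using on_top(1) by (auto intro!: image_eqI[of _ _ T])
    qed simp
  qed
  show "finite (insert (ground_bar \<Lambda>) ((\<lambda>T. Bar (THE h. height_on_top T = Fin h) T) ` Pow \<Lambda>))"
    using fin_roots by simp
qed

lemma pcoeff_stem:
  assumes "B \<in> bars \<Lambda>" "r \<in> bar_roots B"
  shows "pcoeff (stem B) q = (if q < bar_height B then pcoeff r q else 0)"
proof -
  have "(SOME r. r \<in> bar_roots B) \<in> bar_roots B" using assms(2) by (rule someI)
  then show ?thesis
    using bar_roots_agree[OF assms] by (simp add: stem_def pcoeff_truncate)
qed

lemma climbs_over_iff:
  assumes "B \<in> bars \<Lambda>" "r \<in> bar_roots B"
  shows "climbs_over B \<xi> \<longleftrightarrow> (\<forall>q<bar_height B. pcoeff \<xi> q = pcoeff r q)"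
    and "climbs_at B a \<xi> \<longleftrightarrow> climbs_over B \<xi> \<and> pcoeff \<xi> (bar_height B) = a"
proof -
  have *: "climbs_at B a \<xi> \<longleftrightarrow>
      (\<forall>q<bar_height B. pcoeff \<xi> q = pcoeff r q) \<and> pcoeff \<xi> (bar_height B) = a" for a
  proof -
    have "climbs_at B a \<xi> \<longleftrightarrow>
        (\<forall>q\<le>bar_height B. pcoeff \<xi> q = pcoeff (stem B) q + pcoeff (monomial a (bar_height B)) q)"
      unfolding climbs_at_def less_ord_y_iff by (simp add: algebra_simps)
    also have "\<dots> \<longleftrightarrow> (\<forall>q<bar_height B. pcoeff \<xi> q = pcoeff r q) \<and> pcoeff \<xi> (bar_height B) = a"
      using bar_height_nonneg[OF assms(1)]
      by (auto simp: pcoeff_stem[OF assms] pcoeff_monomial order_le_less)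
    finally show ?thesis .
  qed
  show 1: "climbs_over B \<xi> \<longleftrightarrow> (\<forall>q<bar_height B. pcoeff \<xi> q = pcoeff r q)"
    unfolding climbs_over_def * by simp
  show "climbs_at B a \<xi> \<longleftrightarrow> climbs_over B \<xi> \<and> pcoeff \<xi> (bar_height B) = a"
    unfolding 1 * ..
qed

lemma climbs_at_iff:
  "B \<in> bars \<Lambda> \<Longrightarrow> climbs_at B a \<xi> \<longleftrightarrow> climbs_over B \<xi> \<and> pcoeff \<xi> (bar_height B) = a"
  using climbs_over_iff(2) bar_roots_nonempty by blast

lemma bounded_by_iff: "B \<in> bars \<Lambda> \<Longrightarrow> bounded_by \<xi> B \<longleftrightarrow> \<not> climbs_over B \<xi>"
proof -
  assume B: "B \<in> bars \<Lambda>"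
  obtain r where r: "r \<in> bar_roots B" using bar_roots_nonempty[OF B] by blast
  have "bounded_by \<xi> B \<longleftrightarrow> \<not> Fin (bar_height B) \<le> contact \<xi> (stem B)"
    by (auto simp: bounded_by_def)
  then show ?thesis
    unfolding le_contact_iff climbs_over_iff(1)[OF B r] by (simp add: pcoeff_stem[OF B r])
qed

lemma bar_roots_iff_climbs: "B \<in> bars \<Lambda> \<Longrightarrow> r \<in> bar_roots B \<longleftrightarrow> r \<in> \<Lambda> \<and> climbs_over B r"
  using bar_roots_nonempty[of B] climbs_over_iff(1)[of B] bar_roots_subset[of B] bar_props[of B] by blast

lemma bar_eqI:
  assumes "B \<in> bars \<Lambda>" "B' \<in> bars \<Lambda>" "bar_height B = bar_height B'"
    "climbs_over B \<xi>" "climbs_over B' \<xi>"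
  shows "B = B'"
proof -
  obtain r r' where r: "r \<in> bar_roots B" "r' \<in> bar_roots B'"
    using bar_roots_nonempty assms(1,2) by blast
  have "pcoeff r q = pcoeff r' q" if "q < bar_height B" for q
    using assms(4,5) that unfolding climbs_over_iff(1)[OF assms(1) r(1)]
      climbs_over_iff(1)[OF assms(2) r(2)] assms(3) by metis
  then have "climbs_over B s \<longleftrightarrow> climbs_over B' s" for s
    unfolding climbs_over_iff(1)[OF assms(1) r(1)] climbs_over_iff(1)[OF assms(2) r(2)]
    using assms(3) by auto
  then have "bar_roots B = bar_roots B'"
    using bar_roots_iff_climbs[OF assms(1)] bar_roots_iff_climbs[OF assms(2)] by blast
  with assms(3) show ?thesis by (rule bar.expand[OF conjI])
qed

lemma trunks_bar_iff:
  assumes "B \<in> bars \<Lambda>"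
  shows "T \<in> trunks B \<longleftrightarrow> (\<exists>c. T = trunk_over B c \<and> T \<noteq> {})"
proof -
  have "{s \<in> bar_roots B. \<forall>q\<le>bar_height B. pcoeff s q = pcoeff r q}
      = trunk_over B (pcoeff r (bar_height B))" if "r \<in> bar_roots B" for r
    using bar_roots_agree[OF assms that] by (auto simp: trunk_over_def order_le_less)
  then have "T \<in> trunks B \<longleftrightarrow> (\<exists>r\<in>bar_roots B. T = trunk_over B (pcoeff r (bar_height B)))"
    unfolding trunks_iff by auto
  then show ?thesis by (auto simp: trunk_over_def)
qed

lemma grows_at_iff:
  assumes "B \<in> bars \<Lambda>"
  shows "grows_at B c T \<longleftrightarrow> T = trunk_over B c \<and> T \<noteq> {}"
proof
  assume "grows_at B c T"
  then obtain c' where c': "T = trunk_over B c'" "T \<noteq> {}" "\<forall>r\<in>T. climbs_at B c r"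
    unfolding grows_at_def trunks_bar_iff[OF assms] by blast
  then obtain r where "r \<in> T" by blast
  then have "c = c'" using c' climbs_at_iff[OF assms] by (auto simp: trunk_over_def)
  with c' show "T = trunk_over B c \<and> T \<noteq> {}" by simp
next
  assume *: "T = trunk_over B c \<and> T \<noteq> {}"
  then have "\<forall>r\<in>T. climbs_at B c r"
    using climbs_at_iff[OF assms] bar_roots_iff_climbs[OF assms] by (auto simp: trunk_over_def)
  with * show "grows_at B c T" unfolding grows_at_def trunks_bar_iff[OF assms] by blast
qed

lemma growth_points_iff: "B \<in> bars \<Lambda> \<Longrightarrow> c \<in> growth_points B \<longleftrightarrow> trunk_over B c \<noteq> {}"
  by (auto simp: growth_points_def grows_at_iff)

lemma trunk_at_eq: "B \<in> bars \<Lambda> \<Longrightarrow> c \<in> growth_points B \<Longrightarrow> trunk_at B c = trunk_over B c"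
  unfolding trunk_at_def by (rule the_equality) (auto simp: grows_at_iff growth_points_iff)

lemma leaves_tree_on_iff:
  "B \<in> bars \<Lambda> \<Longrightarrow> leaves_tree_on B \<xi> \<longleftrightarrow>
    climbs_over B \<xi> \<and> pcoeff \<xi> (bar_height B) \<notin> growth_points B"
  by (auto simp: leaves_tree_on_def climbs_at_iff)

lemma postbar_at_props:
  assumes "B \<in> bars \<Lambda>" "postbar_at B c B'"
  shows "B' \<in> bars \<Lambda>" "bar_roots B' = trunk_over B c" "bar_height B < bar_height B'"
    "trunk_over B c \<noteq> {}"
proof -
  have g: "bar_roots B' = trunk_over B c" "trunk_over B c \<noteq> {}"
    and t: "bar_roots B' \<in> trunks B" and top: "height_on_top (bar_roots B') = Fin (bar_height B')"
    using assms(2) unfolding postbar_at_def grows_at_iff[OF assms(1)] trunks_bar_iff[OF assms(1)]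
    by auto
  have "Bar (bar_height B') (bar_roots B') \<in> bars \<Lambda>" by (rule bars.on_top[OF assms(1) t top])
  then show B': "B' \<in> bars \<Lambda>" by simp
  show "bar_roots B' = trunk_over B c" "trunk_over B c \<noteq> {}" by (rule g)+
  have "finite (bar_roots B')" "bar_roots B' \<noteq> {}" using finite_bar_roots[OF B'] g by auto
  then obtain r s where rs: "r \<in> bar_roots B'" "s \<in> bar_roots B'"
    "pcoeff r (bar_height B') \<noteq> pcoeff s (bar_height B')"
    using height_on_top_Fin(2)[OF _ _ top] by blast
  show "bar_height B < bar_height B'"
  proof (rule ccontr)
    assume "\<not> bar_height B < bar_height B'"
    moreover have "pcoeff r q = pcoeff s q" if "q \<le> bar_height B" for q
      using rs(1,2) that bar_roots_agree[OF assms(1), of r s q] unfolding g(1)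
      by (auto simp: trunk_over_def order_le_less)
    ultimately show False using rs(3) by auto
  qed
qed

lemma bar_cases:
  assumes "B' \<in> bars \<Lambda>" "B' \<noteq> ground_bar \<Lambda>"
  obtains B c where "B \<in> bars \<Lambda>" "postbar_at B c B'"
  using assms(1)
proof cases
  case ground
  with assms(2) show ?thesis by simp
next
  case (on_top B T h)
  then obtain c where "T = trunk_over B c" "T \<noteq> {}" using trunks_bar_iff by blast
  then have "postbar_at B c B'" using on_top by (simp add: postbar_at_def grows_at_iff)
  then show ?thesis using that on_top by blast
qed

lemma postbar_at_exists:
  assumes "B \<in> bars \<Lambda>" "r \<in> trunk_over B c" "s \<in> trunk_over B c" "r \<noteq> s"
  obtains B' where "postbar_at B c B'"
proof -
  have "finite (trunk_over B c)" using finite_bar_roots[OF assms(1)] by (simp add: trunk_over_def)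
  then obtain h where "height_on_top (trunk_over B c) = Fin h"
    using height_on_top_finite_of_two assms(2-4) by blast
  then have "postbar_at B c (Bar h (trunk_over B c))"
    unfolding postbar_at_def grows_at_iff[OF assms(1)] using assms(2) by auto
  then show ?thesis by (rule that)
qed

text \<open>Two arcs over \<open>B'\<close> agree below its height, so the lower bars cannot tell them
  apart.\<close>

lemma climbs_over_below:
  assumes "B \<in> bars \<Lambda>" "B' \<in> bars \<Lambda>" "climbs_over B' \<xi>" "climbs_over B' \<eta>"
    "bar_height B \<le> bar_height B'"
  shows "climbs_over B \<xi> \<longleftrightarrow> climbs_over B \<eta>"
    "bar_height B < bar_height B' \<Longrightarrow> pcoeff \<xi> (bar_height B) = pcoeff \<eta> (bar_height B)"
proof -
  obtain r r' where r: "r \<in> bar_roots B" "r' \<in> bar_roots B'"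
    using bar_roots_nonempty assms(1,2) by blast
  have *: "pcoeff \<xi> q = pcoeff \<eta> q" if "q < bar_height B'" for q
    using assms(3,4) that unfolding climbs_over_iff(1)[OF assms(2) r(2)] by metis
  then show "bar_height B < bar_height B' \<Longrightarrow> pcoeff \<xi> (bar_height B) = pcoeff \<eta> (bar_height B)" by blast
  show "climbs_over B \<xi> \<longleftrightarrow> climbs_over B \<eta>"
    unfolding climbs_over_iff(1)[OF assms(1) r(1)] using * assms(5) by auto
qed

lemma postbar_at_climbs:
  assumes "B \<in> bars \<Lambda>" "postbar_at B c B'" "climbs_over B' \<xi>"
  shows "climbs_over B \<xi>" "pcoeff \<xi> (bar_height B) = c"
proof -
  note B' = postbar_at_props[OF assms(1,2)]
  obtain r where r: "r \<in> bar_roots B'" using B' by blast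
  then have r': "r \<in> bar_roots B" "pcoeff r (bar_height B) = c" using B' by (auto simp: trunk_over_def)
  have "climbs_over B' r" "climbs_over B r"
    using r r' bar_roots_iff_climbs[OF B'(1)] bar_roots_iff_climbs[OF assms(1)] by blast+
  then show "climbs_over B \<xi>" "pcoeff \<xi> (bar_height B) = c"
    using climbs_over_below[OF assms(1) B'(1) assms(3)] B'(3) r'(2) by auto
qed

text \<open>The roots of a bar strictly between would all belong to the trunk below \<open>B'\<close> and so agree at
  the height of that bar; but a bar of positive height branches there.\<close>

lemma no_bar_between:
  assumes "B1 \<in> bars \<Lambda>" "postbar_at B1 c B'" "climbs_over B' \<xi>"
    "B \<in> bars \<Lambda>" "climbs_over B \<xi>" "bar_height B < bar_height B'"
  shows "bar_height B \<le> bar_height B1"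
proof (rule ccontr)
  assume gt: "\<not> bar_height B \<le> bar_height B1"
  note B' = postbar_at_props[OF assms(1,2)]
  have "bar_height B > 0" using gt bar_height_nonneg[OF assms(1)] by linarith
  then have "B \<noteq> ground_bar \<Lambda>" by (auto simp: ground_bar_def)
  then obtain r s where rs: "r \<in> bar_roots B" "s \<in> bar_roots B"
    "pcoeff r (bar_height B) \<noteq> pcoeff s (bar_height B)"
    using ground_or_branching[OF assms(4)] by blast
  have "t \<in> bar_roots B'" if t: "t \<in> bar_roots B" for t
  proof -
    have tL: "t \<in> \<Lambda>" "climbs_over B t" using t bar_roots_iff_climbs[OF assms(4)] by blast+
    have "climbs_over B1 t \<longleftrightarrow> climbs_over B1 \<xi>" "pcoeff t (bar_height B1) = pcoeff \<xi> (bar_height B1)"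
      using climbs_over_below[OF assms(1,4) tL(2) assms(5)] gt by auto
    then show ?thesis
      using postbar_at_climbs[OF assms(1-3)] tL(1) bar_roots_iff_climbs[OF assms(1)]
      unfolding B'(2) trunk_over_def by auto
  qed
  then show False
    using rs bar_roots_agree[OF B'(1) _ _ assms(6)] by metis
qed

text \<open>Going down from \<open>B'\<close>, the bar immediately below is \<open>B\<close> or still lies above \<open>B\<close>.
  The predicate \<open>P\<close> stands for what is known about the bars in between; for covers it is
  collinearity.\<close>

lemma postbar_chain:
  assumes "B' \<in> bars \<Lambda>" "B \<in> bars \<Lambda>" "climbs_over B \<xi>" "climbs_over B' \<xi>" "bar_height B < bar_height B'"
    "\<And>X. X \<in> bars \<Lambda> \<Longrightarrow> climbs_over X \<xi> \<Longrightarrow> bar_height B < bar_height X \<Longrightarrow>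
      bar_height X < bar_height B' \<Longrightarrow> P X"
  shows "postbar_at B (pcoeff \<xi> (bar_height B)) B' \<or>
    (\<exists>B1 Br. postbar_at B (pcoeff \<xi> (bar_height B)) B1 \<and> P B1 \<and>
      (\<lambda>X Y. postbar X Y \<and> P Y)\<^sup>*\<^sup>* B1 Br \<and> postbar Br B')"
  using assms
proof (induction "card {X \<in> bars \<Lambda>. bar_height X < bar_height B'}" arbitrary: B' rule: less_induct)
  case (less B')
  have "B' \<noteq> ground_bar \<Lambda>"
    using less.prems(5) bar_height_nonneg[OF less.prems(2)] by (auto simp: ground_bar_def)
  then obtain B0 c where B0: "B0 \<in> bars \<Lambda>" "postbar_at B0 c B'"
    using bar_cases[OF less.prems(1)] by blast
  note B0' = postbar_at_props[OF B0] postbar_at_climbs[OF B0 less.prems(4)]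
  have le: "bar_height B \<le> bar_height B0"
    by (rule no_bar_between[OF B0 less.prems(4) less.prems(2,3,5)])
  show ?case
  proof (cases "bar_height B = bar_height B0")
    case True
    then have "B = B0" by (rule bar_eqI[OF less.prems(2) B0(1) _ less.prems(3) B0'(5)])
    then show ?thesis using B0(2) B0'(6) by auto
  next
    case False
    with le have lt: "bar_height B < bar_height B0" by simp
    have "{X \<in> bars \<Lambda>. bar_height X < bar_height B0} \<subset> {X \<in> bars \<Lambda>. bar_height X < bar_height B'}"
      using B0'(3) B0(1) by auto
    then have card: "card {X \<in> bars \<Lambda>. bar_height X < bar_height B0}
        < card {X \<in> bars \<Lambda>. bar_height X < bar_height B'}"
      using finite_bars by (intro psubset_card_mono) auto
    have P0: "P B0" using less.prems(6)[OF B0(1) B0'(5) lt B0'(3)] .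
    have post: "postbar B0 B'" using B0(2) by (auto simp: postbar_def)
    have "postbar_at B (pcoeff \<xi> (bar_height B)) B0 \<or>
        (\<exists>B1 Br. postbar_at B (pcoeff \<xi> (bar_height B)) B1 \<and> P B1 \<and>
          (\<lambda>X Y. postbar X Y \<and> P Y)\<^sup>*\<^sup>* B1 Br \<and> postbar Br B0)"
      using less.hyps[OF card B0(1) less.prems(2,3) B0'(5) lt] less.prems(6) B0'(3)
      by (meson less_trans)
    then show ?thesis
    proof
      assume "postbar_at B (pcoeff \<xi> (bar_height B)) B0"
      then show ?thesis using P0 post by blast
    next
      assume "\<exists>B1 Br. postbar_at B (pcoeff \<xi> (bar_height B)) B1 \<and> P B1 \<and>
          (\<lambda>X Y. postbar X Y \<and> P Y)\<^sup>*\<^sup>* B1 Br \<and> postbar Br B0"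
      then obtain B1 Br where 1: "postbar_at B (pcoeff \<xi> (bar_height B)) B1" "P B1"
        "(\<lambda>X Y. postbar X Y \<and> P Y)\<^sup>*\<^sup>* B1 Br" "postbar Br B0" by blast
      have "(\<lambda>X Y. postbar X Y \<and> P Y)\<^sup>*\<^sup>* B1 B0"
        by (rule rtranclp.rtrancl_into_rtrancl[OF 1(3)]) (use 1(4) P0 in simp)
      then show ?thesis using 1(1,2) post by blast
    qed
  qed
qed

lemma postbar_props:
  assumes "B \<in> bars \<Lambda>" "postbar B B'"
  shows "B' \<in> bars \<Lambda>" "bar_height B < bar_height B'" "climbs_over B' \<xi> \<Longrightarrow> climbs_over B \<xi>"
  using assms(2) postbar_at_props[OF assms(1)] postbar_at_climbs[OF assms(1)]
  unfolding postbar_def by blast+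

lemma postbar_rtranclp_props:
  assumes "postbar\<^sup>*\<^sup>* B B'" "B \<in> bars \<Lambda>"
  shows "B' \<in> bars \<Lambda> \<and> bar_height B \<le> bar_height B' \<and> (\<forall>\<xi>. climbs_over B' \<xi> \<longrightarrow> climbs_over B \<xi>)"
  using assms
proof (induction rule: rtranclp_induct)
  case (step X Y)
  then show ?case using postbar_props[of X Y] by fastforce
qed simp

lemma lies_over_props:
  assumes "B \<in> bars \<Lambda>" "lies_over B' B c"
  shows "B' \<in> bars \<Lambda>" "bar_height B < bar_height B'" "climbs_over B' \<xi> \<Longrightarrow> climbs_at B c \<xi>"
proof -
  obtain B1 where B1: "postbar_at B c B1" "postbar\<^sup>*\<^sup>* B1 B'" using assms(2) by (auto simp: lies_over_def)
  note p1 = postbar_at_props[OF assms(1) B1(1)]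
  note p2 = postbar_rtranclp_props[OF B1(2) p1(1)]
  show "B' \<in> bars \<Lambda>" "bar_height B < bar_height B'" using p1 p2 by auto
  show "climbs_over B' \<xi> \<Longrightarrow> climbs_at B c \<xi>"
    using p2 postbar_at_climbs[OF assms(1) B1(1)] climbs_at_iff[OF assms(1)] by blast
qed

lemma lies_above_props:
  assumes "B \<in> bars \<Lambda>" "lies_above B' B"
  shows "B' \<in> bars \<Lambda>" "bar_height B < bar_height B'" "climbs_over B' \<xi> \<Longrightarrow> climbs_over B \<xi>"
proof -
  obtain B1 where "postbar B B1" "postbar\<^sup>*\<^sup>* B1 B'"
    using assms(2) unfolding lies_above_def by (meson tranclpD)
  then show "B' \<in> bars \<Lambda>" "bar_height B < bar_height B'" "climbs_over B' \<xi> \<Longrightarrow> climbs_over B \<xi>"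
    using postbar_props[OF assms(1), of B1] postbar_rtranclp_props[of B1 B'] by fastforce+
qed

text \<open>Consecutive postbars leave no room for other bars under the same arc, so a property of
  the members of a chain holds for every bar between its ends which an arc to its top climbs.\<close>

lemma between_chain:
  assumes "B \<in> bars \<Lambda>" "postbar_at B c B1" "P B1" "(\<lambda>X Y. postbar X Y \<and> P Y)\<^sup>*\<^sup>* B1 Br"
  shows "Br \<in> bars \<Lambda> \<and> (\<forall>X \<xi>. X \<in> bars \<Lambda> \<longrightarrow> climbs_over Br \<xi> \<longrightarrow> climbs_over X \<xi> \<longrightarrow>
    bar_height B < bar_height X \<longrightarrow> bar_height X \<le> bar_height Br \<longrightarrow> P X)"
  using assms(4)
proof (induction rule: rtranclp_induct)
  case base
  note B1 = postbar_at_props[OF assms(1,2)]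
  have "P X" if "X \<in> bars \<Lambda>" "climbs_over B1 \<xi>" "climbs_over X \<xi>" "bar_height B < bar_height X"
    "bar_height X \<le> bar_height B1" for X \<xi>
  proof -
    have "\<not> bar_height X < bar_height B1"
      using no_bar_between[OF assms(1,2) that(2) that(1,3)] that(4) by linarith
    then have "X = B1" using that bar_eqI[OF that(1) B1(1)] by auto
    then show ?thesis using assms(3) by simp
  qed
  then show ?case using B1(1) by blast
next
  case (step Y Z)
  have Y: "Y \<in> bars \<Lambda>" using step.IH by blast
  obtain d where d: "postbar_at Y d Z" using step.hyps(2) by (auto simp: postbar_def)
  note Z = postbar_at_props[OF Y d]
  have "P X" if "X \<in> bars \<Lambda>" "climbs_over Z \<xi>" "climbs_over X \<xi>" "bar_height B < bar_height X"
    "bar_height X \<le> bar_height Z" for X \<xi>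
  proof (cases "bar_height X < bar_height Z")
    case True
    then have "bar_height X \<le> bar_height Y" by (rule no_bar_between[OF Y d that(2) that(1,3)])
    moreover have "climbs_over Y \<xi>" by (rule postbar_at_climbs(1)[OF Y d that(2)])
    ultimately show ?thesis using step.IH that by blast
  next
    case False
    then have "X = Z" using that bar_eqI[OF that(1) Z(1)] by auto
    then show ?thesis using step.hyps(2) by simp
  qed
  then show ?case using Z(1) by blast
qed

lemma trunk_above_singleton_or_postbar:
  assumes "B \<in> bars \<Lambda>" "trunk_over B c \<noteq> {}"
  obtains r where "trunk_over B c = {r}" | B' where "postbar_at B c B'"
proof -
  obtain r where r: "r \<in> trunk_over B c" using assms(2) by blast
  show ?thesis
  proof (cases "trunk_over B c = {r}")
    case True
    then show ?thesis by (rule that(1))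
  next
    case False
    then obtain s where "s \<in> trunk_over B c" "r \<noteq> s" using r by blast
    then show ?thesis using postbar_at_exists[OF assms(1) r] that(2) by blast
  qed
qed

end

lemma trunk_over_galois:
  "trunk_over (galois_bar j B) (cis (2 * pi * (of_int j * of_rat (bar_height B))) * c)
    = galois j ` trunk_over B c"
  by (auto simp: trunk_over_def pcoeff_galois)

lemma galois_bar_mem_bars:
  assumes "\<And>j r. r \<in> \<Lambda> \<Longrightarrow> galois j r \<in> \<Lambda>" "B \<in> bars \<Lambda>"
  shows "galois_bar j B \<in> bars \<Lambda>"
proof -
  have img: "galois j ` \<Lambda> = \<Lambda>"
  proof
    show "galois j ` \<Lambda> \<subseteq> \<Lambda>" using assms(1) by blast
    show "\<Lambda> \<subseteq> galois j ` \<Lambda>"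
    proof
      fix r assume "r \<in> \<Lambda>"
      then have "galois (- j) r \<in> \<Lambda>" by (rule assms(1))
      then show "r \<in> galois j ` \<Lambda>" by (intro image_eqI[of _ _ "galois (- j) r"]) auto
    qed
  qed
  show ?thesis
    using assms(2)
  proof (induction rule: bars.induct)
    case ground
    then show ?case using bars.ground[of \<Lambda>] img by (simp add: galois_bar_def ground_bar_def)
  next
    case (on_top B T h)
    obtain r where r: "r \<in> bar_roots B"
      and T: "T = {s \<in> bar_roots B. \<forall>q\<le>bar_height B. pcoeff s q = pcoeff r q}"
      using on_top.hyps(2) unfolding trunks_iff by blast
    have "galois j ` T = {s \<in> bar_roots (galois_bar j B). \<forall>q\<le>bar_height (galois_bar j B).
        pcoeff s q = pcoeff (galois j r) q}"
      by (auto simp: T)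
    then have "galois j ` T \<in> trunks (galois_bar j B)" using r by (auto simp: trunks_iff)
    then have "Bar h (galois j ` T) \<in> bars \<Lambda>"
      using on_top by (intro bars.on_top[of "galois_bar j B"]) (auto simp: height_on_top_galois)
    then show ?case by (simp add: galois_bar_def)
  qed
qed


section \<open>Orders of a factored germ along arcs\<close>

lemma ramify_X_monomial: "ramify 1 fps_X = monomial 1 1"
proof (rule puiseux_eqI)
  fix q
  show "pcoeff (ramify 1 fps_X) q = pcoeff (monomial 1 1) q"
  proof (cases "\<exists>k. q = of_nat k / of_nat 1")
    case True
    then obtain k where k: "q = of_nat k / of_nat 1" by blast
    have "pcoeff (ramify 1 fps_X) q = fps_X $ k"
      unfolding k by (rule pcoeff_ramify) simp
    then show ?thesis by (simp add: k pcoeff_monomial fps_X_def)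
  next
    case False
    then have "q \<noteq> 1" by (metis div_by_1 of_nat_1)
    with False show ?thesis by (simp add: pcoeff_ramify_outside pcoeff_monomial)
  qed
qed

lemma pord_monomial:
  assumes "e \<ge> 0"
  shows "monomial 1 e \<noteq> 0" "pord (monomial 1 e) = e"
proof -
  have *: "pcoeff (monomial 1 e) e \<noteq> 0" using assms by (simp add: pcoeff_monomial)
  then show "monomial 1 e \<noteq> 0" by auto
  show "pord (monomial 1 e) = e"
    by (rule pord_eqI) (use * in \<open>auto simp: vanishes_below_def pcoeff_monomial\<close>)
qed

lemma pord_one: "pord 1 = 0"
  using pord_monomial(2)[of 0] by simp

lemma pord_prod:
  "finite A \<Longrightarrow> (\<And>a. a \<in> A \<Longrightarrow> f a \<noteq> 0) \<Longrightarrow> prod f A \<noteq> 0 \<and> pord (prod f A) = (\<Sum>a\<in>A. pord (f a))"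
  by (induction A rule: finite_induct) (auto simp: pord_one pord_mult)

lemma pcoeff_0_unit:
  assumes "u dvd 1"
  shows "pcoeff (of_germ u $ 0) 0 \<noteq> 0"
proof -
  obtain w where "1 = u * w" using assms by (rule dvdE)
  then have "of_germ u * of_germ w = 1" by (metis of_germ_mult of_germ_one)
  then have "of_germ u $ 0 * of_germ w $ 0 = 1" by (metis fps_mult_nth_0 fps_one_nth)
  then have "pcoeff (of_germ u $ 0) 0 * pcoeff (of_germ w $ 0) 0 = 1"
    by (metis pcoeff_0_mult pcoeff_one)
  then show ?thesis by auto
qed

lemma peval_unit_order:
  assumes "u dvd 1" "pos \<xi>"
  shows "peval (of_germ u) \<xi> \<noteq> 0" "pord (peval (of_germ u) \<xi>) = 0"
proof -
  have *: "pcoeff (peval (of_germ u) \<xi>) 0 \<noteq> 0"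
    using pcoeff_0_unit[OF assms(1)] pcoeff_0_peval[OF bounded_denom_of_germ assms(2)] by simp
  then show "peval (of_germ u) \<xi> \<noteq> 0" by auto
  show "pord (peval (of_germ u) \<xi>) = 0" by (rule pord_eqI[OF vanishes_below_trivial *]) simp
qed

definition factored :: "germ \<Rightarrow> nat \<Rightarrow> puiseux set \<Rightarrow> bool" where
  "factored F E A \<longleftrightarrow> finite A \<and> (\<forall>a\<in>A. pos a) \<and>
    (\<exists>u. u dvd 1 \<and> of_germ F = of_germ (u * germ_y ^ E) * (\<Prod>a\<in>A. root_factor a))"

lemma of_germ_y_power: "of_germ (u * germ_y ^ E) = of_germ u * fps_const (monomial 1 (of_nat E))"
  unfolding of_germ_mult of_germ_power of_germ_y ramify_X_monomial fps_const_power
  by (simp add: monomial_power)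

lemma factored_eval:
  assumes F: "factored F E A" and \<xi>: "pos \<xi>" and ne: "\<xi> \<notin> A"
  shows "peval (of_germ F) \<xi> \<noteq> 0" "pord (peval (of_germ F) \<xi>) = of_nat E + (\<Sum>a\<in>A. pord (\<xi> - a))"
proof -
  obtain u where u: "u dvd 1" "of_germ F = of_germ (u * germ_y ^ E) * (\<Prod>a\<in>A. root_factor a)"
    and finA: "finite A" using F unfolding factored_def by blast
  have ev: "peval (of_germ F) \<xi>
      = peval (of_germ u) \<xi> * monomial 1 (of_nat E) * (\<Prod>a\<in>A. \<xi> - a)"
    unfolding u(2) of_germ_y_power using \<xi>
    by (simp add: peval_mult peval_prod peval_const peval_root_factor bounded_denom_mult
        bounded_denom_of_germ bounded_denom_const bounded_denom_prod bounded_denom_root_factor)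
  have nz: "\<xi> - a \<noteq> 0" if "a \<in> A" for a using that ne by auto
  note 1 = peval_unit_order[OF u(1) \<xi>] and 2 = pord_monomial[of "of_nat E"]
    and 3 = pord_prod[OF finA, of "\<lambda>a. \<xi> - a", OF nz]
  show "peval (of_germ F) \<xi> \<noteq> 0" unfolding ev using 1 2 3 by simp
  show "pord (peval (of_germ F) \<xi>) = of_nat E + (\<Sum>a\<in>A. pord (\<xi> - a))"
    unfolding ev using 1 2 3 by (simp add: pord_mult)
qed

lemma factored_root:
  assumes F: "factored F E A"
  shows "np_root F \<xi> \<longleftrightarrow> \<xi> \<in> A"
proof
  assume "np_root F \<xi>"
  then show "\<xi> \<in> A" using factored_eval(1)[OF F] by (auto simp: np_root_iff)
next
  assume \<xi>: "\<xi> \<in> A"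
  obtain u where u: "u dvd 1" "of_germ F = of_germ (u * germ_y ^ E) * (\<Prod>a\<in>A. root_factor a)"
    and finA: "finite A" and pos: "pos \<xi>" using F \<xi> unfolding factored_def by blast
  have "(\<Prod>a\<in>A. \<xi> - a) = 0" using \<xi> finA by (intro prod_zero) auto
  then show "np_root F \<xi>"
    unfolding np_root_iff u(2) using pos
    by (simp add: peval_mult peval_prod peval_root_factor bounded_denom_of_germ
        bounded_denom_prod bounded_denom_root_factor)
qed

lemma of_germ_nth: "pcoeff (of_germ F $ i) (of_nat j) = germ_coeff F i j"
proof -
  have "pcoeff (ramify 1 (Rep_germ F $ i)) (of_nat j / of_nat 1) = Rep_germ F $ i $ j"
    by (rule pcoeff_ramify) simp
  then show ?thesis by (simp add: of_germ_def germ_coeff.rep_eq)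
qed

lemma nu_eqI:
  assumes "\<forall>\<^sub>F z in at 0. ord_y (subst F (stem B + monomial z (bar_height B))) = Fin v"
  shows "nu F B = v"
  unfolding nu_def
proof (rule the_equality)
  show "\<forall>\<^sub>F z in at 0. ord_y (subst F (stem B + monomial z (bar_height B))) = Fin v" by (rule assms)
  fix w assume "\<forall>\<^sub>F z in at 0. ord_y (subst F (stem B + monomial z (bar_height B))) = Fin w"
  then have "\<forall>\<^sub>F z in at (0 :: complex). Fin w = Fin v"
    using assms by eventually_elim simp
  then show "w = v" by simp
qed

text \<open>On the ground bar the substituted arc is the constant \<open>z\<close>. The lowest coefficient of
  \<open>F(z,y)\<close> is a convergent power series in \<open>z\<close>, a unit times \<open>z\<^sup>p\<close> with \<open>p\<close> the number of
  roots, so it vanishes at no small \<open>z \<noteq> 0\<close>.\<close>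

lemma nu_ground:
  assumes F: "factored F E A"
  shows "nu F (ground_bar \<Lambda>) = of_nat E"
proof (rule nu_eqI)
  obtain u where u: "u dvd 1" "of_germ F = of_germ (u * germ_y ^ E) * (\<Prod>a\<in>A. root_factor a)"
    and finA: "finite A" and posA: "\<And>a. a \<in> A \<Longrightarrow> pos a" using F unfolding factored_def by blast
  define G where "G = of_germ u * (\<Prod>a\<in>A. root_factor a)"
  have "of_germ F = fps_const (monomial 1 (of_nat E)) * G"
    unfolding u(2) of_germ_y_power G_def by (simp only: mult_ac)
  then have FG: "of_germ F $ i = monomial 1 (of_nat E) * G $ i" for i by simp
  define ct where "ct H = Abs_fps (\<lambda>i. pcoeff (H $ i) 0)" for H
  have ct_mult: "ct (H * K) = ct H * ct K" for H K
    by (rule fps_ext) (simp add: ct_def fps_mult_nth pcoeff_sum)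
  have ct_rf: "ct (root_factor a) = fps_X" if "pos a" for a
    using that by (intro fps_ext) (simp add: ct_def root_factor_def pcoeff_one pos_def fps_X_def)
  have ct_one: "ct 1 = 1"
    by (rule fps_ext) (simp add: ct_def pcoeff_one)
  have "ct (\<Prod>a\<in>A. root_factor a) = fps_X ^ card A"
    using finA posA
    by (induction A rule: finite_induct) (auto simp: ct_mult ct_rf ct_one)
  then have ctG: "ct G = ct (of_germ u) * fps_X ^ card A" by (simp add: G_def ct_mult)
  define p where "p = card A"
  define b where "b = ct (of_germ u)"
  have b0: "b $ 0 \<noteq> 0" using pcoeff_0_unit[OF u(1)] by (simp add: b_def ct_def)
  have cF: "germ_coeff F i E = (if i < p then 0 else b $ (i - p))" for i
  proof -
    have "germ_coeff F i E = pcoeff (G $ i) 0"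
      unfolding of_germ_nth[symmetric] FG by (simp add: pcoeff_monomial_mult)
    also have "\<dots> = ct G $ i" by (simp add: ct_def)
    finally show ?thesis unfolding ctG p_def b_def by (simp add: fps_X_power_mult_right_nth)
  qed
  obtain r M where r: "r > 0" and M: "\<And>i j. norm (Rep_germ F $ i $ j) * r ^ (i + j) \<le> M"
    using convergent2_boundE[of "Rep_germ F"] Rep_germ[of F] unfolding mem_Collect_eq by metis
  have bb: "norm (b $ i) * r ^ i \<le> M / r ^ (p + E)" for i
  proof -
    have "b $ i = Rep_germ F $ (i + p) $ E" using cF[of "i + p"] by (simp add: germ_coeff.rep_eq)
    then have "norm (b $ i) * r ^ i * r ^ (p + E) \<le> M"
      using M[of "i + p" E] by (simp add: power_add mult_ac)
    then show ?thesis using r by (simp add: pos_le_divide_eq)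
  qed
  \<comment> \<open>The series \<open>b\<close> converges at every point of modulus less than \<open>r\<close>.\<close>
  define K where "K = (of_real (r / 2) :: complex)"
  have nK: "norm K = r / 2" using r by (simp add: K_def)
  have sumK: "summable (\<lambda>i. b $ i * K ^ i)"
  proof (rule summable_comparison_test[OF exI[of _ 0]])
    show "summable (\<lambda>i. M / r ^ (p + E) * (1 / 2) ^ i)"
      by (intro summable_mult summable_geometric) simp
    show "\<forall>i\<ge>0. norm (b $ i * K ^ i) \<le> M / r ^ (p + E) * (1 / 2) ^ i"
    proof (intro allI impI)
      fix i
      have "norm (b $ i * K ^ i) = norm (b $ i) * r ^ i * (1 / 2) ^ i"
        by (simp add: norm_mult norm_power nK power_divide)
      also have "\<dots> \<le> M / r ^ (p + E) * (1 / 2) ^ i"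
        by (rule mult_right_mono[OF bb]) simp
      finally show "norm (b $ i * K ^ i) \<le> M / r ^ (p + E) * (1 / 2) ^ i" .
    qed
  qed
  define S where "S z = (\<Sum>i. b $ i * z ^ i)" for z
  have "isCont S 0" unfolding S_def by (rule isCont_powser[OF sumK]) (unfold nK, use r in simp)
  moreover have "S 0 \<noteq> 0" using b0 by (simp add: S_def)
  ultimately have "\<forall>\<^sub>F z in at 0. S z \<noteq> 0"
    by (metis isCont_def tendsto_imp_eventually_ne)
  moreover have "\<forall>\<^sub>F z in at (0 :: complex). z \<noteq> 0" by (rule eventually_neq_at_within)
  moreover have "\<forall>\<^sub>F z in at (0 :: complex). norm z < norm K"
  proof -
    have "\<forall>\<^sub>F z in at (0 :: complex). dist z 0 < norm K"
      unfolding nK eventually_at using r by (intro exI[of _ "r / 2"]) auto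
    then show ?thesis by simp
  qed
  ultimately show "\<forall>\<^sub>F z in at 0. ord_y (subst F (stem (ground_bar \<Lambda>) + monomial z (bar_height (ground_bar \<Lambda>))))
      = Fin (of_nat E)"
  proof eventually_elim
    case (elim z)
    have "stem (ground_bar \<Lambda>) = 0"
      by (rule puiseux_eqI) (simp add: stem_def ground_bar_def pcoeff_truncate pcoeff_neg)
    then have \<xi>: "stem (ground_bar \<Lambda>) + monomial z (bar_height (ground_bar \<Lambda>)) = monomial z 0"
      by (simp add: ground_bar_def)
    have c: "pcoeff (subst F (monomial z 0)) q = (\<Sum>i. z ^ i * pcoeff (of_germ F $ i) q)" for q
      unfolding pcoeff_subst
      by (simp add: monomial_power pcoeff_monomial_mult mult.commute[of "of_germ F $ _"])
    have low: "pcoeff (subst F (monomial z 0)) q = 0" if "q < of_nat E" for q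
    proof -
      have "pcoeff (of_germ F $ i) q = 0" for i
        unfolding FG using that by (simp add: pcoeff_monomial_mult pcoeff_neg)
      then show ?thesis unfolding c by simp
    qed
    have "summable (\<lambda>i. b $ i * z ^ i)" by (rule powser_inside[OF sumK]) (use elim(3) in simp)
    then have sums: "(\<lambda>i. z ^ p * (b $ i * z ^ i)) sums (z ^ p * S z)"
      unfolding S_def by (intro sums_mult summable_sums)
    have "(\<lambda>i. z ^ i * germ_coeff F i E) sums (z ^ p * S z)"
    proof -
      have "(\<lambda>i. z ^ (i + p) * germ_coeff F (i + p) E) sums (z ^ p * S z)"
        using sums by (simp add: cF power_add mult_ac)
      moreover have "(\<Sum>i<p. z ^ i * germ_coeff F i E) = 0" by (simp add: cF)
      ultimately show ?thesis
        using sums_iff_shift[of "\<lambda>i. z ^ i * germ_coeff F i E" p "z ^ p * S z"] by simp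
    qed
    then have "pcoeff (subst F (monomial z 0)) (of_nat E) = z ^ p * S z"
      unfolding c of_germ_nth by (simp add: sums_iff)
    also have "\<dots> \<noteq> 0" using elim by simp
    finally have nz: "pcoeff (subst F (monomial z 0)) (of_nat E) \<noteq> 0" .
    then have "subst F (monomial z 0) \<noteq> 0" by auto
    moreover have "pord (subst F (monomial z 0)) = of_nat E"
      by (rule pord_eqI[OF _ nz]) (simp add: vanishes_below_def low)
    ultimately show ?case unfolding \<xi> by (simp add: ord_y_eq)
  qed
qed

context root_tree
begin

text \<open>The minimum of the height of \<open>B\<close> and the contact order of \<open>a\<close> with the stem of \<open>B\<close>.\<close>

definition stem_contact :: "bar \<Rightarrow> puiseux \<Rightarrow> rat" where
  "stem_contact B a = (if a \<in> bar_roots B then bar_height B else pord (a - stem B))"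

text \<open>An arc over \<open>B\<close> has with every root the contact which \<open>B\<close> prescribes, except with the
  roots of a trunk on \<open>B\<close> it follows.\<close>

lemma pord_climber:
  assumes B: "B \<in> bars \<Lambda>" and \<xi>: "climbs_over B \<xi>" and a: "a \<in> \<Lambda>"
    and off: "a \<notin> trunk_over B (pcoeff \<xi> (bar_height B))"
  shows "\<xi> - a \<noteq> 0" "pord (\<xi> - a) = stem_contact B a" "stem_contact B a \<le> bar_height B"
proof -
  obtain r where r: "r \<in> bar_roots B" using bar_roots_nonempty[OF B] by blast
  have below: "pcoeff \<xi> q = pcoeff (stem B) q" if "q < bar_height B" for q
    using \<xi> that by (simp add: climbs_over_iff(1)[OF B r] pcoeff_stem[OF B r])
  have "\<exists>c. vanishes_below c (\<xi> - a) \<and> pcoeff (\<xi> - a) c \<noteq> 0 \<and> stem_contact B a = c \<and> c \<le> bar_height B"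
  proof (cases "a \<in> bar_roots B")
    case True
    then have "vanishes_below (bar_height B) (\<xi> - a)"
      by (simp add: vanishes_below_def below pcoeff_stem[OF B True])
    moreover have "pcoeff (\<xi> - a) (bar_height B) \<noteq> 0" using off True by (auto simp: trunk_over_def)
    ultimately show ?thesis using True by (auto simp: stem_contact_def)
  next
    case False
    then obtain q where q: "q < bar_height B" "pcoeff a q \<noteq> pcoeff r q"
      using bar_rootsI[OF B r a] by blast
    then have nz: "pcoeff (a - stem B) q \<noteq> 0" by (simp add: pcoeff_stem[OF B r])
    then have ne: "a - stem B \<noteq> 0" by auto
    define c where "c = pord (a - stem B)"
    have "c \<le> q" using pord_props(2)[OF ne] nz unfolding c_def vanishes_below_def
      by (meson not_le)
    then have c: "c < bar_height B" using q(1) by simp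
    have "pcoeff (\<xi> - a) q' = - pcoeff (a - stem B) q'" if "q' \<le> c" for q'
      using that c by (simp add: below)
    then have "vanishes_below c (\<xi> - a)" "pcoeff (\<xi> - a) c \<noteq> 0"
      using pord_props(1,2)[OF ne] by (auto simp: c_def[symmetric] vanishes_below_def)
    then show ?thesis using False c by (auto simp: stem_contact_def c_def)
  qed
  then obtain c where c: "vanishes_below c (\<xi> - a)" "pcoeff (\<xi> - a) c \<noteq> 0"
    "stem_contact B a = c" "c \<le> bar_height B" by blast
  show "\<xi> - a \<noteq> 0" using c(2) by auto
  show "pord (\<xi> - a) = stem_contact B a" using pord_eqI[OF c(1,2)] c(3) by simp
  show "stem_contact B a \<le> bar_height B" using c by simp
qed

lemma pos_climber:
  assumes "B \<in> bars \<Lambda>" "bar_height B > 0" "climbs_over B \<xi>"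
  shows "pos \<xi>"
proof -
  obtain r where r: "r \<in> bar_roots B" using bar_roots_nonempty[OF assms(1)] by blast
  then have "pos r" using bar_roots_subset[OF assms(1)] roots_pos by blast
  then show ?thesis
    using assms(2,3) unfolding climbs_over_iff(1)[OF assms(1) r] by (simp add: pos_def)
qed

text \<open>For generic \<open>z\<close> the arc \<open>\<lambda>\<^sub>B + z y\<^sup>h\<close> follows none of the trunks on \<open>B\<close>.\<close>

lemma nu_bar:
  assumes F: "factored F E A" and A: "A \<subseteq> \<Lambda>" and B: "B \<in> bars \<Lambda>"
  shows "nu F B = of_nat E + (\<Sum>a\<in>A. stem_contact B a)"
proof (cases "B = ground_bar \<Lambda>")
  case True
  then have "stem_contact B a = 0" if "a \<in> A" for a
    using that A by (auto simp: stem_contact_def ground_bar_def)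
  then show ?thesis using nu_ground[OF F] True by simp
next
  case False
  then have h: "bar_height B > 0" using ground_or_branching[OF B] by blast
  obtain r where r: "r \<in> bar_roots B" using bar_roots_nonempty[OF B] by blast
  show ?thesis
  proof (rule nu_eqI)
    have "\<forall>\<^sub>F z in at (0 :: complex). \<forall>w\<in>(\<lambda>a. pcoeff a (bar_height B)) ` \<Lambda>. z \<noteq> w"
      using fin_roots by (intro eventually_ball_finite finite_imageI ballI eventually_neq_at_within)
    then show "\<forall>\<^sub>F z in at 0. ord_y (subst F (stem B + monomial z (bar_height B)))
        = Fin (of_nat E + (\<Sum>a\<in>A. stem_contact B a))"
    proof eventually_elim
      case (elim z)
      let ?\<xi> = "stem B + monomial z (bar_height B)"
      have \<xi>: "climbs_over B ?\<xi>" "pcoeff ?\<xi> (bar_height B) = z"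
        using h by (auto simp: climbs_over_iff(1)[OF B r] pcoeff_stem[OF B r] pcoeff_monomial)
      have "a \<notin> trunk_over B (pcoeff ?\<xi> (bar_height B))" if "a \<in> \<Lambda>" for a
        using elim that unfolding \<xi>(2) by (auto simp: trunk_over_def)
      then have *: "?\<xi> - a \<noteq> 0" "pord (?\<xi> - a) = stem_contact B a" if "a \<in> A" for a
        using pord_climber[OF B \<xi>(1)] that A by blast+
      then have "?\<xi> \<notin> A" by auto
      then show ?case
        using factored_eval[OF F pos_climber[OF B h \<xi>(1)]] *
        by (simp add: subst_eq_peval ord_y_eq)
    qed
  qed
qed

lemma nu_galois_bar:
  assumes F: "factored F E A" and A: "A \<subseteq> \<Lambda>" and B: "B \<in> bars \<Lambda>"
    and inv: "\<And>j r. r \<in> \<Lambda> \<Longrightarrow> galois j r \<in> \<Lambda>" "\<And>j a. a \<in> A \<Longrightarrow> galois j a \<in> A"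
  shows "nu F (galois_bar j B) = nu F B"
proof -
  have jB: "galois_bar j B \<in> bars \<Lambda>" using inv(1) B by (rule galois_bar_mem_bars)
  obtain r where r: "r \<in> bar_roots B" using bar_roots_nonempty[OF B] by blast
  then have jr: "galois j r \<in> bar_roots (galois_bar j B)" by simp
  have st: "stem (galois_bar j B) = galois j (stem B)"
    by (rule puiseux_eqI) (simp add: pcoeff_stem[OF jB jr] pcoeff_galois pcoeff_stem[OF B r])
  have "pord (galois j a) = pord a" for a by (simp add: pord_def)
  then have mc: "stem_contact (galois_bar j B) (galois j a) = stem_contact B a" for a
    by (auto simp: stem_contact_def st galois_diff[symmetric])
  have bij: "bij_betw (galois j) A A"
    by (rule bij_betw_byWitness[of _ "galois (- j)"]) (use inv(2) in auto)
  have "(\<Sum>a\<in>A. stem_contact (galois_bar j B) a)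
      = (\<Sum>a\<in>A. stem_contact (galois_bar j B) (galois j a))"
    by (rule sum.reindex_bij_betw[OF bij, symmetric])
  then show ?thesis unfolding nu_bar[OF F A jB] nu_bar[OF F A B] mc by simp
qed

text \<open>The root \<open>r\<close>, alone in its trunk, is an arc over \<open>B\<close> whose contact orders with the roots of
  \<open>F\<close> are positive. If there are no such roots, \<open>F(0,0) = 0\<close> forces \<open>E > 0\<close>.\<close>

lemma nu_pos:
  assumes F: "factored F E A" and A: "A \<subseteq> \<Lambda>" and B: "B \<in> bars \<Lambda>"
    and F0: "germ_coeff F 0 0 = 0" and single: "trunk_over B c = {r}" "r \<notin> A"
  shows "nu F B > 0"
proof -
  have r: "r \<in> bar_roots B" "pcoeff r (bar_height B) = c" using single(1) by (auto simp: trunk_over_def)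
  then have r': "r \<in> \<Lambda>" "climbs_over B r" using bar_roots_iff_climbs[OF B] by blast+
  have contact: "stem_contact B a > 0" if a: "a \<in> A" for a
  proof -
    have a': "a \<in> \<Lambda>" "a \<notin> trunk_over B (pcoeff r (bar_height B))" using a A single r(2) by auto
    note * = pord_climber[OF B r'(2) a']
    have "pcoeff (r - a) 0 = 0" using roots_pos r'(1) a'(1) by (simp add: pos_def)
    then have "pord (r - a) \<noteq> 0" using pord_props(1)[OF *(1)] by metis
    then show ?thesis using pord_props(3)[OF *(1)] *(2) by simp
  qed
  have nonneg: "(\<Sum>a\<in>A. stem_contact B a) \<ge> 0"
    by (intro sum_nonneg) (use contact in fastforce)
  show ?thesis
  proof (cases "E = 0")
    case True
    have "A \<noteq> {}"
    proof
      assume "A = {}"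
      then obtain u where "u dvd 1" "of_germ F = of_germ (u * germ_y ^ 0)"
        using F True unfolding factored_def by auto
      then show False using pcoeff_0_unit[of u] of_germ_nth[of F 0 0] F0 by simp
    qed
    then have "(\<Sum>a\<in>A. stem_contact B a) > 0"
      using F contact by (intro sum_pos) (auto simp: factored_def)
    then show ?thesis using nu_bar[OF F A B] by simp
  next
    case False
    then show ?thesis using nu_bar[OF F A B] nonneg by (simp add: add_pos_nonneg)
  qed
qed

end


section \<open>The Jacobian along an arc\<close>

text \<open>\<open>log_slope k \<gamma> H l\<close> says that \<open>H\<^sub>x / H\<close>, evaluated at \<open>\<gamma>\<close>, is
  \<open>l y\<^sup>-\<^sup>k\<close> plus terms of higher order. It turns products into sums.\<close>

definition log_slope :: "rat \<Rightarrow> puiseux \<Rightarrow> puiseux fps \<Rightarrow> complex \<Rightarrow> bool" where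
  "log_slope k \<gamma> H l \<longleftrightarrow> bounded_denom H \<and> peval H \<gamma> \<noteq> 0 \<and>
    vanishes_below (pord (peval H \<gamma>)) (monomial 1 k * peval (fps_deriv H) \<gamma>) \<and>
    pcoeff (monomial 1 k * peval (fps_deriv H) \<gamma>) (pord (peval H \<gamma>))
      = l * pcoeff (peval H \<gamma>) (pord (peval H \<gamma>))"

lemma log_slope_mult:
  assumes \<gamma>: "pos \<gamma>" and H: "log_slope k \<gamma> H l" and K: "log_slope k \<gamma> K m"
  shows "log_slope k \<gamma> (H * K) (l + m)"
proof -
  let ?c = "monomial 1 k"
  define h h' n where "h = peval H \<gamma>" and "h' = ?c * peval (fps_deriv H) \<gamma>" and "n = pord h"
  define q q' p where "q = peval K \<gamma>" and "q' = ?c * peval (fps_deriv K) \<gamma>" and "p = pord q"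
  have h: "bounded_denom H" "h \<noteq> 0" "vanishes_below n h'" "pcoeff h' n = l * pcoeff h n"
    using H by (auto simp: log_slope_def h_def h'_def n_def)
  have q: "bounded_denom K" "q \<noteq> 0" "vanishes_below p q'" "pcoeff q' p = m * pcoeff q p"
    using K by (auto simp: log_slope_def q_def q'_def p_def)
  have vh: "vanishes_below n h" and vq: "vanishes_below p q"
    unfolding n_def p_def by (rule pord_props h q)+
  have ev: "peval (H * K) \<gamma> = h * q" using h(1) q(1) \<gamma> by (simp add: peval_mult h_def q_def)
  have ev': "?c * peval (fps_deriv (H * K)) \<gamma> = h * q' + h' * q"
    using h(1) q(1) \<gamma>
    by (simp add: peval_add peval_mult bounded_denom_mult bounded_denom_deriv h_def h'_def q_def
        q'_def algebra_simps)
  have "pord (h * q) = n + p" using h(2) q(2) by (simp add: pord_mult n_def p_def)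
  moreover have "vanishes_below (n + p) (h * q' + h' * q)"
    by (intro vanishes_below_add vanishes_below_mult vh vq h(3) q(3))
  moreover have "pcoeff (h * q' + h' * q) (n + p) = (l + m) * pcoeff (h * q) (n + p)"
    using pcoeff_mult_leading[OF vh q(3)] pcoeff_mult_leading[OF h(3) vq]
      pcoeff_mult_leading[OF vh vq] h(4) q(4)
    by (simp add: algebra_simps)
  ultimately show ?thesis
    unfolding log_slope_def ev ev' using h(1,2) q(1,2) by (simp add: bounded_denom_mult)
qed

lemma log_slope_const:
  assumes "pos \<gamma>" "a \<noteq> 0"
  shows "log_slope k \<gamma> (fps_const a) 0"
  using assms peval_const[OF assms(1), of 0]
  by (simp add: log_slope_def bounded_denom_const peval_const)

lemma log_slope_prod:
  assumes "pos \<gamma>"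
  shows "finite A \<Longrightarrow> (\<And>a. a \<in> A \<Longrightarrow> log_slope k \<gamma> (F a) (l a)) \<Longrightarrow> log_slope k \<gamma> (prod F A) (sum l A)"
proof (induction A rule: finite_induct)
  case empty
  then show ?case using log_slope_const[OF assms, of 1 k] by simp
next
  case (insert a A)
  then show ?case by (simp add: log_slope_mult[OF assms])
qed

lemma fps_deriv_root_factor: "fps_deriv (root_factor a) = 1"
  by (simp add: root_factor_def)

lemma log_slope_root_inside:
  assumes "pos \<gamma>" "k \<ge> 0" "vanishes_below k (\<gamma> - a)" "pcoeff (\<gamma> - a) k \<noteq> 0"
  shows "log_slope k \<gamma> (root_factor a) (1 / pcoeff (\<gamma> - a) k)"
proof -
  have "pord (\<gamma> - a) = k" "\<gamma> - a \<noteq> 0" using pord_eqI[OF assms(3,4)] assms(4) by auto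
  then show ?thesis
    using assms unfolding log_slope_def fps_deriv_root_factor
    by (auto simp: bounded_denom_root_factor peval_root_factor peval_one pcoeff_monomial
        vanishes_below_def)
qed

lemma log_slope_root_outside:
  assumes "pos \<gamma>" "\<gamma> - a \<noteq> 0" "pord (\<gamma> - a) < k"
  shows "log_slope k \<gamma> (root_factor a) 0"
  using assms unfolding log_slope_def fps_deriv_root_factor
  by (auto simp: bounded_denom_root_factor peval_root_factor peval_one pcoeff_monomial
      vanishes_below_def)

lemma log_slope_unit:
  assumes "pos \<gamma>" "k > 0" "u dvd 1"
  shows "log_slope k \<gamma> (of_germ u) 0"
proof -
  note u = peval_unit_order[OF assms(3,1)]
  have *: "pcoeff (monomial 1 k * peval (fps_deriv (of_germ u)) \<gamma>) 0 = 0"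
    using assms(2) by (simp add: pcoeff_monomial)
  then show ?thesis
    unfolding log_slope_def u(2) using u(1)
    by (simp add: bounded_denom_of_germ vanishes_below_trivial del: pcoeff_0_mult)
qed

lemma log_slope_factored:
  assumes F: "factored F E A" and \<gamma>: "pos \<gamma>" and k: "k > 0" and d: "d \<noteq> 0"
    and inside: "\<And>a. a \<in> A \<Longrightarrow> a \<in> T \<Longrightarrow> vanishes_below k (\<gamma> - a) \<and> pcoeff (\<gamma> - a) k = d"
    and outside: "\<And>a. a \<in> A \<Longrightarrow> a \<notin> T \<Longrightarrow> \<gamma> - a \<noteq> 0 \<and> pord (\<gamma> - a) < k"
  shows "log_slope k \<gamma> (of_germ F) (of_nat (card (T \<inter> A)) / d)"
proof -
  obtain u where u: "u dvd 1" "of_germ F = of_germ (u * germ_y ^ E) * (\<Prod>a\<in>A. root_factor a)"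
    and finA: "finite A" using F unfolding factored_def by blast
  have "log_slope k \<gamma> (root_factor a) (if a \<in> T then 1 / d else 0)" if "a \<in> A" for a
    using log_slope_root_inside[OF \<gamma>, of k a] log_slope_root_outside[OF \<gamma>, of a k]
      inside[OF that] outside[OF that] k d by auto
  then have "log_slope k \<gamma> (\<Prod>a\<in>A. root_factor a) (\<Sum>a\<in>A. if a \<in> T then 1 / d else 0)"
    by (rule log_slope_prod[OF \<gamma> finA])
  moreover have "(\<Sum>a\<in>A. if a \<in> T then 1 / d else 0) = of_nat (card (T \<inter> A)) / d"
    using finA by (simp add: sum.If_cases Int_commute)
  moreover have "log_slope k \<gamma> (of_germ (u * germ_y ^ E)) (0 + 0)"
    unfolding of_germ_y_power
    by (intro log_slope_mult \<gamma> log_slope_unit k u(1) log_slope_const pord_monomial) simp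
  ultimately have "log_slope k \<gamma> (of_germ F) (0 + 0 + of_nat (card (T \<inter> A)) / d)"
    unfolding u(2) by (metis log_slope_mult[OF \<gamma>])
  then show ?thesis by simp
qed

lemma of_germ_deriv_x: "of_germ (deriv_x F) = fps_deriv (of_germ F)"
  by (simp add: of_germ_eq_lift deriv_x.rep_eq fps_deriv_lift)

lemma of_germ_y_deriv_y: "of_germ (germ_y * deriv_y F) = theta_coeffs (of_germ F)"
proof (rule fps_ext)
  fix i
  have "ramify 1 fps_X * ramify 1 (fps_deriv s) = ramify 1 (fps_const (1 / of_nat 1) * (fps_X * fps_deriv s))" for s
    by (simp add: ramify_mult)
  then have "ramify 1 fps_X * ramify 1 (fps_deriv s) = theta (ramify 1 s)" for s
    using theta_ramify[OF zero_less_one, of s] by simp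
  then show "of_germ (germ_y * deriv_y F) $ i = theta_coeffs (of_germ F) $ i"
    unfolding of_germ_mult of_germ_y fps_mult_left_const_nth
    unfolding of_germ_def theta_coeffs_def fps_nth_Abs_fps deriv_y.rep_eq .
qed

text \<open>The terms with \<open>\<gamma>'\<close> in the chain rule cancel, so that the Jacobian along an arc
  only involves the values of \<open>f\<close> and \<open>g\<close> along it and their \<open>x\<close>-derivatives.\<close>

lemma jacobian_along_arc:
  assumes \<gamma>: "pos \<gamma>"
  shows "monomial 1 1 * peval (of_germ (germ_jacobian f g)) \<gamma>
    = theta (peval (of_germ f) \<gamma>) * peval (fps_deriv (of_germ g)) \<gamma>
      - peval (fps_deriv (of_germ f)) \<gamma> * theta (peval (of_germ g) \<gamma>)"
proof -
  have "germ_y * germ_jacobian f g = (germ_y * deriv_y f) * deriv_x g + - (deriv_x f * (germ_y * deriv_y g))"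
    by (simp add: germ_jacobian_def algebra_simps)
  then have "of_germ germ_y * of_germ (germ_jacobian f g)
      = theta_coeffs (of_germ f) * fps_deriv (of_germ g)
        + - (fps_deriv (of_germ f) * theta_coeffs (of_germ g))"
    by (metis of_germ_add of_germ_deriv_x of_germ_mult of_germ_uminus of_germ_y_deriv_y)
  then have *: "peval (of_germ germ_y * of_germ (germ_jacobian f g)) \<gamma>
      = peval (theta_coeffs (of_germ f)) \<gamma> * peval (fps_deriv (of_germ g)) \<gamma>
        + - (peval (fps_deriv (of_germ f)) \<gamma> * peval (theta_coeffs (of_germ g)) \<gamma>)"
    using \<gamma> by (simp add: peval_add peval_uminus peval_mult bounded_denom_mult
        bounded_denom_uminus bounded_denom_deriv bounded_denom_theta bounded_denom_of_germ
        del: add_uminus_conv_diff)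
  have "peval (of_germ germ_y) \<gamma> = monomial 1 1"
    unfolding of_germ_y ramify_X_monomial by (rule peval_const[OF \<gamma>])
  then have "peval (of_germ germ_y * of_germ (germ_jacobian f g)) \<gamma>
      = monomial 1 1 * peval (of_germ (germ_jacobian f g)) \<gamma>"
    using \<gamma> by (simp add: peval_mult bounded_denom_of_germ)
  with * show ?thesis
    by (simp add: theta_peval[OF bounded_denom_of_germ \<gamma>] algebra_simps)
qed

text \<open>Along \<open>\<gamma>\<close> the product \<open>y J\<close> is \<open>y (f \<circ> \<gamma>)' g\<^sub>x - f\<^sub>x y (g \<circ> \<gamma>)'\<close>, and
  \<open>y d/dy\<close> multiplies a leading coefficient by the order. The two leading terms of
  \<open>y\<^sup>k\<^sup>+\<^sup>1 J / (f g)\<close> do not cancel by assumption.\<close>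

lemma jacobian_nonzero_of_slopes:
  assumes \<gamma>: "pos \<gamma>" and k: "k \<ge> 0"
    and f: "log_slope k \<gamma> (of_germ f) l" and g: "log_slope k \<gamma> (of_germ g) m"
    and ne: "of_rat (pord (peval (of_germ f) \<gamma>)) * m \<noteq> of_rat (pord (peval (of_germ g) \<gamma>)) * l"
  shows "\<not> np_root (germ_jacobian f g) \<gamma>"
proof
  assume "np_root (germ_jacobian f g) \<gamma>"
  then have J: "peval (of_germ (germ_jacobian f g)) \<gamma> = 0" by (simp add: np_root_iff)
  let ?c = "monomial 1 k"
  define a a' n where "a = peval (of_germ f) \<gamma>" and "a' = ?c * peval (fps_deriv (of_germ f)) \<gamma>"
    and "n = pord a"
  define b b' p where "b = peval (of_germ g) \<gamma>" and "b' = ?c * peval (fps_deriv (of_germ g)) \<gamma>"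
    and "p = pord b"
  have a: "a \<noteq> 0" "vanishes_below n a'" "pcoeff a' n = l * pcoeff a n"
    using f by (auto simp: log_slope_def a_def a'_def n_def)
  have b: "b \<noteq> 0" "vanishes_below p b'" "pcoeff b' p = m * pcoeff b p"
    using g by (auto simp: log_slope_def b_def b'_def p_def)
  note pa = pord_props[OF a(1), folded n_def] and pb = pord_props[OF b(1), folded p_def]
  have ta: "vanishes_below n (theta a)" and tb: "vanishes_below p (theta b)"
    using pa(2) pb(2) by (auto simp: vanishes_below_def)
  have "?c * (monomial 1 1 * peval (of_germ (germ_jacobian f g)) \<gamma>) = theta a * b' - a' * theta b"
    unfolding jacobian_along_arc[OF \<gamma>] by (simp add: a_def a'_def b_def b'_def algebra_simps)
  then have "theta a * b' - a' * theta b = 0" using J by simp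
  then have "pcoeff (theta a * b') (n + p) = pcoeff (a' * theta b) (n + p)" by simp
  then have "of_rat n * pcoeff a n * (m * pcoeff b p) = l * pcoeff a n * (of_rat p * pcoeff b p)"
    using pcoeff_mult_leading[OF ta b(2)] pcoeff_mult_leading[OF a(2) tb] a(3) b(3) by simp
  then have "(of_rat n * m) * (pcoeff a n * pcoeff b p) = (of_rat p * l) * (pcoeff a n * pcoeff b p)"
    by (simp only: mult_ac)
  then show False using ne pa(1) pb(1) by (simp add: n_def p_def a_def b_def)
qed

text \<open>At a simple root \<open>a\<close> of \<open>f\<close> the Jacobian is \<open>- f\<^sub>x(a) d/dy g(a(y), y)\<close>, which is
  not zero because \<open>g(a(y), y)\<close> is neither zero nor, having no constant term, constant.\<close>

lemma jacobian_nonzero_at_root: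
  assumes f: "factored f E1 A" and g: "factored g E2 D" and a: "a \<in> A" "a \<notin> D"
    and g0: "germ_coeff g 0 0 = 0"
  shows "\<not> np_root (germ_jacobian f g) a"
proof
  assume "np_root (germ_jacobian f g) a"
  then have J: "peval (of_germ (germ_jacobian f g)) a = 0" by (simp add: np_root_iff)
  obtain u where u: "u dvd 1" "of_germ f = of_germ (u * germ_y ^ E1) * (\<Prod>a\<in>A. root_factor a)"
    and finA: "finite A" and pos: "pos a" using f a unfolding factored_def by blast
  define H where "H = of_germ (u * germ_y ^ E1) * (\<Prod>b\<in>A - {a}. root_factor b)"
  have bH: "bounded_denom H"
    unfolding H_def by (intro bounded_denom_mult bounded_denom_of_germ bounded_denom_prod bounded_denom_root_factor)
  have fH: "of_germ f = root_factor a * H"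
    unfolding u(2) H_def using prod.remove[OF finA a(1), of root_factor] by (simp add: mult_ac)
  have "peval H a = peval (of_germ (u * germ_y ^ E1)) a * (\<Prod>b\<in>A - {a}. a - b)"
    unfolding H_def using pos
    by (simp add: peval_mult peval_prod peval_root_factor bounded_denom_of_germ
        bounded_denom_prod bounded_denom_root_factor)
  then have H: "peval H a \<noteq> 0" using peval_unit_y[OF u(1) pos] finA by auto
  have "fps_deriv (of_germ f) = root_factor a * fps_deriv H + H"
    unfolding fH by (simp add: fps_deriv_root_factor)
  then have fx: "peval (fps_deriv (of_germ f)) a = peval H a"
    using pos bH by (simp add: peval_add peval_mult peval_root_factor bounded_denom_mult
        bounded_denom_deriv bounded_denom_root_factor)
  have f0: "peval (of_germ f) a = 0"
    unfolding fH using pos bH by (simp add: peval_mult peval_root_factor bounded_denom_root_factor)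
  have "theta 0 = 0" by (rule puiseux_eqI) simp
  then have "peval H a * theta (peval (of_germ g) a) = 0"
    using jacobian_along_arc[OF pos, of f g] by (simp add: J fx f0)
  then have theta0: "theta (peval (of_germ g) a) = 0" using H by simp
  have "peval (of_germ g) a = 0"
  proof (rule puiseux_eqI)
    fix q
    show "pcoeff (peval (of_germ g) a) q = pcoeff 0 q"
    proof (cases "q = 0")
      case True
      then show ?thesis
        using pcoeff_0_peval[OF bounded_denom_of_germ pos, of g] of_germ_nth[of g 0 0] g0 by simp
    next
      case False
      then show ?thesis using arg_cong[OF theta0, of "\<lambda>x. pcoeff x q"] by simp
    qed
  qed
  then show False using factored_eval(1)[OF g pos a(2)] by simp
qed

lemma germ_jacobian_swap: "germ_jacobian g f = - germ_jacobian f g"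
  by (simp add: germ_jacobian_def algebra_simps)

lemma np_root_uminus: "np_root (- F) \<gamma> \<longleftrightarrow> np_root F \<gamma>"
  by (auto simp: np_root_iff of_germ_uminus peval_uminus bounded_denom_of_germ)


section \<open>Polar roots in the tree\<close>

lemma finite_Min_witness:
  fixes h :: "'a \<Rightarrow> rat"
  assumes "finite S" "S \<noteq> {}"
  obtains x where "x \<in> S" "\<And>y. y \<in> S \<Longrightarrow> h x \<le> h y"
proof -
  have "Min (h ` S) \<in> h ` S" using assms by (intro Min_in) auto
  then obtain x where "x \<in> S" "h x = Min (h ` S)" by auto
  then show ?thesis using that[of x] assms(1) by simp
qed

lemma finite_Max_witness:
  fixes h :: "'a \<Rightarrow> rat"
  assumes "finite S" "S \<noteq> {}"
  obtains x where "x \<in> S" "\<And>y. y \<in> S \<Longrightarrow> h y \<le> h x"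
proof -
  have "Max (h ` S) \<in> h ` S" using assms by (intro Max_in) auto
  then obtain x where "x \<in> S" "h x = Max (h ` S)" by auto
  then show ?thesis using that[of x] assms(1) by simp
qed

locale jacobian_tree =
  fixes f g :: germ and E1 E2 :: nat and A D :: "puiseux set"
  assumes f: "factored f E1 A" and g: "factored g E2 D"
    and disj: "A \<inter> D = {}" and nonempty: "A \<union> D \<noteq> {}"
    and f0: "germ_coeff f 0 0 = 0" and g0: "germ_coeff g 0 0 = 0"
begin

sublocale root_tree "A \<union> D"
  by standard (use f g nonempty in \<open>auto simp: factored_def\<close>)

text \<open>\<open>Delta\<close> with the trunk written out, which gives it a value at every \<open>c\<close>.\<close>

definition discrepancy :: "bar \<Rightarrow> complex \<Rightarrow> rat" where
  "discrepancy B c = nu f B * of_nat (card (trunk_over B c \<inter> D))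
    - nu g B * of_nat (card (trunk_over B c \<inter> A))"

abbreviation noncollinear :: "bar \<Rightarrow> bool" where
  "noncollinear B \<equiv> \<not> collinear_bar f g A D B"

lemma Delta_eq:
  "B \<in> bars (A \<union> D) \<Longrightarrow> c \<in> growth_points B \<Longrightarrow> Delta f g A D B c = discrepancy B c"
  by (simp add: Delta_def discrepancy_def trunk_at_eq)

lemma noncollinear_iff:
  assumes "B \<in> bars (A \<union> D)"
  shows "noncollinear B \<longleftrightarrow> (\<exists>c. trunk_over B c \<noteq> {} \<and> discrepancy B c \<noteq> 0)"
proof -
  have "c \<in> growth_points B \<and> Delta f g A D B c \<noteq> 0 \<longleftrightarrow> trunk_over B c \<noteq> {} \<and> discrepancy B c \<noteq> 0"
    for c
    using Delta_eq[OF assms, of c] growth_points_iff[OF assms, of c] by metis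
  then show ?thesis unfolding collinear_bar_def noncollinear_points_def by blast
qed

lemma collinear_points_iff:
  "B \<in> bars (A \<union> D) \<Longrightarrow> c \<in> collinear_points f g A D B \<longleftrightarrow>
    c \<in> growth_points B \<and> discrepancy B c = 0"
  using Delta_eq unfolding collinear_points_def by auto

text \<open>A root of \<open>B'\<close> climbs over both bars, so its contact orders with the roots outside
  the trunk are those which either bar prescribes.\<close>

lemma nu_postbar:
  assumes F: "factored F E S" and S: "S \<subseteq> A \<union> D" and B: "B \<in> bars (A \<union> D)" and P: "postbar_at B c B'"
  shows "nu F B' = nu F B + of_nat (card (trunk_over B c \<inter> S)) * (bar_height B' - bar_height B)"
proof -
  note B' = postbar_at_props[OF B P]
  obtain r where r: "r \<in> bar_roots B'" using B' by blast
  then have r': "climbs_over B' r" using bar_roots_iff_climbs[OF B'(1)] by blast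
  note rB = postbar_at_climbs[OF B P r']
  have "stem_contact B' a = stem_contact B a + (if a \<in> trunk_over B c then bar_height B' - bar_height B else 0)"
    if a: "a \<in> S" for a
  proof (cases "a \<in> trunk_over B c")
    case True
    then have "a \<in> bar_roots B" "a \<in> bar_roots B'" using B'(2) by (auto simp: trunk_over_def)
    then show ?thesis using True by (simp add: stem_contact_def)
  next
    case False
    have aL: "a \<in> A \<union> D" using a S by blast
    have "a \<notin> trunk_over B' (pcoeff r (bar_height B'))"
      using False B'(2) by (auto simp: trunk_over_def)
    then have "pord (r - a) = stem_contact B' a" by (rule pord_climber(2)[OF B'(1) r' aL])
    moreover have "pord (r - a) = stem_contact B a"
      by (rule pord_climber(2)[OF B rB(1) aL]) (use False rB(2) in simp)
    ultimately show ?thesis using False by simp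
  qed
  then have "(\<Sum>a\<in>S. stem_contact B' a) = (\<Sum>a\<in>S. stem_contact B a)
      + (\<Sum>a\<in>S. if a \<in> trunk_over B c then bar_height B' - bar_height B else 0)"
    by (simp add: sum.distrib)
  also have "(\<Sum>a\<in>S. if a \<in> trunk_over B c then bar_height B' - bar_height B else 0)
      = of_nat (card (trunk_over B c \<inter> S)) * (bar_height B' - bar_height B)"
    using F by (simp add: factored_def sum.If_cases Int_commute)
  finally show ?thesis unfolding nu_bar[OF F S B] nu_bar[OF F S B'(1)] by simp
qed

lemma card_trunks:
  assumes B: "B \<in> bars (A \<union> D)"
  shows "(\<Sum>c\<in>growth_points B. card (trunk_over B c \<inter> S)) = card (bar_roots B \<inter> S)"
proof -
  have gp: "growth_points B = (\<lambda>r. pcoeff r (bar_height B)) ` bar_roots B"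
    using growth_points_iff[OF B] by (auto simp: trunk_over_def)
  have fin: "finite (growth_points B)" unfolding gp using finite_bar_roots[OF B] by simp
  have "bar_roots B \<inter> S = (\<Union>c\<in>growth_points B. trunk_over B c \<inter> S)"
    unfolding gp by (auto simp: trunk_over_def)
  moreover have "card (\<Union>c\<in>growth_points B. trunk_over B c \<inter> S)
      = (\<Sum>c\<in>growth_points B. card (trunk_over B c \<inter> S))"
    using fin finite_bar_roots[OF B] by (intro card_UN_disjoint) (auto simp: trunk_over_def)
  ultimately show ?thesis by simp
qed

text \<open>Passing from a trunk to the bar on top of it adds \<open>p \<delta>\<close> to \<open>\<nu>\<^sub>f\<close> and \<open>q \<delta>\<close> to
  \<open>\<nu>\<^sub>g\<close>, where \<open>\<delta>\<close> is the difference of the heights. This leaves \<open>\<nu>\<^sub>f q - \<nu>\<^sub>g p\<close>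
  unchanged, which is the sum of the discrepancies on the new bar.\<close>

lemma postbar_noncollinear:
  assumes B: "B \<in> bars (A \<union> D)" and P: "postbar_at B c B'" and c: "discrepancy B c \<noteq> 0"
  shows "noncollinear B'"
proof -
  note B' = postbar_at_props[OF B P]
  have "(\<Sum>c'\<in>growth_points B'. discrepancy B' c')
      = nu f B' * of_nat (card (bar_roots B' \<inter> D)) - nu g B' * of_nat (card (bar_roots B' \<inter> A))"
    unfolding discrepancy_def sum_subtractf sum_distrib_left[symmetric] of_nat_sum[symmetric]
      card_trunks[OF B'(1)] ..
  also have "\<dots> = discrepancy B c"
    unfolding B'(2) nu_postbar[OF f Un_upper1 B P] nu_postbar[OF g Un_upper2 B P] discrepancy_def
    by (simp add: algebra_simps)
  finally obtain c' where "c' \<in> growth_points B'" "discrepancy B' c' \<noteq> 0"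
    using c by (metis sum.neutral)
  then show ?thesis unfolding noncollinear_iff[OF B'(1)] growth_points_iff[OF B'(1)] by blast
qed

text \<open>A trunk of bimultiplicity \<open>[1,0]\<close> has discrepancy \<open>- \<nu>\<^sub>g(B)\<close>, one of bimultiplicity \<open>[0,1]\<close>
  has \<open>\<nu>\<^sub>f(B)\<close>.\<close>

lemma singleton_trunk_noncollinear:
  assumes B: "B \<in> bars (A \<union> D)" and single: "trunk_over B c = {r}"
  shows "discrepancy B c \<noteq> 0"
proof -
  have "r \<in> bar_roots B" using single by (auto simp: trunk_over_def)
  then have "r \<in> A \<union> D" using bar_roots_subset[OF B] by blast
  then show ?thesis
  proof
    assume "r \<in> A"
    then have "r \<notin> D" using disj by blast
    then show ?thesis
      using nu_pos[OF g Un_upper2 B g0 single] \<open>r \<in> A\<close> by (simp add: discrepancy_def single)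
  next
    assume "r \<in> D"
    then have "r \<notin> A" using disj by blast
    then show ?thesis
      using nu_pos[OF f Un_upper1 B f0 single] \<open>r \<in> D\<close> by (simp add: discrepancy_def single)
  qed
qed

text \<open>Below the bar on top of the trunk, \<open>\<gamma>\<close> differs from all members of the trunk by the
  same leading term \<open>d y\<^sup>k\<close>. So \<open>f\<^sub>x/f\<close> and \<open>g\<^sub>x/g\<close> have the leading coefficients
  \<open>p/d\<close> and \<open>q/d\<close>, and that of the Jacobian is a nonzero multiple of the discrepancy.\<close>

lemma no_root_at_noncollinear_point:
  assumes B: "B \<in> bars (A \<union> D)" and \<gamma>: "climbs_over B \<gamma>" "pos \<gamma>" "\<gamma> \<notin> A \<union> D"
    and c: "c = pcoeff \<gamma> (bar_height B)" "trunk_over B c \<noteq> {}" "discrepancy B c \<noteq> 0"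
    and top: "\<And>B'. postbar_at B c B' \<Longrightarrow> \<not> climbs_over B' \<gamma>"
  shows "\<not> np_root (germ_jacobian f g) \<gamma>"
proof -
  define T where "T = trunk_over B c"
  have "\<exists>k d. k > bar_height B \<and> d \<noteq> 0 \<and>
      (\<forall>a\<in>T. vanishes_below k (\<gamma> - a) \<and> pcoeff (\<gamma> - a) k = d)"
  proof (rule trunk_above_singleton_or_postbar[OF B c(2)])
    fix r assume r: "trunk_over B c = {r}"
    then have rB: "r \<in> bar_roots B" "pcoeff r (bar_height B) = c" by (auto simp: trunk_over_def)
    have ne: "\<gamma> - r \<noteq> 0" using \<gamma>(3) rB bar_roots_subset[OF B] by auto
    have "pcoeff (\<gamma> - r) q = 0" if "q \<le> bar_height B" for q
      using \<gamma>(1) that rB(2) c(1) unfolding climbs_over_iff(1)[OF B rB(1)] by (auto simp: order_le_less)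
    then have "bar_height B < pord (\<gamma> - r)"
      using pord_props(1)[OF ne] by (meson not_le)
    then show ?thesis using pord_props[OF ne] unfolding T_def r by blast
  next
    fix B' assume P: "postbar_at B c B'"
    note B' = postbar_at_props[OF B P]
    obtain r where r: "r \<in> bar_roots B'" using B' by blast
    then have rB: "r \<in> bar_roots B" "pcoeff r (bar_height B) = c"
      using B'(2) by (auto simp: trunk_over_def)
    have agree: "pcoeff (\<gamma> - r) q = 0" if "q \<le> bar_height B" for q
      using \<gamma>(1) that rB(2) c(1) unfolding climbs_over_iff(1)[OF B rB(1)] by (auto simp: order_le_less)
    obtain q where q: "q < bar_height B'" "pcoeff (\<gamma> - r) q \<noteq> 0"
      using top[OF P] unfolding climbs_over_iff(1)[OF B'(1) r] by auto
    then have ne: "\<gamma> - r \<noteq> 0" by auto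
    define k where "k = pord (\<gamma> - r)"
    have k1: "bar_height B < k" using pord_props(1)[OF ne] agree unfolding k_def by (meson not_le)
    have "k \<le> q" using pord_props(2)[OF ne] q(2) unfolding k_def vanishes_below_def by (meson not_le)
    then have k2: "k < bar_height B'" using q(1) by simp
    have same: "pcoeff (\<gamma> - a) q' = pcoeff (\<gamma> - r) q'" if "a \<in> T" "q' \<le> k" for a q'
      using bar_roots_agree[OF B'(1) r, of a q'] that k2 B'(2) by (simp add: T_def)
    have "vanishes_below k (\<gamma> - a) \<and> pcoeff (\<gamma> - a) k = pcoeff (\<gamma> - r) k" if "a \<in> T" for a
      using same[OF that] pord_props(2)[OF ne] unfolding vanishes_below_def k_def by simp
    then show ?thesis using k1 pord_props(1)[OF ne] unfolding k_def by blast
  qed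
  then obtain k d where k: "k > bar_height B" and d: "d \<noteq> 0"
    and inside: "\<And>a. a \<in> T \<Longrightarrow> vanishes_below k (\<gamma> - a) \<and> pcoeff (\<gamma> - a) k = d" by blast
  have kpos: "k > 0" using k bar_height_nonneg[OF B] by linarith
  have outside: "\<gamma> - a \<noteq> 0" "pord (\<gamma> - a) = stem_contact B a" "stem_contact B a < k"
    if "a \<in> A \<union> D" "a \<notin> T" for a
    using pord_climber[OF B \<gamma>(1), of a] that k unfolding c(1)[symmetric] T_def by auto
  have slope: "log_slope k \<gamma> (of_germ F) (of_nat (card (T \<inter> S)) / d)"
    if F: "factored F E S" "S \<subseteq> A \<union> D" for F E S
  proof (rule log_slope_factored[OF F(1) \<gamma>(2) kpos d])
    fix a assume a: "a \<in> S"
    show "vanishes_below k (\<gamma> - a) \<and> pcoeff (\<gamma> - a) k = d" if "a \<in> T" using inside[OF that] .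
    have aL: "a \<in> A \<union> D" using a F(2) by blast
    show "\<gamma> - a \<noteq> 0 \<and> pord (\<gamma> - a) < k" if "a \<notin> T"
      using outside[OF aL that] by simp
  qed
  have order: "pord (peval (of_germ F) \<gamma>)
      = nu F B + of_nat (card (T \<inter> S)) * (k - bar_height B)"
    if F: "factored F E S" "S \<subseteq> A \<union> D" for F E S
  proof -
    have "pord (\<gamma> - a) = stem_contact B a + (if a \<in> T then k - bar_height B else 0)" if "a \<in> S" for a
    proof (cases "a \<in> T")
      case True
      then have "pord (\<gamma> - a) = k" using inside d by (intro pord_eqI) auto
      moreover have "stem_contact B a = bar_height B"
        using True by (simp add: stem_contact_def T_def trunk_over_def)
      ultimately show ?thesis using True by simp
    next
      case False
      then show ?thesis using outside that F(2) by auto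
    qed
    then have "(\<Sum>a\<in>S. pord (\<gamma> - a)) = (\<Sum>a\<in>S. stem_contact B a)
        + (\<Sum>a\<in>S. if a \<in> T then k - bar_height B else 0)"
      by (simp add: sum.distrib)
    also have "(\<Sum>a\<in>S. if a \<in> T then k - bar_height B else 0)
        = of_nat (card (T \<inter> S)) * (k - bar_height B)"
      using F(1) by (simp add: factored_def sum.If_cases Int_commute)
    finally have sum: "(\<Sum>a\<in>S. pord (\<gamma> - a))
        = (\<Sum>a\<in>S. stem_contact B a) + of_nat (card (T \<inter> S)) * (k - bar_height B)" .
    have "\<gamma> \<notin> S" using \<gamma>(3) F(2) by blast
    then show ?thesis
      unfolding factored_eval(2)[OF F(1) \<gamma>(2) \<open>\<gamma> \<notin> S\<close>] nu_bar[OF F B] sum by simp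
  qed
  let ?p = "of_nat (card (T \<inter> A)) :: rat" and ?q = "of_nat (card (T \<inter> D)) :: rat"
  show ?thesis
  proof (rule jacobian_nonzero_of_slopes[OF \<gamma>(2) less_imp_le[OF kpos]
        slope[OF f Un_upper1] slope[OF g Un_upper2]])
    have "pord (peval (of_germ f) \<gamma>) * ?q - pord (peval (of_germ g) \<gamma>) * ?p = discrepancy B c"
      unfolding order[OF f Un_upper1] order[OF g Un_upper2] discrepancy_def T_def[symmetric]
      by (simp add: algebra_simps)
    then have "pord (peval (of_germ f) \<gamma>) * ?q \<noteq> pord (peval (of_germ g) \<gamma>) * ?p" using c(3) by auto
    then have "(of_rat (pord (peval (of_germ f) \<gamma>) * ?q) :: complex)
        \<noteq> of_rat (pord (peval (of_germ g) \<gamma>) * ?p)" by (simp only: of_rat_eq_iff not_False_eq_True)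
    then show "of_rat (pord (peval (of_germ f) \<gamma>)) * (of_nat (card (T \<inter> D)) / d)
        \<noteq> of_rat (pord (peval (of_germ g) \<gamma>)) * (of_nat (card (T \<inter> A)) / d)"
      using d by (simp add: of_rat_mult)
  qed
qed


section \<open>Covers\<close>

text \<open>By the chain condition a member of a cover is the first non-collinear bar on the way up from
  \<open>c\<close>.\<close>

lemma cover_element:
  assumes B: "B \<in> bars (A \<union> D)" and S: "is_cover f g A D B c S" and B': "B' \<in> S"
  shows "B' \<in> bars (A \<union> D)" "noncollinear B'" "bar_height B < bar_height B'"
    "climbs_over B' \<xi> \<Longrightarrow> climbs_at B c \<xi>"
    "X \<in> bars (A \<union> D) \<Longrightarrow> climbs_over B' \<xi> \<Longrightarrow> climbs_over X \<xi> \<Longrightarrow> bar_height B < bar_height X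
      \<Longrightarrow> bar_height X < bar_height B' \<Longrightarrow> collinear_bar f g A D X"
proof -
  have 1: "noncollinear B'" "lies_over B' B c"
    and 2: "postbar_at B c B' \<or> (\<exists>B1 Br. postbar_at B c B1 \<and> collinear_bar f g A D B1 \<and>
        (\<lambda>X Y. postbar X Y \<and> collinear_bar f g A D Y)\<^sup>*\<^sup>* B1 Br \<and> postbar Br B')"
    using S B' unfolding is_cover_def by blast+
  show "B' \<in> bars (A \<union> D)" "noncollinear B'" "bar_height B < bar_height B'"
    "climbs_over B' \<xi> \<Longrightarrow> climbs_at B c \<xi>"
    using 1 lies_over_props[OF B 1(2)] by blast+
  show "collinear_bar f g A D X" if X: "X \<in> bars (A \<union> D)" "climbs_over B' \<xi>" "climbs_over X \<xi>"
    "bar_height B < bar_height X" "bar_height X < bar_height B'"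
    using 2
  proof
    assume "postbar_at B c B'"
    then have "bar_height X \<le> bar_height B" using no_bar_between[OF B _ X(2) X(1,3,5)] by blast
    then show ?thesis using X(4) by simp
  next
    assume "\<exists>B1 Br. postbar_at B c B1 \<and> collinear_bar f g A D B1 \<and>
        (\<lambda>X Y. postbar X Y \<and> collinear_bar f g A D Y)\<^sup>*\<^sup>* B1 Br \<and> postbar Br B'"
    then obtain B1 Br d where chain: "postbar_at B c B1" "collinear_bar f g A D B1"
      "(\<lambda>X Y. postbar X Y \<and> collinear_bar f g A D Y)\<^sup>*\<^sup>* B1 Br" and d: "postbar_at Br d B'"
      unfolding postbar_def[of _ B'] by blast
    note Br = between_chain[where P = "collinear_bar f g A D", OF B chain]
    then have BrB: "Br \<in> bars (A \<union> D)" by blast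
    have "bar_height X \<le> bar_height Br" by (rule no_bar_between[OF BrB d X(2) X(1,3,5)])
    then show ?thesis using Br X postbar_at_climbs(1)[OF BrB d X(2)] by blast
  qed
qed

lemma cover_element_unique:
  assumes B: "B \<in> bars (A \<union> D)" and S: "is_cover f g A D B c S" "is_cover f g A D B c S'"
    and X: "X \<in> S" "Y \<in> S'" "climbs_over X \<xi>" "climbs_over Y \<xi>"
  shows "X = Y"
proof -
  note x = cover_element[OF B S(1) X(1)] and y = cover_element[OF B S(2) X(2)]
  have "\<not> bar_height X < bar_height Y" using y(5)[OF x(1) X(4,3) x(3)] x(2) by blast
  moreover have "\<not> bar_height Y < bar_height X" using x(5)[OF y(1) X(3,4) y(3)] y(2) by blast
  ultimately show ?thesis using bar_eqI[OF x(1) y(1) _ X(3,4)] by simp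
qed

lemma cover_unique:
  assumes B: "B \<in> bars (A \<union> D)" and S: "is_cover f g A D B c S" "is_cover f g A D B c S'"
  shows "S = S'"
proof -
  have sub: "S \<subseteq> S'" if S: "is_cover f g A D B c S" "is_cover f g A D B c S'" for S S'
  proof
    fix X assume X: "X \<in> S"
    note x = cover_element[OF B S(1) X]
    obtain r where "r \<in> bar_roots X" using bar_roots_nonempty[OF x(1)] by blast
    then have r: "r \<in> A \<union> D" "climbs_over X r" using bar_roots_iff_climbs[OF x(1)] by blast+
    then obtain Y where Y: "Y \<in> S'" "climbs_over Y r"
      using S(2) x(4)[OF r(2)] unfolding is_cover_def by blast
    have "X = Y" by (rule cover_element_unique[OF B S X Y(1) r(2) Y(2)])
    then show "X \<in> S'" using Y(1) by simp
  qed
  show ?thesis using sub[OF S] sub[OF S(2,1)] by blast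
qed

text \<open>The cover of \<open>c\<close> consists of the first non-collinear bars met on the way up from \<open>c\<close>.
  Every root meets one, since the highest bar under a root carries it as a trunk of its own,
  and such a trunk is non-collinear.\<close>

lemma cover_exists:
  assumes B: "B \<in> bars (A \<union> D)" and c: "discrepancy B c = 0"
  shows "\<exists>S. is_cover f g A D B c S"
proof -
  define S where "S = {B' \<in> bars (A \<union> D). noncollinear B' \<and> bar_height B < bar_height B' \<and>
    (\<exists>\<xi>. climbs_over B' \<xi> \<and> climbs_at B c \<xi>) \<and>
    (\<forall>X \<xi>. X \<in> bars (A \<union> D) \<longrightarrow> climbs_over B' \<xi> \<longrightarrow> climbs_over X \<xi> \<longrightarrow>
      bar_height B < bar_height X \<longrightarrow> bar_height X < bar_height B' \<longrightarrow> collinear_bar f g A D X)}"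
  have chain: "lies_over B' B c \<and> (postbar_at B c B' \<or> (\<exists>B1 Br. postbar_at B c B1 \<and>
      collinear_bar f g A D B1 \<and>
      (\<lambda>X Y. postbar X Y \<and> collinear_bar f g A D Y)\<^sup>*\<^sup>* B1 Br \<and> postbar Br B'))"
    if B': "B' \<in> S" for B'
  proof -
    obtain \<xi> where \<xi>: "climbs_over B' \<xi>" "climbs_over B \<xi>" "pcoeff \<xi> (bar_height B) = c"
      and b: "B' \<in> bars (A \<union> D)" "bar_height B < bar_height B'"
      and coll: "\<And>X. X \<in> bars (A \<union> D) \<Longrightarrow> climbs_over X \<xi> \<Longrightarrow> bar_height B < bar_height X \<Longrightarrow>
        bar_height X < bar_height B' \<Longrightarrow> collinear_bar f g A D X"
      using B' unfolding S_def climbs_at_iff[OF B] by blast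
    have "postbar_at B c B' \<or> (\<exists>B1 Br. postbar_at B c B1 \<and> collinear_bar f g A D B1 \<and>
      (\<lambda>X Y. postbar X Y \<and> collinear_bar f g A D Y)\<^sup>*\<^sup>* B1 Br \<and> postbar Br B')"
      using postbar_chain[where P = "collinear_bar f g A D", OF b(1) B \<xi>(2,1) b(2) coll]
      unfolding \<xi>(3) .
    moreover from this have "lies_over B' B c"
    proof
      assume "postbar_at B c B'"
      then show ?thesis unfolding lies_over_def by blast
    next
      assume "\<exists>B1 Br. postbar_at B c B1 \<and> collinear_bar f g A D B1 \<and>
        (\<lambda>X Y. postbar X Y \<and> collinear_bar f g A D Y)\<^sup>*\<^sup>* B1 Br \<and> postbar Br B'"
      then obtain B1 Br where 1: "postbar_at B c B1"
        "(\<lambda>X Y. postbar X Y \<and> collinear_bar f g A D Y)\<^sup>*\<^sup>* B1 Br" "postbar Br B'" by blast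
      have "postbar\<^sup>*\<^sup>* B1 Br"
        by (rule rtranclp_mono[THEN predicate2D, OF _ 1(2)]) blast
      then have "postbar\<^sup>*\<^sup>* B1 B'" using 1(3) by (rule rtranclp.rtrancl_into_rtrancl)
      then show ?thesis using 1(1) unfolding lies_over_def by blast
    qed
    ultimately show ?thesis by blast
  qed
  have "\<exists>!B'. B' \<in> S \<and> climbs_over B' r" if r: "r \<in> A \<union> D" "climbs_at B c r" for r
  proof -
    have rB: "climbs_over B r" "pcoeff r (bar_height B) = c" using r(2) climbs_at_iff[OF B] by blast+
    \<comment> \<open>The highest bar under \<open>r\<close> is non-collinear and above \<open>B\<close>; so there is a lowest
      bar with these properties, the member of the cover under \<open>r\<close>.\<close>
    define U where "U = {X \<in> bars (A \<union> D). climbs_over X r}"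
    have "finite U" "U \<noteq> {}" using finite_bars B rB unfolding U_def by auto
    then obtain X where X: "X \<in> U" "\<And>Y. Y \<in> U \<Longrightarrow> bar_height Y \<le> bar_height X"
      using finite_Max_witness[of U bar_height] by blast
    have XB: "X \<in> bars (A \<union> D)" "climbs_over X r" using X(1) by (auto simp: U_def)
    have rX: "r \<in> trunk_over X (pcoeff r (bar_height X))"
      using bar_roots_iff_climbs[OF XB(1)] r(1) XB(2) by (simp add: trunk_over_def)
    have "discrepancy X (pcoeff r (bar_height X)) \<noteq> 0"
    proof (rule trunk_above_singleton_or_postbar[OF XB(1)])
      show "trunk_over X (pcoeff r (bar_height X)) \<noteq> {}" using rX by blast
      fix r' assume "trunk_over X (pcoeff r (bar_height X)) = {r'}"
      then show ?thesis by (rule singleton_trunk_noncollinear[OF XB(1)])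
    next
      fix Y assume Y: "postbar_at X (pcoeff r (bar_height X)) Y"
      note y = postbar_at_props[OF XB(1) Y]
      have "climbs_over Y r" using rX y(2) bar_roots_iff_climbs[OF y(1)] by blast
      then have "Y \<in> U" using y(1) by (simp add: U_def)
      then show ?thesis using X(2)[of Y] y(3) by simp
    qed
    then have XN: "noncollinear X" "X \<noteq> B"
      using noncollinear_iff[OF XB(1)] rX c rB(2) by auto
    have "bar_height B \<le> bar_height X" using X(2)[of B] B rB(1) by (simp add: U_def)
    moreover have "bar_height B \<noteq> bar_height X"
      using XN(2) bar_eqI[OF XB(1) B _ XB(2) rB(1)] by auto
    ultimately have hX: "bar_height B < bar_height X" by simp
    define V where "V = {Y \<in> bars (A \<union> D). climbs_over Y r \<and> noncollinear Y \<and> bar_height B < bar_height Y}"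
    have "finite V" "V \<noteq> {}" using finite_bars XB XN hX unfolding V_def by auto
    then obtain Y where Y: "Y \<in> V" "\<And>Z. Z \<in> V \<Longrightarrow> bar_height Y \<le> bar_height Z"
      using finite_Min_witness[of V bar_height] by blast
    have y: "Y \<in> bars (A \<union> D)" "climbs_over Y r" "noncollinear Y" "bar_height B < bar_height Y"
      using Y(1) by (auto simp: V_def)
    have "collinear_bar f g A D Z" if Z: "Z \<in> bars (A \<union> D)" "climbs_over Y \<xi>" "climbs_over Z \<xi>"
      "bar_height B < bar_height Z" "bar_height Z < bar_height Y" for Z \<xi>
    proof (rule ccontr)
      assume "noncollinear Z"
      moreover have "climbs_over Z r"
        using climbs_over_below(1)[OF Z(1) y(1) Z(2) y(2)] Z(3,5) by simp
      ultimately have "Z \<in> V" using Z by (simp add: V_def)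
      then show False using Y(2)[of Z] Z(5) by simp
    qed
    then have "Y \<in> S" using y r(2) unfolding S_def by blast
    moreover have "Y' = Y" if Y': "Y' \<in> S" "climbs_over Y' r" for Y'
    proof -
      have y': "Y' \<in> bars (A \<union> D)" "noncollinear Y'" "bar_height B < bar_height Y'"
        "\<And>X \<xi>. X \<in> bars (A \<union> D) \<Longrightarrow> climbs_over Y' \<xi> \<Longrightarrow> climbs_over X \<xi> \<Longrightarrow>
          bar_height B < bar_height X \<Longrightarrow> bar_height X < bar_height Y' \<Longrightarrow> collinear_bar f g A D X"
        using Y'(1) unfolding S_def by blast+
      have "bar_height Y \<le> bar_height Y'" using Y(2)[of Y'] y' Y'(2) by (simp add: V_def)
      moreover have "\<not> bar_height Y < bar_height Y'" using y'(4)[OF y(1) Y'(2) y(2,4)] y(3) by blast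
      ultimately show ?thesis using bar_eqI[OF y'(1) y(1) _ Y'(2) y(2)] by simp
    qed
    ultimately show ?thesis using y(2) by blast
  qed
  then have climbed: "\<forall>r\<in>A \<union> D. climbs_at B c r \<longrightarrow> (\<exists>!B'. B' \<in> S \<and> climbs_over B' r)" by blast
  have "B' \<in> bars (A \<union> D) \<and> noncollinear B'" if "B' \<in> S" for B' using that by (simp add: S_def)
  then have "is_cover f g A D B c S"
    unfolding is_cover_def using chain climbed by (intro conjI ballI) simp_all
  then show ?thesis by (rule exI)
qed

lemma is_cover_cover:
  assumes "B \<in> bars (A \<union> D)" "discrepancy B c = 0"
  shows "is_cover f g A D B c (cover f g A D B c)"
proof -
  obtain S where S: "is_cover f g A D B c S" using cover_exists[OF assms] by blast
  then have "cover f g A D B c = S"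
    unfolding cover_def using cover_unique[OF assms(1)] by (intro the_equality) blast+
  with S show ?thesis by simp
qed

text \<open>If \<open>\<gamma>\<close> climbs over non-collinear bars above \<open>B\<close>, the lowest of them belongs to the cover,
  because a root of that bar meets the cover no later than there.\<close>

lemma bounded_by_cover_iff:
  assumes B: "B \<in> bars (A \<union> D)" and c: "discrepancy B c = 0" and \<gamma>: "climbs_at B c \<gamma>"
  shows "(\<forall>B'\<in>cover f g A D B c. bounded_by \<gamma> B') \<longleftrightarrow>
    (\<forall>X\<in>bars (A \<union> D). noncollinear X \<longrightarrow> climbs_over X \<gamma> \<longrightarrow> bar_height X \<le> bar_height B)"
proof
  note C = is_cover_cover[OF B c]
  assume *: "\<forall>X\<in>bars (A \<union> D). noncollinear X \<longrightarrow> climbs_over X \<gamma> \<longrightarrow> bar_height X \<le> bar_height B"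
  show "\<forall>B'\<in>cover f g A D B c. bounded_by \<gamma> B'"
  proof
    fix B' assume B': "B' \<in> cover f g A D B c"
    show "bounded_by \<gamma> B'"
      using cover_element(1-3)[OF B C B'] * bounded_by_iff[of B' \<gamma>] by fastforce
  qed
next
  note C = is_cover_cover[OF B c]
  assume *: "\<forall>B'\<in>cover f g A D B c. bounded_by \<gamma> B'"
  have \<gamma>B: "climbs_over B \<gamma>" "pcoeff \<gamma> (bar_height B) = c" using \<gamma> climbs_at_iff[OF B] by blast+
  define V where "V = {Y \<in> bars (A \<union> D). climbs_over Y \<gamma> \<and> noncollinear Y \<and> bar_height B < bar_height Y}"
  have "V = {}"
  proof (rule ccontr)
    assume "V \<noteq> {}"
    moreover have "finite V" using finite_bars by (simp add: V_def)
    ultimately obtain Y where Y: "Y \<in> V" "\<And>Z. Z \<in> V \<Longrightarrow> bar_height Y \<le> bar_height Z"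
      using finite_Min_witness[of V bar_height] by blast
    have y: "Y \<in> bars (A \<union> D)" "climbs_over Y \<gamma>" "noncollinear Y" "bar_height B < bar_height Y"
      using Y(1) by (auto simp: V_def)
    obtain r where "r \<in> bar_roots Y" using bar_roots_nonempty[OF y(1)] by blast
    then have r: "r \<in> A \<union> D" "climbs_over Y r" using bar_roots_iff_climbs[OF y(1)] by blast+
    have "climbs_over B r" "pcoeff r (bar_height B) = c"
      using climbs_over_below[OF B y(1) r(2) y(2)] y(4) \<gamma>B by auto
    then have "climbs_at B c r" using climbs_at_iff[OF B] by blast
    then obtain Z where Z: "Z \<in> cover f g A D B c" "climbs_over Z r"
      using C r(1) unfolding is_cover_def by blast
    note z = cover_element[OF B C Z(1)]
    have "bar_height Z \<le> bar_height Y"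
      using z(5)[OF y(1) Z(2) r(2) y(4)] y(3) by force
    then have "climbs_over Z \<gamma>"
      using climbs_over_below(1)[OF z(1) y(1) r(2) y(2)] Z(2) by blast
    then show False using * Z(1) bounded_by_iff[OF z(1)] by blast
  qed
  then show "\<forall>X\<in>bars (A \<union> D). noncollinear X \<longrightarrow> climbs_over X \<gamma> \<longrightarrow> bar_height X \<le> bar_height B"
    unfolding V_def by force
qed

text \<open>The lowest non-collinear bar which an arc climbs over is minimal, since the arc climbs over all
  bars below it too.\<close>

lemma bounded_by_minimal_iff:
  "(\<forall>B\<in>minimal_noncollinear_bars f g A D. bounded_by \<gamma> B) \<longleftrightarrow>
    (\<forall>X\<in>bars (A \<union> D). noncollinear X \<longrightarrow> \<not> climbs_over X \<gamma>)"
proof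
  assume "\<forall>X\<in>bars (A \<union> D). noncollinear X \<longrightarrow> \<not> climbs_over X \<gamma>"
  then show "\<forall>B\<in>minimal_noncollinear_bars f g A D. bounded_by \<gamma> B"
    using bounded_by_iff unfolding minimal_noncollinear_bars_def by blast
next
  assume *: "\<forall>B\<in>minimal_noncollinear_bars f g A D. bounded_by \<gamma> B"
  define V where "V = {Y \<in> bars (A \<union> D). climbs_over Y \<gamma> \<and> noncollinear Y}"
  have "V = {}"
  proof (rule ccontr)
    assume "V \<noteq> {}"
    moreover have "finite V" using finite_bars by (simp add: V_def)
    ultimately obtain Y where Y: "Y \<in> V" "\<And>Z. Z \<in> V \<Longrightarrow> bar_height Y \<le> bar_height Z"
      using finite_Min_witness[of V bar_height] by blast
    have y: "Y \<in> bars (A \<union> D)" "climbs_over Y \<gamma>" "noncollinear Y"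
      using Y(1) by (auto simp: V_def)
    have "\<not> lies_above Y Z" if Z: "Z \<in> bars (A \<union> D)" "noncollinear Z" for Z
    proof
      assume la: "lies_above Y Z"
      note z = lies_above_props[OF Z(1) la]
      have "Z \<in> V" using Z z(3)[OF y(2)] by (simp add: V_def)
      then show False using Y(2)[of Z] z(2) by simp
    qed
    then have "Y \<in> minimal_noncollinear_bars f g A D"
      using y unfolding minimal_noncollinear_bars_def by blast
    then show False using * bounded_by_iff[OF y(1)] y(2) by blast
  qed
  then show "\<forall>X\<in>bars (A \<union> D). noncollinear X \<longrightarrow> \<not> climbs_over X \<gamma>"
    unfolding V_def by blast
qed

end


section \<open>Conjugate bars\<close>

context jacobian_tree
begin

lemma galois_A: "a \<in> A \<Longrightarrow> galois j a \<in> A"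
  using np_root_galois[of f a j] by (simp add: factored_root[OF f])

lemma galois_D: "a \<in> D \<Longrightarrow> galois j a \<in> D"
  using np_root_galois[of g a j] by (simp add: factored_root[OF g])

lemma galois_roots: "r \<in> A \<union> D \<Longrightarrow> galois j r \<in> A \<union> D"
  using galois_A galois_D by blast

lemma galois_bar_bars: "B \<in> bars (A \<union> D) \<Longrightarrow> galois_bar j B \<in> bars (A \<union> D)"
  by (rule galois_bar_mem_bars[OF galois_roots])

lemma card_galois_Int:
  assumes "\<And>j a. a \<in> S \<Longrightarrow> galois j a \<in> S"
  shows "card (galois j ` T \<inter> S) = card (T \<inter> S)"
proof -
  have "galois j ` T \<inter> S = galois j ` (T \<inter> S)"
  proof
    show "galois j ` T \<inter> S \<subseteq> galois j ` (T \<inter> S)"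
    proof
      fix x assume "x \<in> galois j ` T \<inter> S"
      then obtain t where t: "t \<in> T" "x = galois j t" "x \<in> S" by blast
      then have "t \<in> S" using assms[of x "- j"] by simp
      then show "x \<in> galois j ` (T \<inter> S)" using t by blast
    qed
    show "galois j ` (T \<inter> S) \<subseteq> galois j ` T \<inter> S" using assms by blast
  qed
  then show ?thesis by (simp add: card_image inj_on_def)
qed

lemma discrepancy_galois:
  assumes B: "B \<in> bars (A \<union> D)"
  shows "discrepancy (galois_bar j B) (cis (2 * pi * (of_int j * of_rat (bar_height B))) * c)
    = discrepancy B c"
proof -
  have "card (galois j ` T \<inter> A) = card (T \<inter> A)" "card (galois j ` T \<inter> D) = card (T \<inter> D)" for T
    using card_galois_Int[of A j T] card_galois_Int[of D j T] galois_A galois_D by blast+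
  moreover have "nu f (galois_bar j B) = nu f B"
    by (rule nu_galois_bar[OF f Un_upper1 B]) (rule galois_roots galois_A, assumption)+
  moreover have "nu g (galois_bar j B) = nu g B"
    by (rule nu_galois_bar[OF g Un_upper2 B]) (rule galois_roots galois_D, assumption)+
  ultimately show ?thesis unfolding discrepancy_def trunk_over_galois by simp
qed

lemma noncollinear_galois:
  assumes B: "B \<in> bars (A \<union> D)" and N: "noncollinear B"
  shows "noncollinear (galois_bar j B)"
proof -
  obtain c where c: "trunk_over B c \<noteq> {}" "discrepancy B c \<noteq> 0"
    using N unfolding noncollinear_iff[OF B] by blast
  let ?c = "cis (2 * pi * (of_int j * of_rat (bar_height B))) * c"
  have "trunk_over (galois_bar j B) ?c \<noteq> {}" using c(1) by (simp add: trunk_over_galois)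
  moreover have "discrepancy (galois_bar j B) ?c \<noteq> 0" using c(2) by (simp add: discrepancy_galois[OF B])
  ultimately show ?thesis unfolding noncollinear_iff[OF galois_bar_bars[OF B]] by blast
qed

lemma climbs_over_galois:
  assumes B: "B \<in> bars (A \<union> D)"
  shows "climbs_over (galois_bar j B) (galois j \<xi>) \<longleftrightarrow> climbs_over B \<xi>"
proof -
  obtain r where r: "r \<in> bar_roots B" using bar_roots_nonempty[OF B] by blast
  then have jr: "galois j r \<in> bar_roots (galois_bar j B)" by simp
  show ?thesis
    unfolding climbs_over_iff(1)[OF B r] climbs_over_iff(1)[OF galois_bar_bars[OF B] jr] by simp
qed

lemma growth_points_galois:
  assumes B: "B \<in> bars (A \<union> D)"
  shows "pcoeff (galois j \<gamma>) (bar_height B) \<in> growth_points (galois_bar j B)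
    \<longleftrightarrow> pcoeff \<gamma> (bar_height B) \<in> growth_points B"
  unfolding growth_points_iff[OF B] growth_points_iff[OF galois_bar_bars[OF B]]
    pcoeff_galois trunk_over_galois by simp

text \<open>The roots of an irreducible germ form one Galois orbit, and every root of \<open>f g\<close> is a root
  of some irreducible germ; hence conjugacy of bars is the action of \<open>galois\<close> on the tree.\<close>

lemma conjugate_iff:
  assumes B: "B \<in> bars (A \<union> D)" and B': "B' \<in> bars (A \<union> D)"
  shows "conjugate B B' \<longleftrightarrow> (\<exists>j. B' = galois_bar j B)"
proof
  assume "conjugate B B'"
  then obtain p \<xi> \<xi>' where h: "bar_height B = bar_height B'" and p: "irreducible p"
    and \<xi>: "np_root p \<xi>" "climbs_over B \<xi>" and \<xi>': "np_root p \<xi>'" "climbs_over B' \<xi>'"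
    unfolding conjugate_def by blast
  obtain j where j: "\<xi>' = galois j \<xi>" using irreducible_roots_conjugate[OF p \<xi>(1) \<xi>'(1)] .
  have "climbs_over (galois_bar j B) \<xi>'" unfolding j using climbs_over_galois[OF B] \<xi>(2) by simp
  then have "B' = galois_bar j B"
    using bar_eqI[OF B' galois_bar_bars[OF B] _ \<xi>'(2)] h by simp
  then show "\<exists>j. B' = galois_bar j B" by (rule exI)
next
  assume "\<exists>j. B' = galois_bar j B"
  then obtain j where j: "B' = galois_bar j B" by blast
  obtain r where "r \<in> bar_roots B" using bar_roots_nonempty[OF B] by blast
  then have r: "r \<in> A \<union> D" "climbs_over B r" using bar_roots_iff_climbs[OF B] by blast+
  have "\<exists>F. F \<noteq> 0 \<and> np_root F r"
  proof -
    have nz: "F \<noteq> 0" if "factored F E S" for F E S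
    proof
      assume "F = 0"
      have "inj (\<lambda>z. monomial z 1)"
      proof (rule injI)
        fix a b :: complex assume "monomial a 1 = monomial b 1"
        then have "pcoeff (monomial a 1) 1 = pcoeff (monomial b 1) 1" by simp
        then show "a = b" by (simp add: pcoeff_monomial)
      qed
      then have "infinite (range (\<lambda>z. monomial z 1))"
        using finite_imageD infinite_UNIV_char_0 by blast
      moreover have "finite S" using that by (simp add: factored_def)
      ultimately have "\<not> range (\<lambda>z. monomial z 1) \<subseteq> S" using finite_subset by blast
      then obtain z where "monomial z 1 \<notin> S" by blast
      moreover have "pos (monomial z 1)" by (simp add: pos_def pcoeff_monomial)
      ultimately have "peval (of_germ F) (monomial z 1) \<noteq> 0" using factored_eval(1)[OF that] by blast
      then show False using \<open>F = 0\<close> peval_const[of "monomial z 1" 0] \<open>pos (monomial z 1)\<close> by simp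
    qed
    show ?thesis using r(1) nz[OF f] nz[OF g] factored_root[OF f] factored_root[OF g] by blast
  qed
  then obtain F where F: "F \<noteq> 0" "np_root F r" by blast
  have "conv_puiseux r" using germ_root_factorization[OF F(1)] F(2) by metis
  moreover have "pos r" using r(1) by (rule roots_pos)
  ultimately obtain w where w: "irreducible w" "\<And>\<xi>. np_root w \<xi> \<longleftrightarrow> (\<exists>j. \<xi> = galois j r)"
    using orbit_germ by metis
  have "np_root w r" unfolding w(2) by (rule exI[of _ 0]) simp
  moreover have "np_root w (galois j r)" unfolding w(2) by blast
  moreover have "climbs_over B' (galois j r)" unfolding j using climbs_over_galois[OF B] r(2) by simp
  ultimately show "conjugate B B'" unfolding conjugate_def using w(1) r(2) j by auto
qed

definition galois_class :: "bar \<Rightarrow> bar set" where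
  "galois_class B = range (\<lambda>j. galois_bar j B)"

lemma galois_class_self: "B \<in> galois_class B"
  unfolding galois_class_def by (rule range_eqI[of _ _ 0]) simp

lemma galois_class_closed: "B' \<in> galois_class B \<Longrightarrow> galois_bar j B' \<in> galois_class B"
  unfolding galois_class_def by auto

lemma galois_class_eq:
  assumes "B' \<in> galois_class B"
  shows "galois_class B' = galois_class B"
proof -
  obtain i where i: "B' = galois_bar i B" using assms by (auto simp: galois_class_def)
  show ?thesis
  proof
    show "galois_class B' \<subseteq> galois_class B" unfolding galois_class_def i by auto
    show "galois_class B \<subseteq> galois_class B'"
    proof
      fix X assume "X \<in> galois_class B"
      then obtain j where "X = galois_bar j B" by (auto simp: galois_class_def)
      then have "X = galois_bar (j - i) B'" by (simp add: i)
      then show "X \<in> galois_class B'" by (simp add: galois_class_def)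
    qed
  qed
qed

lemma bar_classes_iff: "\<B> \<in> bar_classes (A \<union> D) \<longleftrightarrow> (\<exists>B\<in>bars (A \<union> D). \<B> = galois_class B)"
proof -
  have "{(B, B'). B \<in> bars (A \<union> D) \<and> B' \<in> bars (A \<union> D) \<and> conjugate B B'} `` {B} = galois_class B"
    if B: "B \<in> bars (A \<union> D)" for B
    using conjugate_iff[OF B] galois_bar_bars[OF B] B by (auto simp: galois_class_def)
  then show ?thesis unfolding bar_classes_def quotient_def by auto
qed

lemma class_height_galois_class: "class_height (galois_class B) = bar_height B"
proof -
  have "bar_height ` galois_class B = {bar_height B}"
    using galois_class_self[of B] by (auto simp: galois_class_def)
  then show ?thesis by (simp add: class_height_def)
qed

lemma noncollinear_classes_iff:
  "\<B> \<in> noncollinear_classes f g A D \<longleftrightarrow> (\<exists>B\<in>bars (A \<union> D). noncollinear B \<and> \<B> = galois_class B)"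
proof -
  have "\<forall>B'\<in>galois_class B. noncollinear B'" if "B \<in> bars (A \<union> D)" "noncollinear B" for B
    using noncollinear_galois[OF that] by (auto simp: galois_class_def)
  then show ?thesis
    unfolding noncollinear_classes_def mem_Collect_eq bar_classes_iff
    using galois_class_self by blast
qed


section \<open>The decomposition of the Jacobian\<close>

definition top_bar :: "bar \<Rightarrow> puiseux \<Rightarrow> bool" where
  "top_bar B \<gamma> \<longleftrightarrow> B \<in> bars (A \<union> D) \<and> noncollinear B \<and> climbs_over B \<gamma> \<and>
    (\<forall>X\<in>bars (A \<union> D). noncollinear X \<longrightarrow> climbs_over X \<gamma> \<longrightarrow> bar_height X \<le> bar_height B)"

lemma top_bar_unique: "top_bar B \<gamma> \<Longrightarrow> top_bar B' \<gamma> \<Longrightarrow> B = B'"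
  unfolding top_bar_def using bar_eqI[of B B' \<gamma>] by (meson order_antisym)

lemma top_bar_exists_iff:
  "(\<exists>B. top_bar B \<gamma>) \<longleftrightarrow> (\<exists>X\<in>bars (A \<union> D). noncollinear X \<and> climbs_over X \<gamma>)"
proof
  assume ex: "\<exists>X\<in>bars (A \<union> D). noncollinear X \<and> climbs_over X \<gamma>"
  let ?S = "{X \<in> bars (A \<union> D). noncollinear X \<and> climbs_over X \<gamma>}"
  have "finite ?S" "?S \<noteq> {}" using finite_bars ex by auto
  then obtain B where "B \<in> ?S" "\<And>X. X \<in> ?S \<Longrightarrow> bar_height X \<le> bar_height B"
    using finite_Max_witness[of ?S bar_height] by blast
  then have "top_bar B \<gamma>" unfolding top_bar_def by blast
  then show "\<exists>B. top_bar B \<gamma>" by (rule exI)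
qed (auto simp: top_bar_def)

lemma top_bar_galois:
  assumes "top_bar B \<gamma>"
  shows "top_bar (galois_bar j B) (galois j \<gamma>)"
proof -
  have B: "B \<in> bars (A \<union> D)" "noncollinear B" "climbs_over B \<gamma>"
    and top: "\<And>X. X \<in> bars (A \<union> D) \<Longrightarrow> noncollinear X \<Longrightarrow> climbs_over X \<gamma> \<Longrightarrow> bar_height X \<le> bar_height B"
    using assms unfolding top_bar_def by blast+
  have "bar_height X \<le> bar_height (galois_bar j B)"
    if X: "X \<in> bars (A \<union> D)" "noncollinear X" "climbs_over X (galois j \<gamma>)" for X
  proof -
    have "climbs_over (galois_bar (- j) X) (galois (- j) (galois j \<gamma>))"
      using climbs_over_galois[OF X(1)] X(3) by blast
    then have "climbs_over (galois_bar (- j) X) \<gamma>" by simp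
    then show ?thesis
      using top[OF galois_bar_bars[OF X(1)] noncollinear_galois[OF X(1,2)]] by simp
  qed
  then show ?thesis
    unfolding top_bar_def
    using galois_bar_bars[OF B(1)] noncollinear_galois[OF B(1,2)] climbs_over_galois[OF B(1)] B(3)
    by blast
qed

abbreviation J :: germ where "J \<equiv> germ_jacobian f g"

lemma jacobian_root_not_root: "np_root J \<gamma> \<Longrightarrow> \<gamma> \<notin> A \<union> D"
proof
  assume J: "np_root J \<gamma>" and "\<gamma> \<in> A \<union> D"
  then consider "\<gamma> \<in> A" "\<gamma> \<notin> D" | "\<gamma> \<in> D" "\<gamma> \<notin> A" using disj by blast
  then show False
  proof cases
    case 1
    then show ?thesis using jacobian_nonzero_at_root[OF f g _ _ g0] J by blast
  next
    case 2
    then have "\<not> np_root (germ_jacobian g f) \<gamma>" using jacobian_nonzero_at_root[OF g f _ _ f0] by blast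
    then show ?thesis using J unfolding germ_jacobian_swap[of f g] np_root_uminus by blast
  qed
qed

lemma jacobian_nonzero: "J \<noteq> 0"
proof
  assume "J = 0"
  obtain r where r: "r \<in> A \<union> D" using nonempty by blast
  then have "pos r" by (rule roots_pos)
  then have "np_root J r" using \<open>J = 0\<close> peval_const[of r 0] by (simp add: np_root_iff)
  then show False using jacobian_root_not_root r by blast
qed

lemma polar_root_iff: "polar_root f g \<gamma> \<longleftrightarrow> np_root J \<gamma>"
proof
  assume J: "np_root J \<gamma>"
  then have "pos \<gamma>" "\<gamma> \<notin> A" "\<gamma> \<notin> D" using jacobian_root_not_root by (auto simp: np_root_iff)
  then show "polar_root f g \<gamma>"
    using J factored_eval(1)[OF f] factored_eval(1)[OF g]
    by (simp add: polar_root_def subst_eq_peval)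
qed (simp add: polar_root_def)

text \<open>At a non-collinear point the bar on top of the trunk is non-collinear too, and higher, so that
  \<open>\<gamma>\<close> does not climb over it; but then the Jacobian does not vanish along \<open>\<gamma>\<close>.\<close>

lemma top_bar_collinear_point:
  assumes J: "np_root J \<gamma>" and T: "top_bar B \<gamma>" and c: "pcoeff \<gamma> (bar_height B) \<in> growth_points B"
  shows "discrepancy B (pcoeff \<gamma> (bar_height B)) = 0"
proof (rule ccontr)
  let ?c = "pcoeff \<gamma> (bar_height B)"
  assume d: "discrepancy B ?c \<noteq> 0"
  have B: "B \<in> bars (A \<union> D)" "climbs_over B \<gamma>"
    and top: "\<And>X. X \<in> bars (A \<union> D) \<Longrightarrow> noncollinear X \<Longrightarrow> climbs_over X \<gamma> \<Longrightarrow> bar_height X \<le> bar_height B"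
    using T unfolding top_bar_def by blast+
  have "\<not> climbs_over B' \<gamma>" if "postbar_at B ?c B'" for B'
    using top[OF postbar_at_props(1)[OF B(1) that] postbar_noncollinear[OF B(1) that d]]
      postbar_at_props(3)[OF B(1) that] by auto
  moreover have "pos \<gamma>" using J by (simp add: np_root_iff)
  moreover have "trunk_over B ?c \<noteq> {}" using c growth_points_iff[OF B(1)] by blast
  ultimately have "\<not> np_root J \<gamma>"
    using no_root_at_noncollinear_point[OF B _ jacobian_root_not_root[OF J] refl _ d] by blast
  then show False using J by blast
qed

text \<open>The ground bar has a single trunk, at \<open>0\<close>, and every arc of positive order passes there. If the
  ground bar is non-collinear, this point is non-collinear.\<close>

lemma top_bar_height:
  assumes J: "np_root J \<gamma>" and T: "top_bar B \<gamma>"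
  shows "bar_height B > 0"
proof (rule ccontr)
  assume h: "\<not> bar_height B > 0"
  have B: "B \<in> bars (A \<union> D)" "noncollinear B" using T unfolding top_bar_def by blast+
  have h0: "bar_height B = 0" using h bar_height_nonneg[OF B(1)] by simp
  obtain c where c: "trunk_over B c \<noteq> {}" "discrepancy B c \<noteq> 0"
    using B(2) unfolding noncollinear_iff[OF B(1)] by blast
  then obtain r where "r \<in> bar_roots B" "pcoeff r 0 = c" by (auto simp: trunk_over_def h0)
  then have "c = 0" using bar_roots_subset[OF B(1)] roots_pos by (auto simp: pos_def)
  moreover have "pcoeff \<gamma> (bar_height B) = 0" using J h0 by (simp add: np_root_iff pos_def)
  ultimately show False
    using top_bar_collinear_point[OF J T] c growth_points_iff[OF B(1)] by simp
qed

text \<open>A higher bar under \<open>\<gamma>\<close> would stand on a trunk which grows on \<open>B\<close> at the point of \<open>\<gamma>\<close>.\<close>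

lemma leaves_tree_iff_top:
  assumes B: "B \<in> bars (A \<union> D)" "noncollinear B"
  shows "leaves_tree_on B \<gamma> \<longleftrightarrow> top_bar B \<gamma> \<and> pcoeff \<gamma> (bar_height B) \<notin> growth_points B"
proof
  assume "leaves_tree_on B \<gamma>"
  then have \<gamma>: "climbs_over B \<gamma>" "pcoeff \<gamma> (bar_height B) \<notin> growth_points B"
    using leaves_tree_on_iff[OF B(1)] by blast+
  have "bar_height X \<le> bar_height B" if X: "X \<in> bars (A \<union> D)" "climbs_over X \<gamma>" for X
  proof (rule ccontr)
    assume "\<not> bar_height X \<le> bar_height B"
    then have "bar_height B < bar_height X" by simp
    then obtain B1 where "postbar_at B (pcoeff \<gamma> (bar_height B)) B1"
      using postbar_chain[where P = "\<lambda>_. True", OF X(1) B(1) \<gamma>(1) X(2)] by blast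
    then show False using postbar_at_props(4)[OF B(1)] \<gamma>(2) growth_points_iff[OF B(1)] by blast
  qed
  then show "top_bar B \<gamma> \<and> pcoeff \<gamma> (bar_height B) \<notin> growth_points B"
    unfolding top_bar_def using B \<gamma> by blast
qed (auto simp: leaves_tree_on_iff[OF B(1)] top_bar_def)

lemma climbs_at_bounded_iff_top:
  assumes B: "B \<in> bars (A \<union> D)" "noncollinear B" and J: "np_root J \<gamma>"
  shows "(\<exists>c\<in>collinear_points f g A D B. climbs_at B c \<gamma> \<and> (\<forall>B'\<in>cover f g A D B c. bounded_by \<gamma> B'))
    \<longleftrightarrow> top_bar B \<gamma> \<and> pcoeff \<gamma> (bar_height B) \<in> growth_points B"
proof
  assume "\<exists>c\<in>collinear_points f g A D B. climbs_at B c \<gamma> \<and> (\<forall>B'\<in>cover f g A D B c. bounded_by \<gamma> B')"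
  then obtain c where c: "c \<in> growth_points B" "discrepancy B c = 0" "climbs_at B c \<gamma>"
    "\<forall>B'\<in>cover f g A D B c. bounded_by \<gamma> B'"
    unfolding Bex_def collinear_points_iff[OF B(1)] by blast
  have at: "climbs_over B \<gamma>" "pcoeff \<gamma> (bar_height B) = c" using c(3) climbs_at_iff[OF B(1)] by blast+
  have "\<forall>X\<in>bars (A \<union> D). noncollinear X \<longrightarrow> climbs_over X \<gamma> \<longrightarrow> bar_height X \<le> bar_height B"
    using c(4) unfolding bounded_by_cover_iff[OF B(1) c(2,3)] .
  then have "top_bar B \<gamma>" unfolding top_bar_def by (intro conjI B at(1))
  then show "top_bar B \<gamma> \<and> pcoeff \<gamma> (bar_height B) \<in> growth_points B"
    using at(2) c(1) by simp
next
  assume T: "top_bar B \<gamma> \<and> pcoeff \<gamma> (bar_height B) \<in> growth_points B"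
  let ?c = "pcoeff \<gamma> (bar_height B)"
  have d: "discrepancy B ?c = 0" using top_bar_collinear_point[OF J] T by blast
  have at: "climbs_at B ?c \<gamma>" using T climbs_at_iff[OF B(1)] unfolding top_bar_def by blast
  have "\<forall>B'\<in>cover f g A D B ?c. bounded_by \<gamma> B'"
    unfolding bounded_by_cover_iff[OF B(1) d at] using T unfolding top_bar_def by (elim conjE)
  moreover have "?c \<in> collinear_points f g A D B" using collinear_points_iff[OF B(1)] T d by blast
  ultimately show "\<exists>c\<in>collinear_points f g A D B. climbs_at B c \<gamma> \<and>
      (\<forall>B'\<in>cover f g A D B c. bounded_by \<gamma> B')"
    using at by blast
qed

definition P_roots :: "bar set \<Rightarrow> puiseux set" where
  "P_roots \<B> = {\<gamma>. np_root J \<gamma> \<and>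
    (\<exists>B\<in>\<B>. top_bar B \<gamma> \<and> pcoeff \<gamma> (bar_height B) \<notin> growth_points B)}"

definition Q_roots :: "bar set \<Rightarrow> puiseux set" where
  "Q_roots \<B> = {\<gamma>. np_root J \<gamma> \<and>
    (\<exists>B\<in>\<B>. top_bar B \<gamma> \<and> pcoeff \<gamma> (bar_height B) \<in> growth_points B)}"

definition ground_roots :: "puiseux set" where
  "ground_roots = {\<gamma>. np_root J \<gamma> \<and> \<not> (\<exists>B. top_bar B \<gamma>)}"

definition root_product :: "puiseux set \<Rightarrow> puiseux fps" where
  "root_product S = (\<Prod>\<gamma>\<in>S. root_factor \<gamma> ^ root_multiplicity J \<gamma>)"

lemma root_product_germ:
  assumes "S \<subseteq> {\<gamma>. np_root J \<gamma>}" "\<And>j \<gamma>. \<gamma> \<in> S \<Longrightarrow> galois j \<gamma> \<in> S"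
  shows "root_product S \<in> range of_germ"
proof -
  have "conv_puiseux \<gamma>" if "np_root J \<gamma>" for \<gamma>
    using germ_root_factorization[OF jacobian_nonzero] that by metis
  then show ?thesis
    unfolding root_product_def using assms
    by (intro germ_of_invariant_roots) (auto simp: root_multiplicity_galois)
qed

lemma class_bars:
  assumes "\<B> \<in> noncollinear_classes f g A D" "B \<in> \<B>"
  shows "B \<in> bars (A \<union> D)" "noncollinear B" "galois_bar j B \<in> \<B>"
proof -
  obtain B0 where B0: "B0 \<in> bars (A \<union> D)" "noncollinear B0" "\<B> = galois_class B0"
    using assms(1) unfolding noncollinear_classes_iff by blast
  then obtain i where i: "B = galois_bar i B0" using assms(2) by (auto simp: galois_class_def)
  show "B \<in> bars (A \<union> D)" unfolding i by (rule galois_bar_bars[OF B0(1)])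
  show "noncollinear B" unfolding i by (rule noncollinear_galois[OF B0(1,2)])
  show "galois_bar j B \<in> \<B>" using galois_class_closed assms(2) B0(3) by blast
qed

lemma P_factor_eq:
  assumes "\<B> \<in> noncollinear_classes f g A D"
  shows "P_factor f g \<B> = root_product (P_roots \<B>)"
proof -
  have "(\<exists>B\<in>\<B>. leaves_tree_on B \<gamma>) \<longleftrightarrow>
      (\<exists>B\<in>\<B>. top_bar B \<gamma> \<and> pcoeff \<gamma> (bar_height B) \<notin> growth_points B)" for \<gamma>
    using leaves_tree_iff_top[OF class_bars(1,2)[OF assms]] by blast
  then show ?thesis
    unfolding P_factor_def polar_product_def root_product_def P_roots_def polar_root_iff by simp
qed

lemma Q_factor_eq:
  assumes "\<B> \<in> noncollinear_classes f g A D"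
  shows "Q_factor f g A D \<B> = root_product (Q_roots \<B>)"
proof -
  have "np_root J \<gamma> \<and> (\<exists>B\<in>\<B>. \<exists>c\<in>collinear_points f g A D B. climbs_at B c \<gamma> \<and>
        (\<forall>B'\<in>cover f g A D B c. bounded_by \<gamma> B')) \<longleftrightarrow>
      np_root J \<gamma> \<and> (\<exists>B\<in>\<B>. top_bar B \<gamma> \<and> pcoeff \<gamma> (bar_height B) \<in> growth_points B)" for \<gamma>
    using climbs_at_bounded_iff_top[OF class_bars(1,2)[OF assms]] by blast
  then show ?thesis
    unfolding Q_factor_def polar_product_def root_product_def Q_roots_def polar_root_iff by simp
qed

lemma Q_ground_eq: "Q_ground f g A D = root_product ground_roots"
proof -
  have "(\<forall>B\<in>minimal_noncollinear_bars f g A D. bounded_by \<gamma> B) \<longleftrightarrow> \<not> (\<exists>B. top_bar B \<gamma>)" for \<gamma>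
    unfolding bounded_by_minimal_iff top_bar_exists_iff by blast
  then show ?thesis
    unfolding Q_ground_def polar_product_def root_product_def ground_roots_def polar_root_iff by simp
qed

lemma P_roots_galois:
  assumes C: "\<B> \<in> noncollinear_classes f g A D" and "\<gamma> \<in> P_roots \<B>"
  shows "galois j \<gamma> \<in> P_roots \<B>"
proof -
  obtain B where B: "B \<in> \<B>" "np_root J \<gamma>" "top_bar B \<gamma>" "pcoeff \<gamma> (bar_height B) \<notin> growth_points B"
    using assms(2) unfolding P_roots_def by blast
  show ?thesis
    unfolding P_roots_def
    using np_root_galois[OF B(2)] top_bar_galois[OF B(3), of j] class_bars(3)[OF C B(1), of j]
      growth_points_galois[OF class_bars(1)[OF C B(1)], of j \<gamma>] B(4)
    by (auto intro!: bexI[of _ "galois_bar j B"])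
qed

lemma Q_roots_galois:
  assumes C: "\<B> \<in> noncollinear_classes f g A D" and "\<gamma> \<in> Q_roots \<B>"
  shows "galois j \<gamma> \<in> Q_roots \<B>"
proof -
  obtain B where B: "B \<in> \<B>" "np_root J \<gamma>" "top_bar B \<gamma>" "pcoeff \<gamma> (bar_height B) \<in> growth_points B"
    using assms(2) unfolding Q_roots_def by blast
  show ?thesis
    unfolding Q_roots_def
    using np_root_galois[OF B(2)] top_bar_galois[OF B(3), of j] class_bars(3)[OF C B(1), of j]
      growth_points_galois[OF class_bars(1)[OF C B(1)], of j \<gamma>] B(4)
    by (auto intro!: bexI[of _ "galois_bar j B"])
qed

lemma ground_roots_galois:
  assumes "\<gamma> \<in> ground_roots"
  shows "galois j \<gamma> \<in> ground_roots"
proof -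
  have "\<not> top_bar B (galois j \<gamma>)" for B
  proof
    assume "top_bar B (galois j \<gamma>)"
    then have "top_bar (galois_bar (- j) B) (galois (- j) (galois j \<gamma>))" by (rule top_bar_galois)
    then show False using assms by (auto simp: ground_roots_def)
  qed
  then show ?thesis using assms np_root_galois by (simp add: ground_roots_def)
qed

definition positive_classes :: "bar set set" where
  "positive_classes = {\<B> \<in> noncollinear_classes f g A D. class_height \<B> > 0}"

lemma finite_positive_classes: "finite positive_classes"
proof (rule finite_subset)
  show "positive_classes \<subseteq> Pow (bars (A \<union> D))"
    using class_bars(1) unfolding positive_classes_def by blast
qed (use finite_bars in simp)

lemma top_bar_class:
  assumes "np_root J \<gamma>" "top_bar B \<gamma>"
  shows "galois_class B \<in> positive_classes"
  using top_bar_height[OF assms] assms(2)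
  unfolding positive_classes_def mem_Collect_eq noncollinear_classes_iff class_height_galois_class
    top_bar_def by blast

lemma class_eq_of_member:
  assumes "\<B> \<in> positive_classes" "B \<in> \<B>"
  shows "\<B> = galois_class B"
  using assms galois_class_eq unfolding positive_classes_def mem_Collect_eq noncollinear_classes_iff
  by metis

lemma finite_jacobian_roots: "finite {\<gamma>. np_root J \<gamma>}"
  using germ_root_factorization[OF jacobian_nonzero] by metis

text \<open>The highest non-collinear bar under a polar root is unique and of positive height, so the
  root is counted in exactly one factor.\<close>

lemma root_product_decomposition:
  "root_product {\<gamma>. np_root J \<gamma>} = root_product ground_roots
    * (\<Prod>\<B>\<in>positive_classes. root_product (P_roots \<B>) * root_product (Q_roots \<B>))"
proof -
  let ?C = "\<lambda>\<B>. P_roots \<B> \<union> Q_roots \<B>"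
  have C: "\<gamma> \<in> ?C \<B> \<longleftrightarrow> np_root J \<gamma> \<and> (\<exists>B\<in>\<B>. top_bar B \<gamma>)" for \<gamma> \<B>
    unfolding P_roots_def Q_roots_def by blast
  have finC: "finite (?C \<B>)" for \<B>
    by (rule finite_subset[OF _ finite_jacobian_roots]) (use C in blast)
  have disjC: "?C \<B> \<inter> ?C \<B>' = {}" if \<B>: "\<B> \<in> positive_classes" "\<B>' \<in> positive_classes" "\<B> \<noteq> \<B>'" for \<B> \<B>'
  proof (rule ccontr)
    assume "?C \<B> \<inter> ?C \<B>' \<noteq> {}"
    then obtain \<gamma> where "\<gamma> \<in> ?C \<B>" "\<gamma> \<in> ?C \<B>'" by blast
    then obtain B B' where B: "B \<in> \<B>" "top_bar B \<gamma>" "B' \<in> \<B>'" "top_bar B' \<gamma>" unfolding C by blast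
    then have "B = B'" using top_bar_unique by blast
    then show False using class_eq_of_member[OF \<B>(1) B(1)] class_eq_of_member[OF \<B>(2) B(3)] \<B>(3) by simp
  qed
  have disjPQ: "P_roots \<B> \<inter> Q_roots \<B> = {}" for \<B>
    unfolding P_roots_def Q_roots_def using top_bar_unique by blast
  have all: "{\<gamma>. np_root J \<gamma>} = ground_roots \<union> (\<Union>\<B>\<in>positive_classes. ?C \<B>)"
  proof (intro set_eqI iffI)
    fix \<gamma> assume "\<gamma> \<in> {\<gamma>. np_root J \<gamma>}"
    then have J: "np_root J \<gamma>" by simp
    show "\<gamma> \<in> ground_roots \<union> (\<Union>\<B>\<in>positive_classes. ?C \<B>)"
    proof (cases "\<exists>B. top_bar B \<gamma>")
      case True
      then obtain B where B: "top_bar B \<gamma>" by blast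
      have "\<gamma> \<in> ?C (galois_class B)" unfolding C using J B galois_class_self by blast
      then show ?thesis using top_bar_class[OF J B] by blast
    next
      case False
      then show ?thesis using J by (simp add: ground_roots_def)
    qed
  next
    fix \<gamma> assume "\<gamma> \<in> ground_roots \<union> (\<Union>\<B>\<in>positive_classes. ?C \<B>)"
    then show "\<gamma> \<in> {\<gamma>. np_root J \<gamma>}" unfolding ground_roots_def P_roots_def Q_roots_def by blast
  qed
  have fin0: "finite ground_roots"
    by (rule finite_subset[OF _ finite_jacobian_roots]) (auto simp: ground_roots_def)
  have finU: "finite (\<Union>\<B>\<in>positive_classes. ?C \<B>)" using finite_positive_classes finC by blast
  have disj0: "ground_roots \<inter> (\<Union>\<B>\<in>positive_classes. ?C \<B>) = {}"
    unfolding ground_roots_def P_roots_def Q_roots_def by blast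
  have "root_product (\<Union>\<B>\<in>positive_classes. ?C \<B>) = (\<Prod>\<B>\<in>positive_classes. root_product (?C \<B>))"
    unfolding root_product_def
    by (rule prod.UNION_disjoint[OF finite_positive_classes]) (use finC disjC in blast)+
  also have "\<dots> = (\<Prod>\<B>\<in>positive_classes. root_product (P_roots \<B>) * root_product (Q_roots \<B>))"
  proof (intro prod.cong refl)
    fix \<B>
    show "root_product (?C \<B>) = root_product (P_roots \<B>) * root_product (Q_roots \<B>)"
      unfolding root_product_def using finC[of \<B>] disjPQ[of \<B>]
      by (intro prod.union_disjoint) auto
  qed
  finally have classes: "root_product (\<Union>\<B>\<in>positive_classes. ?C \<B>)
      = (\<Prod>\<B>\<in>positive_classes. root_product (P_roots \<B>) * root_product (Q_roots \<B>))" .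
  have "root_product (ground_roots \<union> (\<Union>\<B>\<in>positive_classes. ?C \<B>))
      = root_product ground_roots * root_product (\<Union>\<B>\<in>positive_classes. ?C \<B>)"
    unfolding root_product_def by (rule prod.union_disjoint[OF fin0 finU disj0])
  then show ?thesis unfolding all classes .
qed

theorem jacobian_decomposition:
  "(\<forall>\<B>\<in>positive_classes. Q_factor f g A D \<B> \<in> range of_germ) \<and> Q_ground f g A D \<in> range of_germ \<and>
    (\<forall>\<B>\<in>positive_classes. P_factor f g \<B> \<in> range of_germ) \<and>
    (\<exists>v E. v dvd 1 \<and> of_germ J = of_germ (v * germ_y ^ E) * Q_ground f g A D
      * (\<Prod>\<B>\<in>positive_classes. P_factor f g \<B> * Q_factor f g A D \<B>))"
proof (intro conjI ballI)
  fix \<B> assume "\<B> \<in> positive_classes"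
  then have C: "\<B> \<in> noncollinear_classes f g A D" by (simp add: positive_classes_def)
  show "Q_factor f g A D \<B> \<in> range of_germ"
    unfolding Q_factor_eq[OF C]
    by (rule root_product_germ[OF _ Q_roots_galois[OF C]]) (auto simp: Q_roots_def)
  show "P_factor f g \<B> \<in> range of_germ"
    unfolding P_factor_eq[OF C]
    by (rule root_product_germ[OF _ P_roots_galois[OF C]]) (auto simp: P_roots_def)
next
  show "Q_ground f g A D \<in> range of_germ"
    unfolding Q_ground_eq
    by (rule root_product_germ[OF _ ground_roots_galois]) (auto simp: ground_roots_def)
next
  obtain v E where v: "v dvd 1"
    "of_germ J = of_germ (v * germ_y ^ E) * root_product {\<gamma>. np_root J \<gamma>}"
    using germ_root_factorization[OF jacobian_nonzero] unfolding root_product_def by metis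
  have "(\<Prod>\<B>\<in>positive_classes. P_factor f g \<B> * Q_factor f g A D \<B>)
      = (\<Prod>\<B>\<in>positive_classes. root_product (P_roots \<B>) * root_product (Q_roots \<B>))"
    by (intro prod.cong refl) (simp add: positive_classes_def P_factor_eq Q_factor_eq)
  then have "of_germ J = of_germ (v * germ_y ^ E) * Q_ground f g A D
      * (\<Prod>\<B>\<in>positive_classes. P_factor f g \<B> * Q_factor f g A D \<B>)"
    unfolding v(2) root_product_decomposition Q_ground_eq by (simp only: mult.assoc)
  with v(1) show "\<exists>v E. v dvd 1 \<and> of_germ J = of_germ (v * germ_y ^ E) * Q_ground f g A D
      * (\<Prod>\<B>\<in>positive_classes. P_factor f g \<B> * Q_factor f g A D \<B>)"
    by blast
qed

end

lemma factored_list: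
  assumes "u dvd 1" "of_germ F = of_germ (u * germ_y ^ E) * (\<Prod>a\<leftarrow>as. root_factor a)"
    "distinct as" "\<And>a. a \<in> set as \<Longrightarrow> pos a"
  shows "factored F E (set as)"
  unfolding factored_def using assms by (auto simp: prod.distinct_set_conv_list)

theorem theoremF:
  fixes f g u u' :: germ and E1 E2 :: nat and \<alpha> \<beta> :: "puiseux list"
  assumes "germ_coeff f 0 0 = 0" and "germ_coeff g 0 0 = 0"
    and "u dvd 1" and "u' dvd 1"
    and "of_germ f = of_germ (u * germ_y ^ E1) * (\<Prod>a\<leftarrow>\<alpha>. root_factor a)"
    and "of_germ g = of_germ (u' * germ_y ^ E2) * (\<Prod>b\<leftarrow>\<beta>. root_factor b)"
    and "\<forall>r\<in>set (\<alpha> @ \<beta>). 0 < ord_y r"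
    and "distinct (\<alpha> @ \<beta>)"
    and "length \<alpha> + length \<beta> \<ge> 1"
  defines "N \<equiv> {\<B> \<in> noncollinear_classes f g (set \<alpha>) (set \<beta>). class_height \<B> > 0}"
    and "P \<equiv> P_factor f g"
    and "Q \<equiv> Q_factor f g (set \<alpha>) (set \<beta>)"
    and "Q0 \<equiv> Q_ground f g (set \<alpha>) (set \<beta>)"
  shows "(\<forall>\<B>\<in>N. Q \<B> \<in> range of_germ) \<and> Q0 \<in> range of_germ \<and>
         (\<forall>\<B>\<in>N. P \<B> \<in> range of_germ) \<and>
         (\<exists>(v :: germ) (E :: nat). v dvd 1 \<and>
            of_germ (germ_jacobian f g) = of_germ (v * germ_y ^ E) * Q0 * (\<Prod>\<B>\<in>N. P \<B> * Q \<B>))"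
proof -
  interpret jacobian_tree f g E1 E2 "set \<alpha>" "set \<beta>"
  proof
    show "factored f E1 (set \<alpha>)"
      using assms(3,5,7,8) by (intro factored_list) (auto simp: zero_less_ord_y_iff)
    show "factored g E2 (set \<beta>)"
      using assms(4,6,7,8) by (intro factored_list) (auto simp: zero_less_ord_y_iff)
    show "set \<alpha> \<inter> set \<beta> = {}" using assms(8) by auto
    show "set \<alpha> \<union> set \<beta> \<noteq> {}" using assms(9) by auto
  qed (rule assms)+
  show ?thesis
    using jacobian_decomposition unfolding N_def P_def Q_def Q0_def positive_classes_def .
qed

end
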